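(* Let $R$ be a commutative, connected (i.e. its only idempotents are $0$ and $1$) Noetherian ring, and let $B$ be an $R$-algebra which is a finitely generated projective $R$-module of constant rank. Suppose there exists $a \in R$ such that $a(a-1)$ is a nonzerodivisor in $R$. Then the following are equivalent: (i) $\deg_R(B)=2$; (ii) $\operatorname{gdeg}_R(B)=2$; (iii) $B \neq R$ and $B$ has a standard involution.
   Context: An $R$-algebra is an associative ring $B$ with $1$ together with an embedding $R \hookrightarrow B$ of rings (sending $1$ to $1$) whose image is central; $R$ is identified with its image. The degree $\deg_R(x)$ of $x\in B$ is the smallest positive integer $d$ such that $x$ satisfies a monic polynomial of degree $d$ with coefficients in $R$. The degree $\deg_R(B)$ is the smallest positive integer $n$ such that every element of $B$ has degree at most $n$. The geometric degree $\operatorname{gdeg}_R(B)$ is the maximum of $\deg_S(B\otimes_R S)$ over all ring homomorphisms $R\to S$ with $S$ a connected Noetherian commutative ring. An involution on $B$ is an $R$-linear map $x\mapsto \overline{x}$ with $\overline{1}=1$, $\overline{xy}=\overline{y}\,\overline{x}$ and $\overline{\overline{x}}=x$ for all $x,y\in B$; it is standard if $x\overline{x}\in R$ for all $x\in B$. *)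

theory Defs
  imports
    "HOL-Algebra.Ring_Divisibility"
    "HOL-Algebra.Free_Abelian_Groups"
    "HOL-Library.Extended_Nat"
begin

section \<open>Rings and modules\<close>

text \<open>The zero ring satisfies this definition too. Its algebras have degree 1.\<close>

definition connected_ring :: "('a, 'm) ring_scheme \<Rightarrow> bool" where
  "connected_ring R \<longleftrightarrow> (\<forall>e\<in>carrier R. e \<otimes>\<^bsub>R\<^esub> e = e \<longrightarrow> e = \<zero>\<^bsub>R\<^esub> \<or> e = \<one>\<^bsub>R\<^esub>)"

definition nonzerodivisor :: "('a, 'm) ring_scheme \<Rightarrow> 'a \<Rightarrow> bool" where
  "nonzerodivisor R a \<longleftrightarrow>
     a \<in> carrier R \<and> (\<forall>x\<in>carrier R. a \<otimes>\<^bsub>R\<^esub> x = \<zero>\<^bsub>R\<^esub> \<longrightarrow> x = \<zero>\<^bsub>R\<^esub>)"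

definition finitely_generated_module ::
    "('r, 'm) ring_scheme \<Rightarrow> ('r, 'b, 'n) module_scheme \<Rightarrow> bool" where
  "finitely_generated_module R M \<longleftrightarrow>
     (\<exists>A. finite A \<and> A \<subseteq> carrier M \<and>
        (\<forall>x\<in>carrier M. \<exists>c\<in>A \<rightarrow> carrier R. x = (\<Oplus>\<^bsub>M\<^esub>a\<in>A. c a \<odot>\<^bsub>M\<^esub> a)))"

text \<open>
  The direct sum of copies of \<open>R\<close> indexed by \<open>I\<close>. The fields \<open>mult\<close> and \<open>one\<close> play no role in
  a module.
\<close>

definition free_module :: "('r, 'm) ring_scheme \<Rightarrow> 'i set \<Rightarrow> ('r, 'i \<Rightarrow> 'r) module" where
  "free_module R I =
     \<lparr>carrier = {f. (\<forall>i\<in>I. f i \<in> carrier R) \<and> (\<forall>i. i \<notin> I \<longrightarrow> f i = \<zero>\<^bsub>R\<^esub>) \<and>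
                    finite {i \<in> I. f i \<noteq> \<zero>\<^bsub>R\<^esub>}},
      mult = undefined, one = undefined,
      ring.zero = (\<lambda>i. \<zero>\<^bsub>R\<^esub>), add = (\<lambda>f g i. f i \<oplus>\<^bsub>R\<^esub> g i),
      smult = (\<lambda>r f i. r \<otimes>\<^bsub>R\<^esub> f i)\<rparr>"

text \<open>
  A module is projective if it is isomorphic to a direct summand of a free module. Index sets
  inside the type of elements of \<open>M\<close> suffice, since a projective \<open>M\<close> is a direct summand of the
  free module on the set \<open>carrier M\<close>.
\<close>

definition projective_module ::
    "('r, 'm) ring_scheme \<Rightarrow> ('r, 'b, 'n) module_scheme \<Rightarrow> bool" where
  "projective_module R M \<longleftrightarrow>
     (\<exists>(I :: 'b set) P Q f.
        submodule P R (free_module R I) \<and> submodule Q R (free_module R I) \<and>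
        P \<inter> Q = {\<zero>\<^bsub>free_module R I\<^esub>} \<and>
        P <+>\<^bsub>free_module R I\<^esub> Q = carrier (free_module R I) \<and>
        bij_betw f (carrier M) P \<and>
        (\<forall>x\<in>carrier M. \<forall>y\<in>carrier M. f (x \<oplus>\<^bsub>M\<^esub> y) = f x \<oplus>\<^bsub>free_module R I\<^esub> f y) \<and>
        (\<forall>r\<in>carrier R. \<forall>x\<in>carrier M. f (r \<odot>\<^bsub>M\<^esub> x) = r \<odot>\<^bsub>free_module R I\<^esub> f x))"

definition free_of_rank :: "('r, 'm) ring_scheme \<Rightarrow> ('r, 'b, 'n) module_scheme \<Rightarrow> nat \<Rightarrow> bool" where
  "free_of_rank R M n \<longleftrightarrow>
     (\<exists>e\<in>{..<n} \<rightarrow> carrier M. \<forall>x\<in>carrier M.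
        \<exists>!c. c \<in> {..<n} \<rightarrow>\<^sub>E carrier R \<and> x = (\<Oplus>\<^bsub>M\<^esub>i\<in>{..<n}. c i \<odot>\<^bsub>M\<^esub> e i))"


section \<open>Localization\<close>

text \<open>
  For a multiplicative set \<open>T\<close> of \<open>R\<close>, the fraction \<open>m/s\<close> is the class of the pair \<open>(m, s)\<close>,
  where \<open>(m, s)\<close> and \<open>(m', s')\<close> are equivalent iff \<open>t s' m = t s m'\<close> for some \<open>t\<close> in \<open>T\<close>.
  The operations take the union over all representatives, and by well-definedness that is
  the union of equal sets.
\<close>

definition loc_frac ::
    "('r, 'm) ring_scheme \<Rightarrow> 'r set \<Rightarrow> ('r, 'b, 'n) module_scheme \<Rightarrow> 'b \<Rightarrow> 'r \<Rightarrow> ('b \<times> 'r) set" where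
  "loc_frac R T M m s =
     {(m', s'). m' \<in> carrier M \<and> s' \<in> T \<and>
        (\<exists>t\<in>T. t \<odot>\<^bsub>M\<^esub> (s' \<odot>\<^bsub>M\<^esub> m) = t \<odot>\<^bsub>M\<^esub> (s \<odot>\<^bsub>M\<^esub> m'))}"

definition ring_as_module :: "('r, 'm) ring_scheme \<Rightarrow> ('r, 'r) module" where
  "ring_as_module R =
     \<lparr>carrier = carrier R, mult = mult R, one = \<one>\<^bsub>R\<^esub>, ring.zero = \<zero>\<^bsub>R\<^esub>, add = add R,
      smult = mult R\<rparr>"

definition localized_ring :: "('r, 'm) ring_scheme \<Rightarrow> 'r set \<Rightarrow> ('r \<times> 'r) set ring" where
  "localized_ring R T =
     \<lparr>carrier = {loc_frac R T (ring_as_module R) a s | a s. a \<in> carrier R \<and> s \<in> T},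
      mult = (\<lambda>X Y. \<Union>(a, s)\<in>X. \<Union>(b, t)\<in>Y.
                loc_frac R T (ring_as_module R) (a \<otimes>\<^bsub>R\<^esub> b) (s \<otimes>\<^bsub>R\<^esub> t)),
      one = loc_frac R T (ring_as_module R) \<one>\<^bsub>R\<^esub> \<one>\<^bsub>R\<^esub>,
      ring.zero = loc_frac R T (ring_as_module R) \<zero>\<^bsub>R\<^esub> \<one>\<^bsub>R\<^esub>,
      add = (\<lambda>X Y. \<Union>(a, s)\<in>X. \<Union>(b, t)\<in>Y.
                loc_frac R T (ring_as_module R) (t \<otimes>\<^bsub>R\<^esub> a \<oplus>\<^bsub>R\<^esub> s \<otimes>\<^bsub>R\<^esub> b) (s \<otimes>\<^bsub>R\<^esub> t))\<rparr>"

definition localized_module ::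
    "('r, 'm) ring_scheme \<Rightarrow> 'r set \<Rightarrow> ('r, 'b, 'n) module_scheme
       \<Rightarrow> (('r \<times> 'r) set, ('b \<times> 'r) set) module" where
  "localized_module R T M =
     \<lparr>carrier = {loc_frac R T M m s | m s. m \<in> carrier M \<and> s \<in> T},
      mult = undefined, one = undefined,
      ring.zero = loc_frac R T M \<zero>\<^bsub>M\<^esub> \<one>\<^bsub>R\<^esub>,
      add = (\<lambda>X Y. \<Union>(m, s)\<in>X. \<Union>(n, t)\<in>Y.
                loc_frac R T M (t \<odot>\<^bsub>M\<^esub> m \<oplus>\<^bsub>M\<^esub> s \<odot>\<^bsub>M\<^esub> n) (s \<otimes>\<^bsub>R\<^esub> t)),
      smult = (\<lambda>A X. \<Union>(a, s)\<in>A. \<Union>(m, t)\<in>X. loc_frac R T M (a \<odot>\<^bsub>M\<^esub> m) (s \<otimes>\<^bsub>R\<^esub> t))\<rparr>"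

definition constant_rank :: "('r, 'm) ring_scheme \<Rightarrow> ('r, 'b, 'n) module_scheme \<Rightarrow> bool" where
  "constant_rank R M \<longleftrightarrow>
     (\<exists>n. \<forall>P. primeideal P R \<longrightarrow>
        free_of_rank (localized_ring R (carrier R - P)) (localized_module R (carrier R - P) M) n)"


section \<open>Algebras over a commutative ring\<close>

text \<open>
  \<open>B\<close> need not be commutative, so an algebra is given by a structure map \<open>\<phi>\<close> from \<open>R\<close> to \<open>B\<close>, not
  by the locale \<^locale>\<open>algebra\<close>. The identification of \<open>R\<close> with its image is written out as \<open>\<phi>\<close>.
\<close>

definition ring_algebra :: "('r, 'm) ring_scheme \<Rightarrow> ('b, 'n) ring_scheme \<Rightarrow> ('r \<Rightarrow> 'b) \<Rightarrow> bool" where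
  "ring_algebra R B \<phi> \<longleftrightarrow>
     cring R \<and> ring B \<and> \<phi> \<in> ring_hom R B \<and> inj_on \<phi> (carrier R) \<and>
     (\<forall>r\<in>carrier R. \<forall>b\<in>carrier B. \<phi> r \<otimes>\<^bsub>B\<^esub> b = b \<otimes>\<^bsub>B\<^esub> \<phi> r)"

definition algebra_module :: "('b, 'n) ring_scheme \<Rightarrow> ('r \<Rightarrow> 'b) \<Rightarrow> ('r, 'b) module" where
  "algebra_module B \<phi> =
     \<lparr>carrier = carrier B, mult = mult B, one = \<one>\<^bsub>B\<^esub>, ring.zero = \<zero>\<^bsub>B\<^esub>, add = add B,
      smult = (\<lambda>r b. \<phi> r \<otimes>\<^bsub>B\<^esub> b)\<rparr>"

definition satisfies_monic ::
    "('r, 'm) ring_scheme \<Rightarrow> ('b, 'n) ring_scheme \<Rightarrow> ('r \<Rightarrow> 'b) \<Rightarrow> nat \<Rightarrow> 'b \<Rightarrow> bool" where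
  "satisfies_monic R B \<phi> d x \<longleftrightarrow>
     (\<exists>c\<in>{..<d} \<rightarrow> carrier R.
        x [^]\<^bsub>B\<^esub> d \<oplus>\<^bsub>B\<^esub> (\<Oplus>\<^bsub>B\<^esub>i\<in>{..<d}. \<phi> (c i) \<otimes>\<^bsub>B\<^esub> x [^]\<^bsub>B\<^esub> i) = \<zero>\<^bsub>B\<^esub>)"

text \<open>
  Degrees are extended natural numbers, so that a degree that does not exist is \<open>\<infinity>\<close>
  (the infimum of the empty set). A nonempty infimum in \<^typ>\<open>enat\<close> is attained.
\<close>

definition elem_degree ::
    "('r, 'm) ring_scheme \<Rightarrow> ('b, 'n) ring_scheme \<Rightarrow> ('r \<Rightarrow> 'b) \<Rightarrow> 'b \<Rightarrow> enat" where
  "elem_degree R B \<phi> x = Inf {enat d | d. d > 0 \<and> satisfies_monic R B \<phi> d x}"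

definition alg_degree ::
    "('r, 'm) ring_scheme \<Rightarrow> ('b, 'n) ring_scheme \<Rightarrow> ('r \<Rightarrow> 'b) \<Rightarrow> enat" where
  "alg_degree R B \<phi> =
     Inf {enat n | n. n > 0 \<and> (\<forall>x\<in>carrier B. elem_degree R B \<phi> x \<le> enat n)}"

definition standard_involution ::
    "('r, 'm) ring_scheme \<Rightarrow> ('b, 'n) ring_scheme \<Rightarrow> ('r \<Rightarrow> 'b) \<Rightarrow> ('b \<Rightarrow> 'b) \<Rightarrow> bool" where
  "standard_involution R B \<phi> \<sigma> \<longleftrightarrow>
     \<sigma> \<in> carrier B \<rightarrow> carrier B \<and>
     (\<forall>x\<in>carrier B. \<forall>y\<in>carrier B. \<sigma> (x \<oplus>\<^bsub>B\<^esub> y) = \<sigma> x \<oplus>\<^bsub>B\<^esub> \<sigma> y) \<and>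
     (\<forall>r\<in>carrier R. \<forall>x\<in>carrier B. \<sigma> (\<phi> r \<otimes>\<^bsub>B\<^esub> x) = \<phi> r \<otimes>\<^bsub>B\<^esub> \<sigma> x) \<and>
     \<sigma> \<one>\<^bsub>B\<^esub> = \<one>\<^bsub>B\<^esub> \<and>
     (\<forall>x\<in>carrier B. \<forall>y\<in>carrier B. \<sigma> (x \<otimes>\<^bsub>B\<^esub> y) = \<sigma> y \<otimes>\<^bsub>B\<^esub> \<sigma> x) \<and>
     (\<forall>x\<in>carrier B. \<sigma> (\<sigma> x) = x) \<and>
     (\<forall>x\<in>carrier B. x \<otimes>\<^bsub>B\<^esub> \<sigma> x \<in> \<phi> ` carrier R)"


section \<open>Base change and geometric degree\<close>

text \<open>
  The tensor product of \<open>B\<close> and \<open>S\<close> over \<open>R\<close>, where \<open>R\<close> acts through \<open>\<phi>\<close> on \<open>B\<close> and through \<open>h\<close> on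
  \<open>S\<close>, is the free abelian group on the pairs \<open>(b, s)\<close> modulo the subgroup generated by the
  bilinearity relations. Its multiplication is induced by \<open>(b, s) (b', s') = (b b', s s')\<close>;
  since \<open>S\<close> is commutative and the image of \<open>\<phi>\<close> is central, that subgroup is an ideal for it.
\<close>

definition pair_ring ::
    "('b, 'n) ring_scheme \<Rightarrow> ('s, 'k) ring_scheme \<Rightarrow> (('b \<times> 's) \<Rightarrow>\<^sub>0 int) ring" where
  "pair_ring B S =
     \<lparr>carrier = carrier (free_Abelian_group (carrier B \<times> carrier S)),
      mult = (\<lambda>u v. frag_extend (\<lambda>(b, s). frag_extend (\<lambda>(b', s').
                frag_of (b \<otimes>\<^bsub>B\<^esub> b', s \<otimes>\<^bsub>S\<^esub> s')) v) u),
      one = frag_of (\<one>\<^bsub>B\<^esub>, \<one>\<^bsub>S\<^esub>),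
      ring.zero = 0, add = (+)\<rparr>"

definition tensor_relations ::
    "('r, 'm) ring_scheme \<Rightarrow> ('b, 'n) ring_scheme \<Rightarrow> ('r \<Rightarrow> 'b)
       \<Rightarrow> ('s, 'k) ring_scheme \<Rightarrow> ('r \<Rightarrow> 's) \<Rightarrow> (('b \<times> 's) \<Rightarrow>\<^sub>0 int) set" where
  "tensor_relations R B \<phi> S h =
     {frag_of (b \<oplus>\<^bsub>B\<^esub> b', s) - frag_of (b, s) - frag_of (b', s) | b b' s.
        b \<in> carrier B \<and> b' \<in> carrier B \<and> s \<in> carrier S} \<union>
     {frag_of (b, s \<oplus>\<^bsub>S\<^esub> s') - frag_of (b, s) - frag_of (b, s') | b s s'.
        b \<in> carrier B \<and> s \<in> carrier S \<and> s' \<in> carrier S} \<union>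
     {frag_of (\<phi> r \<otimes>\<^bsub>B\<^esub> b, s) - frag_of (b, h r \<otimes>\<^bsub>S\<^esub> s) | r b s.
        r \<in> carrier R \<and> b \<in> carrier B \<and> s \<in> carrier S}"

definition tensor_kernel ::
    "('r, 'm) ring_scheme \<Rightarrow> ('b, 'n) ring_scheme \<Rightarrow> ('r \<Rightarrow> 'b)
       \<Rightarrow> ('s, 'k) ring_scheme \<Rightarrow> ('r \<Rightarrow> 's) \<Rightarrow> (('b \<times> 's) \<Rightarrow>\<^sub>0 int) set" where
  "tensor_kernel R B \<phi> S h =
     generate (free_Abelian_group (carrier B \<times> carrier S)) (tensor_relations R B \<phi> S h)"

definition base_change ::
    "('r, 'm) ring_scheme \<Rightarrow> ('b, 'n) ring_scheme \<Rightarrow> ('r \<Rightarrow> 'b)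
       \<Rightarrow> ('s, 'k) ring_scheme \<Rightarrow> ('r \<Rightarrow> 's) \<Rightarrow> (('b \<times> 's) \<Rightarrow>\<^sub>0 int) set ring" where
  "base_change R B \<phi> S h = pair_ring B S Quot tensor_kernel R B \<phi> S h"

definition base_change_map ::
    "('r, 'm) ring_scheme \<Rightarrow> ('b, 'n) ring_scheme \<Rightarrow> ('r \<Rightarrow> 'b)
       \<Rightarrow> ('s, 'k) ring_scheme \<Rightarrow> ('r \<Rightarrow> 's) \<Rightarrow> 's \<Rightarrow> (('b \<times> 's) \<Rightarrow>\<^sub>0 int) set" where
  "base_change_map R B \<phi> S h s =
     tensor_kernel R B \<phi> S h +>\<^bsub>pair_ring B S\<^esub> frag_of (\<one>\<^bsub>B\<^esub>, s)"

text \<open>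
  HOL cannot quantify over all types within a formula, so \<open>S\<close> ranges over the rings carried by
  subsets of the type \<^typ>\<open>'r + nat + 's\<close>, where \<open>'s\<close> is an arbitrary parameter: every ring on
  every type occurs, up to isomorphism, for some choice of \<open>'s\<close>. When \<open>R\<close> is Noetherian and
  \<open>B\<close> is projective over \<open>R\<close>, the value does not depend on \<open>'s\<close>: the degree over \<open>S\<close> of an
  element of the base change of \<open>B\<close> to \<open>S\<close> does not decrease when \<open>S\<close> is replaced by a finitely
  generated \<open>R\<close>-subalgebra over which the element is defined, and that subalgebra is connected
  and Noetherian and has a copy inside \<^typ>\<open>'r + nat\<close>.
  A supremum in \<^typ>\<open>enat\<close> that is finite is a maximum.
\<close>

definition geometric_degree ::
    "'s itself \<Rightarrow> ('r, 'm) ring_scheme \<Rightarrow> ('b, 'n) ring_scheme \<Rightarrow> ('r \<Rightarrow> 'b) \<Rightarrow> enat" where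
  "geometric_degree (_ :: 's itself) R B \<phi> =
     (SUP (S, h) \<in> {(S :: ('r + nat + 's) ring, h).
        cring S \<and> noetherian_ring S \<and> connected_ring S \<and> h \<in> ring_hom R S}.
      alg_degree S (base_change R B \<phi> S h) (base_change_map R B \<phi> S h))"

end

theory Submission
  imports Defs "HOL-Algebra.Weak_Morphisms"
begin

text \<open>
  Let \<open>B\<close> have degree at most 2, so that \<open>x\<^sup>2 = t\<^sub>x x - n\<^sub>x\<close> for all \<open>x\<close>. The element \<open>t\<^sub>x\<close> need not be
  unique, and the problem is to choose it linearly in \<open>x\<close>. All identities modulo \<open>R\<close> are tested against
  the linear functionals \<open>h\<close> on \<open>B\<close> with \<open>h(1) = 0\<close>, which detect \<open>R\<close> inside \<open>B\<close> because \<open>R\<close> is a direct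
  summand. Given such a functional \<open>f\<close> and an element \<open>b\<close>, expanding \<open>(b + y)\<^sup>2\<close> for \<open>f(y) = 0\<close> gives an
  identity whose sides are linear and quadratic in \<open>y\<close>; replacing \<open>y\<close> by \<open>a y\<close> shows that \<open>a(a - 1)\<close>
  annihilates both, so both vanish. This produces a linear trace for the multiple \<open>f(b)\<^sup>3 x\<^sup>2\<close> of the
  square. The \<open>r\<close> for which \<open>r x\<^sup>2\<close> has a linear trace form an ideal whose radical contains all \<open>f(b)\<close>,
  and by Nakayama it contains an element that acts as 1 on \<open>B/R\<close>: no localization is needed. If \<open>t\<close> is a
  linear trace with \<open>t(1) = 2\<close>, then \<open>\<sigma>(x) = t(x) - x\<close> is a standard involution; it reverses products
  because the defect \<open>\<sigma>(x y) - \<sigma>(y) \<sigma>(x)\<close> lies in \<open>R\<close> and its product with \<open>x\<close> lies in \<open>R\<close> as well.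

  Conversely, the trace of a standard involution extends to every base change. The degree of \<open>B\<close> itself
  is seen by the base change along an isomorphism from \<open>R\<close> to a copy of \<open>R\<close>.
\<close>

section \<open>Linear functionals on an algebra\<close>

text \<open>The element a has to separate terms of different degree. Over F_2, where a(a - 1) is
  always 0, the theorem fails: in F_2^3 every x satisfies x^2 = x, but a linear trace would be 1 on
  each of the three primitive idempotents, hence 1 + 1 + 1 = 1 on their sum, the unit, where it must
  be 2 = 0. The trace of x is determined only up to what annihilates x modulo R, and a pair f, b
  with f(b) = 1 need not exist globally. Hence the computations carry powers of f(b), and one
  principle about ideals leads back to 1: an ideal whose radical contains all values of functionals
  vanishing at 1 has an element acting as 1 on those values. It is used a second time for the defect
  of the involution: as a functional of x, its product with every functional vanishing at 1 is zero,
  and the principle turns this into vanishing of the defect itself. Nakayama's lemma also supplies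
  the splitting of R, since it shows that the values at 1 of all functionals form the unit
  ideal.\<close>

lemma (in cring) ideal_pow_add:
  assumes "ideal J R" "x \<in> carrier R" "y \<in> carrier R" "c \<in> carrier R"
    and "c \<otimes> x [^] (n::nat) \<in> J" "c \<otimes> y [^] (m::nat) \<in> J"
  shows "c \<otimes> (x \<oplus> y) [^] (n + m) \<in> J"
  using assms(4-6)
\<comment> \<open>Splitting off one factor \<open>x \<oplus> y\<close> and absorbing
  \<open>x\<close> or \<open>y\<close> into \<open>c\<close> lowers one exponent, which replaces the
  binomial expansion. The coefficient \<open>c\<close> is present for the sake of this
  induction.\<close>
proof (induction "n + m" arbitrary: n m c)
  interpret J: ideal J R by fact
  case (Suc k)
  note c = assms(2,3) Suc.prems(1)
  show ?case
  proof (cases "n = 0 \<or> m = 0")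
    case True
    then have "c \<in> J"
      using Suc.prems by auto
    then show ?thesis
      using c by (simp add: J.I_r_closed)
  next
    case False
    then obtain n' m' where nm: "n = Suc n'" "m = Suc m'"
      by (metis old.nat.exhaust)
    have "c \<otimes> x \<otimes> x [^] n' \<in> J"
      using Suc.prems(2) c unfolding nm nat_pow_Suc2[OF c(1)] by (simp add: m_assoc)
    moreover have "c \<otimes> x \<otimes> y [^] m \<in> J"
    proof -
      have "c \<otimes> x \<otimes> y [^] m = x \<otimes> (c \<otimes> y [^] m)"
        using c nat_pow_closed[of y m] by algebra
      then show ?thesis
        using Suc.prems c by (simp add: J.I_l_closed)
    qed
    ultimately have 1: "c \<otimes> x \<otimes> (x \<oplus> y) [^] (n' + m) \<in> J"
      using Suc.hyps(1)[of n' m "c \<otimes> x"] Suc.hyps(2) c nm by auto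
    have "c \<otimes> y \<otimes> y [^] m' \<in> J"
      using Suc.prems(3) c unfolding nm nat_pow_Suc2[OF c(2)] by (simp add: m_assoc)
    moreover have "c \<otimes> y \<otimes> x [^] n \<in> J"
    proof -
      have "c \<otimes> y \<otimes> x [^] n = y \<otimes> (c \<otimes> x [^] n)"
        using c nat_pow_closed[of x n] by algebra
      then show ?thesis
        using Suc.prems c by (simp add: J.I_l_closed)
    qed
    ultimately have 2: "c \<otimes> y \<otimes> (x \<oplus> y) [^] (n + m') \<in> J"
      using Suc.hyps(1)[of n m' "c \<otimes> y"] Suc.hyps(2) c nm by auto
    have e: "n' + m = k" "n + m' = k" "n + m = Suc k"
      using nm Suc.hyps(2) by auto
    have "c \<otimes> (x \<oplus> y) [^] (n + m) = c \<otimes> x \<otimes> (x \<oplus> y) [^] k \<oplus> c \<otimes> y \<otimes> (x \<oplus> y) [^] k"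
      unfolding e nat_pow_Suc using c nat_pow_closed[of "x \<oplus> y" k] by algebra
    then show ?thesis
      using 1 2 unfolding e by auto
  qed
qed auto

lemma (in cring) radical_ideal:
  assumes "ideal J R"
  shows "ideal {x \<in> carrier R. \<exists>n::nat. x [^] n \<in> J} R" (is "ideal ?K R")
proof -
  interpret J: ideal J R by fact
  have mult: "x \<otimes> r \<in> ?K" if x: "x \<in> ?K" and r: "r \<in> carrier R" for x r
  proof -
    from x obtain n :: nat where n: "x \<in> carrier R" "x [^] n \<in> J" by auto
    then have "(x \<otimes> r) [^] n \<in> J"
      using r by (simp add: nat_pow_distrib J.I_r_closed)
    then show ?thesis using n r by auto
  qed
  have add: "x \<oplus> y \<in> ?K" if xy: "x \<in> ?K" "y \<in> ?K" for x y
  proof -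
    from xy obtain n m :: nat where n: "x \<in> carrier R" "x [^] n \<in> J" "y \<in> carrier R" "y [^] m \<in> J"
      by auto
    then show ?thesis
      using ideal_pow_add[OF assms, of x y \<one> n m] by auto
  qed
  have "\<zero> [^] (1::nat) \<in> J" by simp
  then have zero: "\<zero> \<in> ?K" by blast
  have minus: "\<ominus> x \<in> ?K" if "x \<in> ?K" for x
    using mult[OF that, of "\<ominus> \<one>"] that by (simp add: r_minus)
  show ?thesis
  proof (rule idealI[OF ring_axioms])
    show "subgroup ?K (add_monoid R)"
      using add zero minus by (intro add.subgroupI) (auto simp: a_inv_def)
    show "r \<otimes> x \<in> ?K" if "x \<in> ?K" "r \<in> carrier R" for x r
      using mult[OF that] m_comm[of r x] that by simp
  qed (use mult in auto)
qed

text \<open>Injectivity of \<open>\<phi>\<close> is left to \<open>projective_algebra\<close>: the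
  structure map from \<open>S\<close> to a base change is an instance of this locale as well, so the
  degree criteria proved here serve \<open>R\<close> and \<open>S\<close> alike.\<close>

locale central_map = R: cring R + B: ring B
  for R :: "('r, 'm) ring_scheme" (structure) and B :: "('b, 'n) ring_scheme" (structure)
    and \<phi> :: "'r \<Rightarrow> 'b" +
  assumes phi_hom: "\<phi> \<in> ring_hom R B"
    and central: "\<lbrakk>r \<in> carrier R; b \<in> carrier B\<rbrakk> \<Longrightarrow> \<phi> r \<otimes>\<^bsub>B\<^esub> b = b \<otimes>\<^bsub>B\<^esub> \<phi> r"

sublocale central_map \<subseteq> phi: ring_hom_ring R B \<phi>
  by (intro ring_hom_ringI2 R.ring_axioms B.ring_axioms phi_hom)

section \<open>Linear functionals and linear combinations over the base ring\<close>

context central_map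
begin

lemma scalar_left_commute:
  assumes "r \<in> carrier R" "b \<in> carrier B" "c \<in> carrier B"
  shows "b \<otimes>\<^bsub>B\<^esub> (\<phi> r \<otimes>\<^bsub>B\<^esub> c) = \<phi> r \<otimes>\<^bsub>B\<^esub> (b \<otimes>\<^bsub>B\<^esub> c)"
  by (metis assms central B.m_assoc phi.hom_closed)

lemma scalars_closed:
  assumes "c \<in> A \<rightarrow> carrier R" "e \<in> A \<rightarrow> carrier B"
  shows "(\<lambda>i. \<phi> (c i) \<otimes>\<^bsub>B\<^esub> e i) \<in> A \<rightarrow> carrier B"
proof
  fix i assume i: "i \<in> A"
  show "\<phi> (c i) \<otimes>\<^bsub>B\<^esub> e i \<in> carrier B"
    using funcset_mem[OF assms(1) i] funcset_mem[OF assms(2) i] by simp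
qed

definition dual :: "('b \<Rightarrow> 'r) set" where
  "dual = {f \<in> carrier B \<rightarrow> carrier R.
     (\<forall>x\<in>carrier B. \<forall>y\<in>carrier B. f (x \<oplus>\<^bsub>B\<^esub> y) = f x \<oplus> f y) \<and>
     (\<forall>r\<in>carrier R. \<forall>x\<in>carrier B. f (\<phi> r \<otimes>\<^bsub>B\<^esub> x) = r \<otimes> f x)}"

lemma dualI:
  assumes "\<And>x. x \<in> carrier B \<Longrightarrow> f x \<in> carrier R"
    and "\<And>x y. \<lbrakk>x \<in> carrier B; y \<in> carrier B\<rbrakk> \<Longrightarrow> f (x \<oplus>\<^bsub>B\<^esub> y) = f x \<oplus> f y"
    and "\<And>r x. \<lbrakk>r \<in> carrier R; x \<in> carrier B\<rbrakk> \<Longrightarrow> f (\<phi> r \<otimes>\<^bsub>B\<^esub> x) = r \<otimes> f x"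
  shows "f \<in> dual"
  using assms unfolding dual_def by auto

lemma dual_closed [simp, intro]: "\<lbrakk>f \<in> dual; x \<in> carrier B\<rbrakk> \<Longrightarrow> f x \<in> carrier R"
  and dual_add: "\<lbrakk>f \<in> dual; x \<in> carrier B; y \<in> carrier B\<rbrakk> \<Longrightarrow> f (x \<oplus>\<^bsub>B\<^esub> y) = f x \<oplus> f y"
  and dual_smult: "\<lbrakk>f \<in> dual; r \<in> carrier R; x \<in> carrier B\<rbrakk> \<Longrightarrow> f (\<phi> r \<otimes>\<^bsub>B\<^esub> x) = r \<otimes> f x"
  unfolding dual_def by auto

lemma dual_zero: "f \<in> dual \<Longrightarrow> f \<zero>\<^bsub>B\<^esub> = \<zero>"
  using dual_smult[of f \<zero> "\<zero>\<^bsub>B\<^esub>"] by simp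

lemma dual_scalar:
  assumes "f \<in> dual" "r \<in> carrier R"
  shows "f (\<phi> r) = r \<otimes> f \<one>\<^bsub>B\<^esub>"
  using dual_smult[of f r "\<one>\<^bsub>B\<^esub>"] assms by simp

lemma dual_minus:
  assumes "f \<in> dual" "x \<in> carrier B"
  shows "f (\<ominus>\<^bsub>B\<^esub> x) = \<ominus> f x"
  by (metis assms dual_add dual_closed dual_zero B.add.inv_closed B.l_neg R.minus_equality)

lemma dual_diff:
  assumes "f \<in> dual" "x \<in> carrier B" "y \<in> carrier B"
  shows "f (x \<ominus>\<^bsub>B\<^esub> y) = f x \<ominus> f y"
  using assms by (simp add: a_minus_def dual_add dual_minus)

lemma dual_lincomb:
  assumes f: "f \<in> dual" and c: "c \<in> A \<rightarrow> carrier R" and e: "e \<in> A \<rightarrow> carrier B"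
  shows "f (\<Oplus>\<^bsub>B\<^esub>i\<in>A. \<phi> (c i) \<otimes>\<^bsub>B\<^esub> e i) = (\<Oplus>i\<in>A. c i \<otimes> f (e i))"
  using c e
proof (induction A rule: infinite_finite_induct)
  case (insert i A)
  then have "(\<lambda>i. \<phi> (c i) \<otimes>\<^bsub>B\<^esub> e i) \<in> A \<rightarrow> carrier B" "(\<lambda>i. c i \<otimes> f (e i)) \<in> A \<rightarrow> carrier R"
    using f by (auto simp: Pi_iff)
  with insert f show ?case
    by (auto simp: dual_add dual_smult)
qed (auto simp: f dual_zero R.finsum_infinite B.finsum_infinite)

lemma scalar_lincomb:
  assumes "finite A" "r \<in> carrier R" and c: "c \<in> A \<rightarrow> carrier R" and e: "e \<in> A \<rightarrow> carrier B"
  shows "\<phi> r \<otimes>\<^bsub>B\<^esub> (\<Oplus>\<^bsub>B\<^esub>i\<in>A. \<phi> (c i) \<otimes>\<^bsub>B\<^esub> e i) = (\<Oplus>\<^bsub>B\<^esub>i\<in>A. \<phi> (r \<otimes> c i) \<otimes>\<^bsub>B\<^esub> e i)"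
proof -
  have "(\<lambda>i. \<phi> (c i) \<otimes>\<^bsub>B\<^esub> e i) \<in> A \<rightarrow> carrier B"
    using c e by (rule scalars_closed)
  then have "\<phi> r \<otimes>\<^bsub>B\<^esub> (\<Oplus>\<^bsub>B\<^esub>i\<in>A. \<phi> (c i) \<otimes>\<^bsub>B\<^esub> e i) = (\<Oplus>\<^bsub>B\<^esub>i\<in>A. \<phi> r \<otimes>\<^bsub>B\<^esub> (\<phi> (c i) \<otimes>\<^bsub>B\<^esub> e i))"
    using assms by (intro B.finsum_rdistr) auto
  also have "\<dots> = (\<Oplus>\<^bsub>B\<^esub>i\<in>A. \<phi> (r \<otimes> c i) \<otimes>\<^bsub>B\<^esub> e i)"
  proof (rule B.finsum_cong')
    show "(\<lambda>i. \<phi> (r \<otimes> c i) \<otimes>\<^bsub>B\<^esub> e i) \<in> A \<rightarrow> carrier B"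
      using assms by (intro scalars_closed) auto
    show "\<phi> r \<otimes>\<^bsub>B\<^esub> (\<phi> (c i) \<otimes>\<^bsub>B\<^esub> e i) = \<phi> (r \<otimes> c i) \<otimes>\<^bsub>B\<^esub> e i" if "i \<in> A" for i
      using assms(2) funcset_mem[OF c that] funcset_mem[OF e that] by (simp add: B.m_assoc)
  qed auto
  finally show ?thesis .
qed

lemma lincomb_add:
  assumes "c \<in> A \<rightarrow> carrier R" "d \<in> A \<rightarrow> carrier R" and e: "e \<in> A \<rightarrow> carrier B"
  shows "(\<Oplus>\<^bsub>B\<^esub>i\<in>A. \<phi> (c i) \<otimes>\<^bsub>B\<^esub> e i) \<oplus>\<^bsub>B\<^esub> (\<Oplus>\<^bsub>B\<^esub>i\<in>A. \<phi> (d i) \<otimes>\<^bsub>B\<^esub> e i) =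
    (\<Oplus>\<^bsub>B\<^esub>i\<in>A. \<phi> (c i \<oplus> d i) \<otimes>\<^bsub>B\<^esub> e i)"
proof -
  have "(\<Oplus>\<^bsub>B\<^esub>i\<in>A. \<phi> (c i \<oplus> d i) \<otimes>\<^bsub>B\<^esub> e i) = (\<Oplus>\<^bsub>B\<^esub>i\<in>A. \<phi> (c i) \<otimes>\<^bsub>B\<^esub> e i \<oplus>\<^bsub>B\<^esub> \<phi> (d i) \<otimes>\<^bsub>B\<^esub> e i)"
  proof (rule B.finsum_cong')
    show "\<phi> (c i \<oplus> d i) \<otimes>\<^bsub>B\<^esub> e i = \<phi> (c i) \<otimes>\<^bsub>B\<^esub> e i \<oplus>\<^bsub>B\<^esub> \<phi> (d i) \<otimes>\<^bsub>B\<^esub> e i" if "i \<in> A" for i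
      using assms that by (simp add: Pi_iff B.l_distr)
    show "(\<lambda>i. \<phi> (c i) \<otimes>\<^bsub>B\<^esub> e i \<oplus>\<^bsub>B\<^esub> \<phi> (d i) \<otimes>\<^bsub>B\<^esub> e i) \<in> A \<rightarrow> carrier B"
      using scalars_closed[OF assms(1) e] scalars_closed[OF assms(2) e] by auto
  qed auto
  also have "\<dots> = (\<Oplus>\<^bsub>B\<^esub>i\<in>A. \<phi> (c i) \<otimes>\<^bsub>B\<^esub> e i) \<oplus>\<^bsub>B\<^esub> (\<Oplus>\<^bsub>B\<^esub>i\<in>A. \<phi> (d i) \<otimes>\<^bsub>B\<^esub> e i)"
    using assms by (intro B.finsum_addf scalars_closed)
  finally show ?thesis ..
qed

text \<open>
  The factors \<open>v\<close> and \<open>w\<close> congruent to 1 modulo \<open>I\<close> avoid inverting \<open>1 - c\<close> when a generator is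
  eliminated.
\<close>

lemma nakayama:
  assumes I: "ideal I R" and "finite A" and "e \<in> A \<rightarrow> carrier B"
    and "v \<in> carrier R" "\<one> \<ominus> v \<in> I"
    and "\<And>j. j \<in> A \<Longrightarrow> \<exists>c\<in>A \<rightarrow> I. \<phi> v \<otimes>\<^bsub>B\<^esub> e j = (\<Oplus>\<^bsub>B\<^esub>k\<in>A. \<phi> (c k) \<otimes>\<^bsub>B\<^esub> e k)"
  shows "\<exists>w\<in>carrier R. \<one> \<ominus> w \<in> I \<and> (\<forall>j\<in>A. \<phi> w \<otimes>\<^bsub>B\<^esub> e j = \<zero>\<^bsub>B\<^esub>)"
  using assms(2-)
proof (induction A arbitrary: v rule: finite_induct)
  case empty
  then show ?case by blast
next
  have add_minus_cancel_left: "x \<oplus>\<^bsub>B\<^esub> y \<ominus>\<^bsub>B\<^esub> x = y" if "x \<in> carrier B" "y \<in> carrier B" for x y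
    using that by algebra
  case (insert p A)
  interpret I: ideal I R by fact
  note v [simp] = insert.prems(2)
  have IR [simp]: "x \<in> carrier R" if "x \<in> I" for x
    using that by (rule I.a_Hcarr)
  from insert.prems(4)[of p] obtain c where c: "c \<in> insert p A \<rightarrow> I"
    and ep: "\<phi> v \<otimes>\<^bsub>B\<^esub> e p = (\<Oplus>\<^bsub>B\<^esub>k\<in>insert p A. \<phi> (c k) \<otimes>\<^bsub>B\<^esub> e k)" by auto
  have e [simp]: "e p \<in> carrier B" and eA: "e \<in> A \<rightarrow> carrier B"
    using insert.prems(1) by (auto simp: Pi_iff)
  have cp: "c p \<in> I" and cA: "c \<in> A \<rightarrow> I" and cAR: "c \<in> A \<rightarrow> carrier R"
    using c by (auto simp: Pi_iff)
  have sum: "(\<Oplus>\<^bsub>B\<^esub>k\<in>insert p A. \<phi> (d k) \<otimes>\<^bsub>B\<^esub> e k) =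
      \<phi> (d p) \<otimes>\<^bsub>B\<^esub> e p \<oplus>\<^bsub>B\<^esub> (\<Oplus>\<^bsub>B\<^esub>k\<in>A. \<phi> (d k) \<otimes>\<^bsub>B\<^esub> e k)" if "d \<in> insert p A \<rightarrow> I" for d
  proof (rule B.finsum_insert)
    show "(\<lambda>k. \<phi> (d k) \<otimes>\<^bsub>B\<^esub> e k) \<in> A \<rightarrow> carrier B"
      using that eA by (intro scalars_closed) (auto simp: Pi_iff)
    show "\<phi> (d p) \<otimes>\<^bsub>B\<^esub> e p \<in> carrier B"
      using that by auto
  qed (use insert.hyps in auto)
  have sumB: "(\<Oplus>\<^bsub>B\<^esub>k\<in>A. \<phi> (d k) \<otimes>\<^bsub>B\<^esub> e k) \<in> carrier B" if "d \<in> A \<rightarrow> carrier R" for d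
    using that eA by (intro B.finsum_closed scalars_closed)
  \<comment> \<open>Moving the term with \<open>c p\<close> to the left expresses the multiple of
    \<open>e p\<close> by \<open>u\<close> through the remaining generators, and \<open>u\<close> is
    again 1 modulo \<open>I\<close>.\<close>
  define u where "u = v \<ominus> c p"
  have u [simp]: "u \<in> carrier R"
    unfolding u_def using cp by simp
  have uI: "\<one> \<ominus> u \<in> I"
  proof -
    have "\<one> \<ominus> u = (\<one> \<ominus> v) \<oplus> c p"
      unfolding u_def using v IR[OF cp] by algebra
    then show ?thesis
      using insert.prems(3) cp by simp
  qed
  have uep: "\<phi> u \<otimes>\<^bsub>B\<^esub> e p = (\<Oplus>\<^bsub>B\<^esub>k\<in>A. \<phi> (c k) \<otimes>\<^bsub>B\<^esub> e k)"
  proof -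
    have "\<phi> u \<otimes>\<^bsub>B\<^esub> e p = \<phi> v \<otimes>\<^bsub>B\<^esub> e p \<ominus>\<^bsub>B\<^esub> \<phi> (c p) \<otimes>\<^bsub>B\<^esub> e p"
      unfolding u_def using IR[OF cp] by (simp add: a_minus_def B.l_distr B.l_minus)
    also have "\<dots> = (\<Oplus>\<^bsub>B\<^esub>k\<in>A. \<phi> (c k) \<otimes>\<^bsub>B\<^esub> e k)"
      unfolding ep sum[OF c] using IR[OF cp] by (intro add_minus_cancel_left sumB cAR) auto
    finally show ?thesis .
  qed
  \<comment> \<open>The relation for \<open>e j\<close> still contains \<open>e p\<close>.
    Multiplied by \<open>u\<close>, it allows \<open>e p\<close> to be replaced by the generators in
    \<open>A\<close>; the factor in front of \<open>e j\<close> becomes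
    \<open>u \<otimes> v\<close>.\<close>
  have "\<exists>w\<in>carrier R. \<one> \<ominus> w \<in> I \<and> (\<forall>j\<in>A. \<phi> w \<otimes>\<^bsub>B\<^esub> e j = \<zero>\<^bsub>B\<^esub>)"
  proof (rule insert.IH[of "u \<otimes> v"])
    show "\<one> \<ominus> u \<otimes> v \<in> I"
    proof -
      have "\<one> \<ominus> u \<otimes> v = (\<one> \<ominus> u) \<oplus> u \<otimes> (\<one> \<ominus> v)"
        using u v by algebra
      then show ?thesis
        using uI insert.prems(3) by (simp add: I.I_l_closed)
    qed
    show "\<exists>d\<in>A \<rightarrow> I. \<phi> (u \<otimes> v) \<otimes>\<^bsub>B\<^esub> e j = (\<Oplus>\<^bsub>B\<^esub>k\<in>A. \<phi> (d k) \<otimes>\<^bsub>B\<^esub> e k)" if j: "j \<in> A" for j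
    proof -
      from insert.prems(4)[of j] j obtain d where d: "d \<in> insert p A \<rightarrow> I"
        and ej: "\<phi> v \<otimes>\<^bsub>B\<^esub> e j = (\<Oplus>\<^bsub>B\<^esub>k\<in>insert p A. \<phi> (d k) \<otimes>\<^bsub>B\<^esub> e k)" by auto
      have dp: "d p \<in> carrier R" "d p \<in> I" and dA: "d \<in> A \<rightarrow> carrier R"
        using d by (auto simp: Pi_iff)
      have ej': "e j \<in> carrier B"
        using eA j by (auto simp: Pi_iff)
      have "\<phi> (u \<otimes> v) \<otimes>\<^bsub>B\<^esub> e j = \<phi> u \<otimes>\<^bsub>B\<^esub> (\<phi> (d p) \<otimes>\<^bsub>B\<^esub> e p \<oplus>\<^bsub>B\<^esub> (\<Oplus>\<^bsub>B\<^esub>k\<in>A. \<phi> (d k) \<otimes>\<^bsub>B\<^esub> e k))"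
        using ej' by (simp add: B.m_assoc ej sum[OF d])
      also have "\<dots> = \<phi> (d p) \<otimes>\<^bsub>B\<^esub> (\<phi> u \<otimes>\<^bsub>B\<^esub> e p) \<oplus>\<^bsub>B\<^esub> \<phi> u \<otimes>\<^bsub>B\<^esub> (\<Oplus>\<^bsub>B\<^esub>k\<in>A. \<phi> (d k) \<otimes>\<^bsub>B\<^esub> e k)"
        using dp sumB[OF dA] by (simp add: B.r_distr scalar_left_commute[of "d p" "\<phi> u" "e p"])
      also have "\<dots> = (\<Oplus>\<^bsub>B\<^esub>k\<in>A. \<phi> (d p \<otimes> c k) \<otimes>\<^bsub>B\<^esub> e k) \<oplus>\<^bsub>B\<^esub> (\<Oplus>\<^bsub>B\<^esub>k\<in>A. \<phi> (u \<otimes> d k) \<otimes>\<^bsub>B\<^esub> e k)"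
        unfolding uep using dp dA cAR eA insert.hyps by (simp add: scalar_lincomb)
      also have "\<dots> = (\<Oplus>\<^bsub>B\<^esub>k\<in>A. \<phi> (d p \<otimes> c k \<oplus> u \<otimes> d k) \<otimes>\<^bsub>B\<^esub> e k)"
        using dp dA cAR by (intro lincomb_add eA) auto
      finally have "\<phi> (u \<otimes> v) \<otimes>\<^bsub>B\<^esub> e j = (\<Oplus>\<^bsub>B\<^esub>k\<in>A. \<phi> (d p \<otimes> c k \<oplus> u \<otimes> d k) \<otimes>\<^bsub>B\<^esub> e k)" .
      moreover have "(\<lambda>k. d p \<otimes> c k \<oplus> u \<otimes> d k) \<in> A \<rightarrow> I"
        using d cA dp by (auto intro!: I.a_closed I.I_l_closed)
      ultimately show ?thesis
        by (intro bexI[of _ "\<lambda>k. d p \<otimes> c k \<oplus> u \<otimes> d k"]) auto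
    qed
  qed (use eA in auto)
  then obtain w where w: "w \<in> carrier R" "\<one> \<ominus> w \<in> I"
    and we: "\<And>j. j \<in> A \<Longrightarrow> \<phi> w \<otimes>\<^bsub>B\<^esub> e j = \<zero>\<^bsub>B\<^esub>"
    by blast
  show ?case
  \<comment> \<open>\<open>w\<close> kills the generators in \<open>A\<close>, and \<open>u\<close>
    moves \<open>e p\<close> into their span.\<close>
  proof (intro bexI[of _ "w \<otimes> u"] conjI ballI)
    have "\<one> \<ominus> w \<otimes> u = (\<one> \<ominus> w) \<oplus> w \<otimes> (\<one> \<ominus> u)"
      using w u by algebra
    then show "\<one> \<ominus> w \<otimes> u \<in> I"
      using w uI by (simp add: I.I_l_closed)
    fix j assume "j \<in> insert p A"
    then consider "j = p" | "j \<in> A" by auto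
    then show "\<phi> (w \<otimes> u) \<otimes>\<^bsub>B\<^esub> e j = \<zero>\<^bsub>B\<^esub>"
    proof cases
      case 1
      have "\<phi> (w \<otimes> u) \<otimes>\<^bsub>B\<^esub> e j = (\<Oplus>\<^bsub>B\<^esub>k\<in>A. \<phi> (w \<otimes> c k) \<otimes>\<^bsub>B\<^esub> e k)"
        using 1 w uep insert.hyps eA cAR by (simp add: B.m_assoc scalar_lincomb)
      also have "\<dots> = (\<Oplus>\<^bsub>B\<^esub>k\<in>A. \<zero>\<^bsub>B\<^esub>)"
      proof (rule B.finsum_cong')
        show "\<phi> (w \<otimes> c k) \<otimes>\<^bsub>B\<^esub> e k = \<zero>\<^bsub>B\<^esub>" if k: "k \<in> A" for k
        proof -
          have "\<phi> (w \<otimes> c k) \<otimes>\<^bsub>B\<^esub> e k = \<phi> (c k) \<otimes>\<^bsub>B\<^esub> (\<phi> w \<otimes>\<^bsub>B\<^esub> e k)"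
            using w funcset_mem[OF cAR k] funcset_mem[OF eA k]
            by (simp add: B.m_assoc scalar_left_commute[of "c k" "\<phi> w" "e k"])
          then show ?thesis
            using we[OF k] funcset_mem[OF cAR k] by simp
        qed
      qed auto
      finally show ?thesis by simp
    next
      case 2
      have "\<phi> (w \<otimes> u) \<otimes>\<^bsub>B\<^esub> e j = \<phi> u \<otimes>\<^bsub>B\<^esub> (\<phi> w \<otimes>\<^bsub>B\<^esub> e j)"
        using w funcset_mem[OF eA 2] by (simp add: B.m_assoc scalar_left_commute[of u "\<phi> w" "e j"])
      then show ?thesis
        using we[OF 2] by simp
    qed
  qed (use w in auto)
qed

lemma dual_sum:
  assumes fg: "f \<in> dual" "g \<in> dual"
  shows "(\<lambda>x. f x \<oplus> g x) \<in> dual"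
proof (rule dualI)
  fix x y assume xy: "x \<in> carrier B" "y \<in> carrier B"
  note c = dual_closed[OF fg(1) xy(1)] dual_closed[OF fg(1) xy(2)] dual_closed[OF fg(2) xy(1)]
    dual_closed[OF fg(2) xy(2)]
  show "f (x \<oplus>\<^bsub>B\<^esub> y) \<oplus> g (x \<oplus>\<^bsub>B\<^esub> y) = f x \<oplus> g x \<oplus> (f y \<oplus> g y)"
    unfolding dual_add[OF fg(1) xy] dual_add[OF fg(2) xy] using c by algebra
qed (use fg in \<open>auto simp: dual_smult R.r_distr\<close>)

lemma dual_scale: "\<lbrakk>f \<in> dual; r \<in> carrier R\<rbrakk> \<Longrightarrow> (\<lambda>x. r \<otimes> f x) \<in> dual"
  by (rule dualI) (auto simp: dual_add dual_smult R.r_distr R.m_lcomm)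

lemma dual_comp:
  assumes "f \<in> dual" "\<And>x. x \<in> carrier B \<Longrightarrow> p x \<in> carrier B"
    and "\<And>x y. \<lbrakk>x \<in> carrier B; y \<in> carrier B\<rbrakk> \<Longrightarrow> p (x \<oplus>\<^bsub>B\<^esub> y) = p x \<oplus>\<^bsub>B\<^esub> p y"
    and "\<And>r x. \<lbrakk>r \<in> carrier R; x \<in> carrier B\<rbrakk> \<Longrightarrow> p (\<phi> r \<otimes>\<^bsub>B\<^esub> x) = \<phi> r \<otimes>\<^bsub>B\<^esub> p x"
  shows "(\<lambda>x. f (p x)) \<in> dual"
  using assms by (intro dualI) (auto simp: dual_add dual_smult)

lemma zero_dual: "(\<lambda>x. \<zero>) \<in> dual"
  by (rule dualI) auto

text \<open>The dual of the module B/R, realized inside the dual of \<open>B\<close> so that no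
  quotient module has to be formed.\<close>

definition dual0 :: "('b \<Rightarrow> 'r) set" where
  "dual0 = {f \<in> dual. f \<one>\<^bsub>B\<^esub> = \<zero>}"

lemma dual0_dual [simp, intro]: "f \<in> dual0 \<Longrightarrow> f \<in> dual"
  and dual0_one: "f \<in> dual0 \<Longrightarrow> f \<one>\<^bsub>B\<^esub> = \<zero>"
  unfolding dual0_def by auto

lemma dual0_scalar: "\<lbrakk>f \<in> dual0; r \<in> carrier R\<rbrakk> \<Longrightarrow> f (\<phi> r) = \<zero>"
  by (simp add: dual_scalar dual0_one)

end

text \<open>A finite dual basis in the sense of the dual basis lemma. Finite generation and
  projectivity are used only in this form; the \<open>e i\<close> may be linearly dependent.\<close>

locale projective_algebra = central_map R B \<phi>
  for R :: "('r, 'm) ring_scheme" (structure) and B :: "('b, 'n) ring_scheme" (structure)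
    and \<phi> :: "'r \<Rightarrow> 'b" +
  fixes A :: "'i set" and e :: "'i \<Rightarrow> 'b" and F :: "'i \<Rightarrow> 'b \<Rightarrow> 'r"
  assumes phi_inj: "inj_on \<phi> (carrier R)"
    and finite_A: "finite A"
    and e_closed: "e \<in> A \<rightarrow> carrier B"
    and F_dual: "i \<in> A \<Longrightarrow> F i \<in> dual"
    and expansion: "x \<in> carrier B \<Longrightarrow> x = (\<Oplus>\<^bsub>B\<^esub>i\<in>A. \<phi> (F i x) \<otimes>\<^bsub>B\<^esub> e i)"
begin

lemma F_closed: "x \<in> carrier B \<Longrightarrow> (\<lambda>i. F i x) \<in> A \<rightarrow> carrier R"
  using F_dual by auto

lemma dual_ext:
  assumes "x \<in> carrier B" "y \<in> carrier B" "\<And>i. i \<in> A \<Longrightarrow> F i x = F i y"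
  shows "x = y"
proof -
  have "x = (\<Oplus>\<^bsub>B\<^esub>i\<in>A. \<phi> (F i x) \<otimes>\<^bsub>B\<^esub> e i)"
    using assms by (intro expansion)
  also have "\<dots> = (\<Oplus>\<^bsub>B\<^esub>i\<in>A. \<phi> (F i y) \<otimes>\<^bsub>B\<^esub> e i)"
    using assms by (intro B.finsum_cong' scalars_closed F_closed e_closed) auto
  also have "\<dots> = y"
    using assms by (intro expansion[symmetric])
  finally show ?thesis .
qed

lemma dual_eq_zeroI:
  assumes g: "g \<in> dual" and "\<And>i. i \<in> A \<Longrightarrow> g (e i) = \<zero>" and x: "x \<in> carrier B"
  shows "g x = \<zero>"
proof -
  have "g x = (\<Oplus>i\<in>A. F i x \<otimes> g (e i))"
    using dual_lincomb[OF g F_closed[OF x] e_closed] expansion[OF x] by simp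
  also have "\<dots> = (\<Oplus>i\<in>A. \<zero>)"
    using assms F_closed[OF x] by (intro R.finsum_cong') (auto simp: Pi_iff)
  finally show ?thesis by simp
qed

text \<open>Let I be the ideal of all values f(1). Multiplication by \<open>e j\<close> turns a
  value at \<open>e j\<close> into a value at 1, so the coordinates of all \<open>e j\<close> lie in
  I and I B = B. Nakayama's lemma gives w, congruent to 1 modulo I, with w B = 0. As
  \<open>\<phi>\<close> is injective, w = 0, so 1 lies in I.\<close>

lemma retraction_exists: "\<exists>\<pi>\<in>dual. \<pi> \<one>\<^bsub>B\<^esub> = \<one>"
proof -
  let ?I = "{f \<one>\<^bsub>B\<^esub> | f. f \<in> dual}"
  have smult: "r \<otimes> x \<in> ?I" if "x \<in> ?I" "r \<in> carrier R" for r x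
  proof -
    from that obtain f where "f \<in> dual" "x = f \<one>\<^bsub>B\<^esub>" by auto
    then show ?thesis
      using dual_scale[of f r] that by auto
  qed
  have IR: "x \<in> carrier R" if "x \<in> ?I" for x
    using that by auto
  have I: "ideal ?I R"
  proof (rule idealI[OF R.ring_axioms])
    show "subgroup ?I (add_monoid R)"
    proof (rule R.add.subgroupI)
      show "?I \<noteq> {}" using zero_dual by auto
      show "\<ominus> a \<in> ?I" if "a \<in> ?I" for a
        using smult[OF that, of "\<ominus> \<one>"] IR[OF that] by (simp add: R.l_minus)
      show "a \<oplus> b \<in> ?I" if "a \<in> ?I" "b \<in> ?I" for a b
      proof -
        from that obtain f g where "f \<in> dual" "a = f \<one>\<^bsub>B\<^esub>" "g \<in> dual" "b = g \<one>\<^bsub>B\<^esub>" by auto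
        then show ?thesis using dual_sum[of f g] by auto
      qed
    qed auto
    show "x \<otimes> a \<in> ?I" if "a \<in> ?I" "x \<in> carrier R" for a x
      using smult[OF that] .
    show "a \<otimes> x \<in> ?I" if "a \<in> ?I" "x \<in> carrier R" for a x
      using smult[OF that] R.m_comm[of a x] IR[OF that(1)] that(2) by simp
  qed
  have "\<exists>w\<in>carrier R. \<one> \<ominus> w \<in> ?I \<and> (\<forall>j\<in>A. \<phi> w \<otimes>\<^bsub>B\<^esub> e j = \<zero>\<^bsub>B\<^esub>)"
  proof (rule nakayama[OF I finite_A e_closed])
    show "\<one> \<ominus> \<one> \<in> ?I"
      using zero_dual by (auto simp: R.minus_eq R.r_neg)
    show "\<exists>c\<in>A \<rightarrow> ?I. \<phi> \<one> \<otimes>\<^bsub>B\<^esub> e j = (\<Oplus>\<^bsub>B\<^esub>k\<in>A. \<phi> (c k) \<otimes>\<^bsub>B\<^esub> e k)" if j: "j \<in> A" for j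
    proof (intro bexI)
      have ej: "e j \<in> carrier B"
        using e_closed j by auto
      then show "\<phi> \<one> \<otimes>\<^bsub>B\<^esub> e j = (\<Oplus>\<^bsub>B\<^esub>k\<in>A. \<phi> (F k (e j)) \<otimes>\<^bsub>B\<^esub> e k)"
        using expansion[OF ej] by simp
      show "(\<lambda>k. F k (e j)) \<in> A \<rightarrow> ?I"
      proof
        fix k assume "k \<in> A"
        then have "(\<lambda>x. F k (x \<otimes>\<^bsub>B\<^esub> e j)) \<in> dual"
          using ej by (intro dual_comp[OF F_dual, where p = "\<lambda>x. x \<otimes>\<^bsub>B\<^esub> e j"]) (auto simp: B.l_distr B.m_assoc)
        moreover have "F k (e j) = F k (\<one>\<^bsub>B\<^esub> \<otimes>\<^bsub>B\<^esub> e j)"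
          using ej by simp
        ultimately show "F k (e j) \<in> ?I"
          by (intro CollectI exI[of _ "\<lambda>x. F k (x \<otimes>\<^bsub>B\<^esub> e j)"]) simp
      qed
    qed
  qed auto
  then obtain w where w: "w \<in> carrier R" "\<one> \<ominus> w \<in> ?I" "\<And>j. j \<in> A \<Longrightarrow> \<phi> w \<otimes>\<^bsub>B\<^esub> e j = \<zero>\<^bsub>B\<^esub>"
    by blast
  \<comment> \<open>\<open>w\<close> kills the generators, hence also the unit; this is read off
    from the coordinates of \<open>\<phi> w\<close>.\<close>
  have "w \<otimes> F i \<one>\<^bsub>B\<^esub> = \<zero>" if "i \<in> A" for i
  proof (rule dual_eq_zeroI[of "\<lambda>x. w \<otimes> F i x"])
    show "w \<otimes> F i (e j) = \<zero>" if "j \<in> A" for j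
      using dual_smult[of "F i" w "e j"] F_dual[OF \<open>i \<in> A\<close>] w(1) w(3)[OF that]
        funcset_mem[OF e_closed that] by (simp add: F_dual[OF \<open>i \<in> A\<close>] dual_zero)
  qed (use dual_scale[OF F_dual[OF that] w(1)] in auto)
  then have "\<phi> w = \<zero>\<^bsub>B\<^esub>"
    using w(1) by (intro dual_ext) (auto simp: F_dual dual_scalar dual_zero)
  then have "w = \<zero>"
    using phi_inj w(1) by (auto dest!: inj_onD[of \<phi> _ w \<zero>])
  then show ?thesis
    using w(2) by (auto simp: R.minus_eq)
qed

section \<open>The complement of the base ring and tests modulo R\<close>

definition retraction :: "'b \<Rightarrow> 'r" where
  "retraction = (SOME f. f \<in> dual \<and> f \<one>\<^bsub>B\<^esub> = \<one>)"

lemma retraction_dual [simp]: "retraction \<in> dual" and retraction_one: "retraction \<one>\<^bsub>B\<^esub> = \<one>"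
  using someI_ex[of "\<lambda>f. f \<in> dual \<and> f \<one>\<^bsub>B\<^esub> = \<one>"] retraction_exists
  unfolding retraction_def by auto

text \<open>The projection along R onto the kernel of \<open>retraction\<close>; its image is a copy
  of B/R inside \<open>B\<close>.\<close>

definition reduce :: "'b \<Rightarrow> 'b" where
  "reduce x = x \<ominus>\<^bsub>B\<^esub> \<phi> (retraction x)"

lemma reduce_closed [simp, intro]: "x \<in> carrier B \<Longrightarrow> reduce x \<in> carrier B"
  unfolding reduce_def by simp

text \<open>This is the supply of elements of \<open>dual0\<close>: every functional can be pushed
  into it, which is why \<open>dual0\<close> suffices to test membership in R.\<close>

lemma reduce_comp_dual0:
  assumes "f \<in> dual"
  shows "(\<lambda>x. f (reduce x)) \<in> dual0"
proof -
  have "(\<lambda>x. f (reduce x)) \<in> dual"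
  proof (rule dual_comp[OF assms])
    fix x y assume xy: "x \<in> carrier B" "y \<in> carrier B"
    have c: "\<phi> (retraction x) \<in> carrier B" "\<phi> (retraction y) \<in> carrier B"
      using xy by auto
    have "reduce (x \<oplus>\<^bsub>B\<^esub> y) = x \<oplus>\<^bsub>B\<^esub> y \<ominus>\<^bsub>B\<^esub> (\<phi> (retraction x) \<oplus>\<^bsub>B\<^esub> \<phi> (retraction y))"
      unfolding reduce_def using xy by (simp add: dual_add)
    then show "reduce (x \<oplus>\<^bsub>B\<^esub> y) = reduce x \<oplus>\<^bsub>B\<^esub> reduce y"
      unfolding reduce_def using xy c by algebra
  next
    fix r x assume "r \<in> carrier R" "x \<in> carrier B"
    then show "reduce (\<phi> r \<otimes>\<^bsub>B\<^esub> x) = \<phi> r \<otimes>\<^bsub>B\<^esub> reduce x"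
      unfolding reduce_def by (simp add: dual_smult a_minus_def B.r_distr B.r_minus)
  qed auto
  moreover have "reduce \<one>\<^bsub>B\<^esub> = \<zero>\<^bsub>B\<^esub>"
    unfolding reduce_def by (simp add: retraction_one a_minus_def B.r_neg)
  ultimately show ?thesis
    unfolding dual0_def using assms by (simp add: dual_zero)
qed

lemma dual0_reduce: "\<lbrakk>f \<in> dual0; x \<in> carrier B\<rbrakk> \<Longrightarrow> f (reduce x) = f x"
  unfolding reduce_def by (simp add: dual_diff dual0_scalar R.minus_eq)

lemma reduce_eq_zeroI:
  assumes "x \<in> carrier B" "\<And>f. f \<in> dual0 \<Longrightarrow> f x = \<zero>"
  shows "reduce x = \<zero>\<^bsub>B\<^esub>"
proof (rule dual_ext)
  fix i assume "i \<in> A"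
  then show "F i (reduce x) = F i \<zero>\<^bsub>B\<^esub>"
    using assms(2)[OF reduce_comp_dual0[OF F_dual]] by (simp add: F_dual dual_zero)
qed (use assms in auto)

lemma scalar_iff:
  assumes "x \<in> carrier B"
  shows "x \<in> \<phi> ` carrier R \<longleftrightarrow> (\<forall>f\<in>dual0. f x = \<zero>)"
proof
  assume "\<forall>f\<in>dual0. f x = \<zero>"
  then have "x \<ominus>\<^bsub>B\<^esub> \<phi> (retraction x) = \<zero>\<^bsub>B\<^esub>"
    using reduce_eq_zeroI[of x] assms unfolding reduce_def by auto
  then have "x = \<phi> (retraction x)"
    using assms by simp
  then show "x \<in> \<phi> ` carrier R"
    using assms by auto
qed (auto simp: dual0_scalar)

text \<open>The radical of \<open>J\<close> contains the coordinates of the vectors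
  \<open>reduce (e j)\<close>, which generate the complement of R. Nakayama's lemma therefore gives
  w killing this complement with 1 - w in the radical. Some power of 1 - w lies in \<open>J\<close>,
  and all its powers fix the values \<open>f x\<close>.\<close>

lemma ideal_acts_as_one:
  assumes J: "ideal J R" and pow: "\<And>f x. \<lbrakk>f \<in> dual0; x \<in> carrier B\<rbrakk> \<Longrightarrow> \<exists>n::nat. f x [^] n \<in> J"
  shows "\<exists>r\<in>J. \<forall>f\<in>dual0. \<forall>x\<in>carrier B. r \<otimes> f x = f x"
proof -
  let ?K = "{x \<in> carrier R. \<exists>n::nat. x [^] n \<in> J}"
  have K: "ideal ?K R"
    using J by (rule R.radical_ideal)
  define e' where "e' i = reduce (e i)" for i
  have e': "e' \<in> A \<rightarrow> carrier B"
    using e_closed unfolding e'_def by auto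
  have "\<exists>w\<in>carrier R. \<one> \<ominus> w \<in> ?K \<and> (\<forall>j\<in>A. \<phi> w \<otimes>\<^bsub>B\<^esub> e' j = \<zero>\<^bsub>B\<^esub>)"
  proof (rule nakayama[OF K finite_A e'])
    show "\<one> \<ominus> \<one> \<in> ?K"
      using additive_subgroup.zero_closed[OF ideal.axioms(1)[OF K]] by (simp add: R.minus_eq R.r_neg)
    show "\<exists>c\<in>A \<rightarrow> ?K. \<phi> \<one> \<otimes>\<^bsub>B\<^esub> e' j = (\<Oplus>\<^bsub>B\<^esub>k\<in>A. \<phi> (c k) \<otimes>\<^bsub>B\<^esub> e' k)" if j: "j \<in> A" for j
    proof (intro bexI)
      have ej: "e' j \<in> carrier B" "e j \<in> carrier B"
        using e' e_closed j by auto
      have c: "(\<lambda>k. F k (e' j)) \<in> A \<rightarrow> carrier R"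
        using F_closed[OF ej(1)] .
      \<comment> \<open>The projected vectors with the same functionals form a dual basis of the
        complement: \<open>reduce\<close> is applied to the expansion of \<open>e' j\<close>, and
        the result is compared under each \<open>F i\<close>.\<close>
      have "e' j = (\<Oplus>\<^bsub>B\<^esub>k\<in>A. \<phi> (F k (e' j)) \<otimes>\<^bsub>B\<^esub> e' k)"
      proof (rule dual_ext)
        fix i assume i: "i \<in> A"
        let ?G = "\<lambda>x. F i (reduce x)"
        have G: "?G \<in> dual0"
          using reduce_comp_dual0[OF F_dual[OF i]] .
        have "F i (\<Oplus>\<^bsub>B\<^esub>k\<in>A. \<phi> (F k (e' j)) \<otimes>\<^bsub>B\<^esub> e' k) = (\<Oplus>k\<in>A. F k (e' j) \<otimes> F i (e' k))"
          by (intro dual_lincomb F_dual i c e')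
        also have "\<dots> = ?G (\<Oplus>\<^bsub>B\<^esub>k\<in>A. \<phi> (F k (e' j)) \<otimes>\<^bsub>B\<^esub> e k)"
          using dual_lincomb[OF dual0_dual[OF G] c e_closed] unfolding e'_def by simp
        also have "\<dots> = ?G (e' j)"
          using expansion[OF ej(1)] by simp
        also have "\<dots> = ?G (e j)"
          unfolding e'_def using dual0_reduce[OF G ej(2)] by simp
        finally show "F i (e' j) = F i (\<Oplus>\<^bsub>B\<^esub>k\<in>A. \<phi> (F k (e' j)) \<otimes>\<^bsub>B\<^esub> e' k)"
          unfolding e'_def by simp
      qed (use ej scalars_closed[OF c e'] in \<open>auto intro!: B.finsum_closed\<close>)
      then show "\<phi> \<one> \<otimes>\<^bsub>B\<^esub> e' j = (\<Oplus>\<^bsub>B\<^esub>k\<in>A. \<phi> (F k (e' j)) \<otimes>\<^bsub>B\<^esub> e' k)"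
        using ej by simp
      \<comment> \<open>Each coordinate is the value at \<open>e j\<close> of the composite of
        \<open>F k\<close> with \<open>reduce\<close>, an element of \<open>dual0\<close>, so
        \<open>pow\<close> applies.\<close>
      show "(\<lambda>k. F k (e' j)) \<in> A \<rightarrow> ?K"
        using pow[OF reduce_comp_dual0[OF F_dual] ej(2)] c unfolding e'_def by (auto simp: Pi_iff)
    qed
  qed auto
  then obtain w where w: "w \<in> carrier R" "\<one> \<ominus> w \<in> ?K" "\<And>j. j \<in> A \<Longrightarrow> \<phi> w \<otimes>\<^bsub>B\<^esub> e' j = \<zero>\<^bsub>B\<^esub>"
    by blast
  then obtain n :: nat where n: "(\<one> \<ominus> w) [^] n \<in> J" by auto
  have fix1: "(\<one> \<ominus> w) \<otimes> f x = f x" if f: "f \<in> dual0" and x: "x \<in> carrier B" for f x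
  proof -
    have fx: "f x \<in> carrier R" using f x by auto
    have "w \<otimes> f x = \<zero>"
    proof (rule dual_eq_zeroI[of "\<lambda>x. w \<otimes> f x"])
      fix j assume j: "j \<in> A"
      then have ej: "e j \<in> carrier B" using e_closed by auto
      have "w \<otimes> f (e j) = f (\<phi> w \<otimes>\<^bsub>B\<^esub> e' j)"
        using f w ej unfolding e'_def by (simp add: dual_smult dual0_reduce)
      then show "w \<otimes> f (e j) = \<zero>"
        using w(3)[OF j] f by (simp add: dual_zero)
    qed (use dual_scale[OF dual0_dual[OF f] w(1)] x in auto)
    moreover have "(\<one> \<ominus> w) \<otimes> f x = f x \<ominus> w \<otimes> f x"
      using w(1) fx by algebra
    ultimately show ?thesis
      using fx by (simp add: R.minus_eq)
  qed
  have "(\<one> \<ominus> w) [^] k \<otimes> f x = f x" if "f \<in> dual0" "x \<in> carrier B" for f x and k :: nat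
    using that w(1) fix1[OF that] by (induction k) (auto simp: R.m_assoc)
  with n show ?thesis by blast
qed

text \<open>Polarizing \<open>g(x) f(x) = 0\<close> shows that \<open>f(x)\<^sup>2\<close> annihilates all values of \<open>g\<close>.\<close>

lemma dual0_eq_zeroI:
  assumes g: "g \<in> dual0" and gf: "\<And>f x. \<lbrakk>f \<in> dual0; x \<in> carrier B\<rbrakk> \<Longrightarrow> g x \<otimes> f x = \<zero>"
    and z: "z \<in> carrier B"
  shows "g z = \<zero>"
proof -
  let ?J = "{r \<in> carrier R. \<forall>z\<in>carrier B. r \<otimes> g z = \<zero>}"
  have "ideal ?J R"
  proof (rule idealI[OF R.ring_axioms])
    show "subgroup ?J (add_monoid R)"
    proof (rule R.add.subgroupI)
      have "\<zero> \<in> ?J" using g by auto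
      then show "?J \<noteq> {}" by blast
    qed (use g in \<open>auto simp: R.l_distr R.l_minus\<close>)
    show "x \<otimes> a \<in> ?J" if "a \<in> ?J" "x \<in> carrier R" for a x
      using that g by (auto simp: R.m_assoc)
    then show "a \<otimes> x \<in> ?J" if "a \<in> ?J" "x \<in> carrier R" for a x
      using that R.m_comm[of a x] by auto
  qed
  moreover have "\<exists>n::nat. f x [^] n \<in> ?J" if f: "f \<in> dual0" and x: "x \<in> carrier B" for f x
  proof (intro exI[of _ 2] CollectI conjI ballI)
    fix z assume z: "z \<in> carrier B"
    have c: "f x \<in> carrier R" "f z \<in> carrier R" "g x \<in> carrier R" "g z \<in> carrier R"
      using f g x z by auto
    have "(g x \<oplus> g z) \<otimes> (f x \<oplus> f z) = \<zero>"
      using gf[OF f, of "x \<oplus>\<^bsub>B\<^esub> z"] f g x z by (simp add: dual_add)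
    then have "f x \<otimes> ((g x \<oplus> g z) \<otimes> (f x \<oplus> f z)) = \<zero>"
      using c by simp
    \<comment> \<open>In the expanded product the terms with \<open>g x \<otimes> f x\<close> and
      \<open>g z \<otimes> f z\<close> vanish. The additional factor \<open>f x\<close> also removes
      the mixed term \<open>g x \<otimes> f z\<close>, which is where the exponent 2 comes
      from.\<close>
    moreover have "f x [^] (2::nat) \<otimes> g z = f x \<otimes> ((g x \<oplus> g z) \<otimes> (f x \<oplus> f z))
       \<ominus> (f x \<oplus> f z) \<otimes> (g x \<otimes> f x) \<ominus> f x \<otimes> (g z \<otimes> f z)"
      unfolding numeral_2_eq_2 using c by simp algebra
    ultimately show "f x [^] (2::nat) \<otimes> g z = \<zero>"
      using gf[OF f x] gf[OF f z] c by (simp add: R.minus_eq)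
  qed (use f x in auto)
  ultimately obtain r where "r \<in> ?J" "\<forall>f\<in>dual0. \<forall>x\<in>carrier B. r \<otimes> f x = f x"
    using ideal_acts_as_one[of ?J] by blast
  then have "g z = r \<otimes> g z" "r \<otimes> g z = \<zero>"
    using g z by simp_all
  then show ?thesis by simp
qed

end

section \<open>Algebras of degree two\<close>

text \<open>Here \<open>te\<close>, \<open>ty\<close>, \<open>u\<close> stand for traces of b, y, b
  + y; \<open>he\<close>, \<open>hy\<close>, \<open>p\<close> for the values of a functional h at b,
  y, by + yb; and \<open>s\<close>, \<open>\<tau>\<close> for those of f at b and by + yb, where
  f(y) = 0. After multiplication of the first identity by \<open>s\<close>, the second one
  eliminates \<open>u\<close>. As \<open>ty \<otimes> hy\<close> is h(y^2), the left side of the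
  result is linear in y and the right side quadratic.\<close>

lemma (in cring) trace_linearization:
  assumes c: "te \<in> carrier R" "he \<in> carrier R" "p \<in> carrier R" "ty \<in> carrier R" "hy \<in> carrier R"
    "u \<in> carrier R" "s \<in> carrier R" "\<tau> \<in> carrier R"
    and 1: "te \<otimes> he \<oplus> p \<oplus> ty \<otimes> hy = u \<otimes> (he \<oplus> hy)"
    and 2: "te \<otimes> s \<oplus> \<tau> = u \<otimes> s"
  shows "s \<otimes> p \<ominus> \<tau> \<otimes> he \<ominus> s \<otimes> te \<otimes> hy = \<tau> \<otimes> hy \<ominus> s \<otimes> (ty \<otimes> hy)"
proof -
  have "p = (te \<otimes> he \<oplus> p \<oplus> ty \<otimes> hy) \<ominus> te \<otimes> he \<ominus> ty \<otimes> hy"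
    using c by algebra
  then have p: "p = u \<otimes> (he \<oplus> hy) \<ominus> te \<otimes> he \<ominus> ty \<otimes> hy"
    unfolding 1 .
  have "\<tau> = (te \<otimes> s \<oplus> \<tau>) \<ominus> te \<otimes> s"
    using c by algebra
  then have \<tau>: "\<tau> = u \<otimes> s \<ominus> te \<otimes> s"
    unfolding 2 .
  show ?thesis
    unfolding p \<tau> using c(1,2,4-7) by algebra
qed

locale quadratic_algebra = projective_algebra R B \<phi> A e F
  for R :: "('r, 'm) ring_scheme" (structure) and B :: "('b, 'n) ring_scheme" (structure)
    and \<phi> :: "'r \<Rightarrow> 'b" and A :: "'i set" and e :: "'i \<Rightarrow> 'b" and F :: "'i \<Rightarrow> 'b \<Rightarrow> 'r" +
  fixes a :: 'r
  assumes quadratic: "x \<in> carrier B \<Longrightarrow>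
      \<exists>t\<in>carrier R. \<exists>n\<in>carrier R. x \<otimes>\<^bsub>B\<^esub> x = \<phi> t \<otimes>\<^bsub>B\<^esub> x \<oplus>\<^bsub>B\<^esub> \<phi> n"
    and a_closed: "a \<in> carrier R"
    and a_nzd: "nonzerodivisor R (a \<otimes> (a \<ominus> \<one>))"
begin

abbreviation anticomm :: "'b \<Rightarrow> 'b \<Rightarrow> 'b" where
  "anticomm x y \<equiv> x \<otimes>\<^bsub>B\<^esub> y \<oplus>\<^bsub>B\<^esub> y \<otimes>\<^bsub>B\<^esub> x"

text \<open>One \<open>t\<close> serves all functionals at once, so the trace of a sum can be
  computed with one functional and inserted for another.\<close>

lemma quadratic_dual0:
  assumes "x \<in> carrier B"
  shows "\<exists>t\<in>carrier R. \<forall>h\<in>dual0. h (x \<otimes>\<^bsub>B\<^esub> x) = t \<otimes> h x"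
proof -
  from quadratic[OF assms] obtain t n where tn: "t \<in> carrier R" "n \<in> carrier R"
    "x \<otimes>\<^bsub>B\<^esub> x = \<phi> t \<otimes>\<^bsub>B\<^esub> x \<oplus>\<^bsub>B\<^esub> \<phi> n" by blast
  have "h (x \<otimes>\<^bsub>B\<^esub> x) = t \<otimes> h x" if h: "h \<in> dual0" for h
    unfolding tn(3) using assms tn(1,2) h by (simp add: dual_add dual_smult dual0_scalar)
  then show ?thesis using tn(1) by blast
qed

lemma dual_square_add:
  assumes "h \<in> dual" "x \<in> carrier B" "y \<in> carrier B"
  shows "h ((x \<oplus>\<^bsub>B\<^esub> y) \<otimes>\<^bsub>B\<^esub> (x \<oplus>\<^bsub>B\<^esub> y)) = h (x \<otimes>\<^bsub>B\<^esub> x) \<oplus> h (anticomm x y) \<oplus> h (y \<otimes>\<^bsub>B\<^esub> y)"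
proof -
  have "(x \<oplus>\<^bsub>B\<^esub> y) \<otimes>\<^bsub>B\<^esub> (x \<oplus>\<^bsub>B\<^esub> y) = x \<otimes>\<^bsub>B\<^esub> x \<oplus>\<^bsub>B\<^esub> anticomm x y \<oplus>\<^bsub>B\<^esub> y \<otimes>\<^bsub>B\<^esub> y"
    using assms(2,3) by algebra
  then show ?thesis
    using assms by (simp add: dual_add)
qed

lemma anticomm_smult:
  assumes "r \<in> carrier R" "x \<in> carrier B" "y \<in> carrier B"
  shows "anticomm x (\<phi> r \<otimes>\<^bsub>B\<^esub> y) = \<phi> r \<otimes>\<^bsub>B\<^esub> anticomm x y"
  using assms by (simp add: B.r_distr B.m_assoc scalar_left_commute[of r x y])

lemma square_smult:
  assumes "r \<in> carrier R" "x \<in> carrier B"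
  shows "(\<phi> r \<otimes>\<^bsub>B\<^esub> x) \<otimes>\<^bsub>B\<^esub> (\<phi> r \<otimes>\<^bsub>B\<^esub> x) = \<phi> (r \<otimes> r) \<otimes>\<^bsub>B\<^esub> (x \<otimes>\<^bsub>B\<^esub> x)"
  using assms by (simp add: B.m_assoc scalar_left_commute[of r x x])

text \<open>Tested with \<open>f\<close>, the square of b + y determines the multiple by
  \<open>f b\<close> of the trace of b + y, because \<open>f y\<close> vanishes. In the test with
  \<open>h\<close> that trace can then be eliminated.\<close>

lemma trace_on_kernel_aux:
  assumes b: "b \<in> carrier B" and y: "y \<in> carrier B" and f: "f \<in> dual0" and h: "h \<in> dual0"
    and fy: "f y = \<zero>" and te: "te \<in> carrier R" "\<And>h. h \<in> dual0 \<Longrightarrow> h (b \<otimes>\<^bsub>B\<^esub> b) = te \<otimes> h b"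
  shows "f b \<otimes> h (anticomm b y) \<ominus> f (anticomm b y) \<otimes> h b \<ominus> f b \<otimes> te \<otimes> h y =
    f (anticomm b y) \<otimes> h y \<ominus> f b \<otimes> h (y \<otimes>\<^bsub>B\<^esub> y)"
proof -
  obtain ty where ty: "ty \<in> carrier R" "\<And>h. h \<in> dual0 \<Longrightarrow> h (y \<otimes>\<^bsub>B\<^esub> y) = ty \<otimes> h y"
    using quadratic_dual0[OF y] by blast
  obtain u where u: "u \<in> carrier R"
      "\<And>h. h \<in> dual0 \<Longrightarrow> h ((b \<oplus>\<^bsub>B\<^esub> y) \<otimes>\<^bsub>B\<^esub> (b \<oplus>\<^bsub>B\<^esub> y)) = u \<otimes> h (b \<oplus>\<^bsub>B\<^esub> y)"
    using quadratic_dual0[of "b \<oplus>\<^bsub>B\<^esub> y"] b y by blast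
  have sq: "te \<otimes> h b \<oplus> h (anticomm b y) \<oplus> ty \<otimes> h y = u \<otimes> (h b \<oplus> h y)" if "h \<in> dual0" for h
    using u(2)[OF that] dual_square_add[OF dual0_dual[OF that] b y] te(2)[OF that] ty(2)[OF that]
      dual_add[OF dual0_dual[OF that] b y] by simp
  have "te \<otimes> f b \<oplus> f (anticomm b y) = u \<otimes> f b"
    using sq[OF f] fy f b y te ty(1) by simp
  then show ?thesis
    unfolding ty(2)[OF h] using sq[OF h] b y f h te(1) ty(1) u(1)
    by (intro R.trace_linearization) auto
qed

text \<open>
  One side of the identity above is linear in \<open>y\<close> and the other is quadratic, so replacing \<open>y\<close> by
  \<open>a y\<close> shows that \<open>a(a - 1)\<close> annihilates both.
\<close>

lemma trace_on_kernel:
  assumes b: "b \<in> carrier B" and y: "y \<in> carrier B" and f: "f \<in> dual0" and h: "h \<in> dual0"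
    and fy: "f y = \<zero>" and te: "te \<in> carrier R" "\<And>h. h \<in> dual0 \<Longrightarrow> h (b \<otimes>\<^bsub>B\<^esub> b) = te \<otimes> h b"
  shows "f b \<otimes> h (anticomm b y) = f (anticomm b y) \<otimes> h b \<oplus> f b \<otimes> te \<otimes> h y"
    and "f b \<otimes> h (y \<otimes>\<^bsub>B\<^esub> y) = f (anticomm b y) \<otimes> h y"
proof -
  define s p \<tau> he hy q where d: "s = f b" "p = h (anticomm b y)" "\<tau> = f (anticomm b y)"
    "he = h b" "hy = h y" "q = h (y \<otimes>\<^bsub>B\<^esub> y)"
  have c: "s \<in> carrier R" "p \<in> carrier R" "\<tau> \<in> carrier R" "he \<in> carrier R" "hy \<in> carrier R"
    "q \<in> carrier R"
    unfolding d using b y f h by auto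
  note cc = c te(1) a_closed
  let ?g = "s \<otimes> p \<ominus> \<tau> \<otimes> he \<ominus> s \<otimes> te \<otimes> hy"
  have 1: "?g = \<tau> \<otimes> hy \<ominus> s \<otimes> q"
    using trace_on_kernel_aux[OF assms] unfolding d .
  \<comment> \<open>The kernel of \<open>f\<close> is stable under scaling, so the identity also
    holds for the multiple of \<open>y\<close> by \<open>a\<close>, with the same
    \<open>te\<close>.\<close>
  have "f (\<phi> a \<otimes>\<^bsub>B\<^esub> y) = \<zero>"
    using f y fy a_closed by (simp add: dual_smult)
  from trace_on_kernel_aux[OF b _ f h this te]
  have 2: "s \<otimes> (a \<otimes> p) \<ominus> a \<otimes> \<tau> \<otimes> he \<ominus> s \<otimes> te \<otimes> (a \<otimes> hy) =
      a \<otimes> \<tau> \<otimes> (a \<otimes> hy) \<ominus> s \<otimes> (a \<otimes> a \<otimes> q)"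
    using b y a_closed f h unfolding d anticomm_smult[OF a_closed b y] square_smult[OF a_closed y]
    by (simp add: dual_smult del: phi.hom_mult)
  \<comment> \<open>\<open>a \<otimes> ?g\<close> is the left side for the scaled vector, hence
    equal to its right side, which is \<open>a \<otimes> a \<otimes> ?g\<close>.\<close>
  have "a \<otimes> (a \<ominus> \<one>) \<otimes> ?g = a \<otimes> a \<otimes> ?g \<ominus> a \<otimes> ?g"
    using cc by algebra
  also have "a \<otimes> ?g = s \<otimes> (a \<otimes> p) \<ominus> a \<otimes> \<tau> \<otimes> he \<ominus> s \<otimes> te \<otimes> (a \<otimes> hy)"
    using cc by algebra
  also have "\<dots> = a \<otimes> a \<otimes> (\<tau> \<otimes> hy \<ominus> s \<otimes> q)"
    unfolding 2 using cc by algebra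
  also have "a \<otimes> a \<otimes> ?g \<ominus> a \<otimes> a \<otimes> (\<tau> \<otimes> hy \<ominus> s \<otimes> q) = \<zero>"
    unfolding 1 using cc by (simp add: R.minus_eq R.r_neg)
  finally have g0: "?g = \<zero>"
    using a_nzd cc unfolding nonzerodivisor_def by auto
  have "s \<otimes> p = ?g \<oplus> (\<tau> \<otimes> he \<oplus> s \<otimes> te \<otimes> hy)"
    using cc by algebra
  then show "f b \<otimes> h (anticomm b y) = f (anticomm b y) \<otimes> h b \<oplus> f b \<otimes> te \<otimes> h y"
    unfolding g0 unfolding d[symmetric] using cc by simp
  have "s \<otimes> q = \<tau> \<otimes> hy \<ominus> (\<tau> \<otimes> hy \<ominus> s \<otimes> q)"
    using cc by algebra
  then show "f b \<otimes> h (y \<otimes>\<^bsub>B\<^esub> y) = f (anticomm b y) \<otimes> h y"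
    unfolding 1[symmetric] g0 unfolding d[symmetric] using cc by (simp add: R.minus_eq)
qed

lemma anticomm_comp_dual:
  assumes "f \<in> dual" "b \<in> carrier B"
  shows "(\<lambda>y. f (anticomm b y)) \<in> dual"
proof (rule dual_comp[OF assms(1), where p = "\<lambda>y. anticomm b y"])
  show "anticomm b (x \<oplus>\<^bsub>B\<^esub> y) = anticomm b x \<oplus>\<^bsub>B\<^esub> anticomm b y"
    if "x \<in> carrier B" "y \<in> carrier B" for x y
    using that assms(2) by algebra
qed (use assms anticomm_smult in auto)

text \<open>With s = f(b), every x satisfies s x = f(x) b + y where f(y) = 0. Squaring costs s^2,
  and by + yb and y^2 are known only after one more multiplication by s, which accounts for the
  cube.\<close>

lemma scaled_trace_exists:
  assumes b: "b \<in> carrier B" and f: "f \<in> dual0"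
  shows "\<exists>T\<in>dual. \<forall>x\<in>carrier B. \<forall>h\<in>dual0. f b [^] (3::nat) \<otimes> h (x \<otimes>\<^bsub>B\<^esub> x) = T x \<otimes> h x"
proof -
  obtain te where te: "te \<in> carrier R" "\<And>h. h \<in> dual0 \<Longrightarrow> h (b \<otimes>\<^bsub>B\<^esub> b) = te \<otimes> h b"
    using quadratic_dual0[OF b] by blast
  define s where "s = f b"
  have s: "s \<in> carrier R"
    unfolding s_def using b f by auto
  define \<tau> where "\<tau> x = f (anticomm b x)" for x
  have \<tau>: "\<tau> \<in> dual"
    unfolding \<tau>_def using anticomm_comp_dual f b by auto
  define y where "y x = \<phi> s \<otimes>\<^bsub>B\<^esub> x \<oplus>\<^bsub>B\<^esub> \<phi> (\<ominus> f x) \<otimes>\<^bsub>B\<^esub> b" for x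
  have y: "y x \<in> carrier B" if "x \<in> carrier B" for x
    unfolding y_def using s f b that by auto
  \<comment> \<open>The last two summands are \<open>\<tau> (y x)\<close>, written out so that
    linearity in \<open>x\<close> is visible. The outer \<open>s\<close> arises from the factor h(s
    x) = s h(x) in the final product.\<close>
  define T where "T x = s \<otimes> ((s \<otimes> te) \<otimes> f x \<oplus> (s \<otimes> \<tau> x \<oplus> (\<ominus> \<tau> b) \<otimes> f x))" for x
  have "T \<in> dual"
    unfolding T_def using s te(1) \<tau> b dual0_dual[OF f] by (intro dual_scale dual_sum) auto
  moreover have "f b [^] (3::nat) \<otimes> h (x \<otimes>\<^bsub>B\<^esub> x) = T x \<otimes> h x"
    if x: "x \<in> carrier B" and h: "h \<in> dual0" for x h
  proof -
    have fx: "f x \<in> carrier R" "h x \<in> carrier R" "h b \<in> carrier R" "\<tau> x \<in> carrier R" "\<tau> b \<in> carrier R"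
      "h (y x) \<in> carrier R" "h (x \<otimes>\<^bsub>B\<^esub> x) \<in> carrier R" "\<tau> (y x) \<in> carrier R"
      "h (anticomm b (y x)) \<in> carrier R" "h (y x \<otimes>\<^bsub>B\<^esub> y x) \<in> carrier R"
      using f h x b \<tau> y by auto
    have \<tau>y: "\<tau> (y x) = s \<otimes> \<tau> x \<oplus> (\<ominus> \<tau> b) \<otimes> f x"
      unfolding y_def using \<tau> s x b fx by (simp add: dual_add dual_smult dual_minus B.l_minus R.l_minus R.m_comm[of "f x" "\<tau> b"])
    have fy: "f (y x) = \<zero>"
      unfolding y_def using f s x b fx
      by (simp add: dual_add dual_smult s_def[symmetric] dual_minus B.l_minus R.m_comm[of "f x" s] R.r_neg)
    have sx: "\<phi> s \<otimes>\<^bsub>B\<^esub> x = \<phi> (f x) \<otimes>\<^bsub>B\<^esub> b \<oplus>\<^bsub>B\<^esub> y x"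
    proof -
      have c: "\<phi> (f x) \<in> carrier B" "\<phi> s \<in> carrier B"
        using fx s by auto
      have yx: "y x = \<phi> s \<otimes>\<^bsub>B\<^esub> x \<ominus>\<^bsub>B\<^esub> \<phi> (f x) \<otimes>\<^bsub>B\<^esub> b"
        unfolding y_def using fx b by (simp add: B.l_minus B.minus_eq)
      show ?thesis
        unfolding yx using c b x by algebra
    qed
    have hsx: "s \<otimes> h x = f x \<otimes> h b \<oplus> h (y x)"
      using arg_cong[OF sx, of h] h s x b y fx by (simp add: dual_add dual_smult)
    have "h ((\<phi> s \<otimes>\<^bsub>B\<^esub> x) \<otimes>\<^bsub>B\<^esub> (\<phi> s \<otimes>\<^bsub>B\<^esub> x)) = s \<otimes> s \<otimes> h (x \<otimes>\<^bsub>B\<^esub> x)"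
      using h s x by (simp add: square_smult dual_smult del: phi.hom_mult)
    moreover have "h ((\<phi> s \<otimes>\<^bsub>B\<^esub> x) \<otimes>\<^bsub>B\<^esub> (\<phi> s \<otimes>\<^bsub>B\<^esub> x)) =
        f x \<otimes> f x \<otimes> (te \<otimes> h b) \<oplus> f x \<otimes> h (anticomm b (y x)) \<oplus> h (y x \<otimes>\<^bsub>B\<^esub> y x)"
    proof -
      have "anticomm (\<phi> (f x) \<otimes>\<^bsub>B\<^esub> b) (y x) = \<phi> (f x) \<otimes>\<^bsub>B\<^esub> anticomm b (y x)"
        using anticomm_smult[OF fx(1) y[OF x] b] b y[OF x] fx(1) by (simp add: B.a_comm)
      then show ?thesis
        unfolding sx using h b y[OF x] fx(1) te(2)[OF h]
        by (simp add: dual_square_add square_smult dual_smult del: phi.hom_mult)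
    qed
    ultimately have 1: "s \<otimes> s \<otimes> h (x \<otimes>\<^bsub>B\<^esub> x) =
        f x \<otimes> f x \<otimes> (te \<otimes> h b) \<oplus> f x \<otimes> h (anticomm b (y x)) \<oplus> h (y x \<otimes>\<^bsub>B\<^esub> y x)"
      by simp
    have 2: "s \<otimes> h (anticomm b (y x)) = \<tau> (y x) \<otimes> h b \<oplus> s \<otimes> te \<otimes> h (y x)"
      and 3: "s \<otimes> h (y x \<otimes>\<^bsub>B\<^esub> y x) = \<tau> (y x) \<otimes> h (y x)"
      using trace_on_kernel[OF b y[OF x] f h fy te] unfolding s_def \<tau>_def by auto
    have "f b [^] (3::nat) \<otimes> h (x \<otimes>\<^bsub>B\<^esub> x) = s \<otimes> (s \<otimes> s \<otimes> h (x \<otimes>\<^bsub>B\<^esub> x))"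
      unfolding s_def[symmetric] numeral_3_eq_3 using s fx by (simp add: R.m_ac)
    also have "\<dots> = s \<otimes> (f x \<otimes> f x \<otimes> (te \<otimes> h b)) \<oplus> f x \<otimes> (s \<otimes> h (anticomm b (y x)))
        \<oplus> s \<otimes> h (y x \<otimes>\<^bsub>B\<^esub> y x)"
      unfolding 1 using fx s te(1) by algebra
    \<comment> \<open>The coefficient \<open>\<tau> (y x)\<close> occurs both in 2 and in 3. This
      makes the sum a product whose second factor is the value of \<open>h\<close> at s x.\<close>
    also have "\<dots> = (s \<otimes> te \<otimes> f x \<oplus> \<tau> (y x)) \<otimes> (f x \<otimes> h b \<oplus> h (y x))"
      unfolding 2 3 using fx s te(1) by algebra
    also have "\<dots> = T x \<otimes> h x"
      unfolding hsx[symmetric] T_def \<tau>y[symmetric] using fx s te(1) by algebra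
    finally show ?thesis .
  qed
  ultimately show ?thesis by blast
qed

text \<open>The trace identity constrains \<open>T\<close> at the unit only through the values of
  \<open>dual0\<close>. After the ideal argument the value there still has to be normalized to 2,
  the trace of 1 under an involution that fixes 1.\<close>

lemma trace_exists:
  "\<exists>T\<in>dual. T \<one>\<^bsub>B\<^esub> = \<one> \<oplus> \<one> \<and> (\<forall>x\<in>carrier B. \<forall>h\<in>dual0. h (x \<otimes>\<^bsub>B\<^esub> x) = T x \<otimes> h x)"
proof -
  define J where "J = {r \<in> carrier R. \<exists>T\<in>dual. \<forall>x\<in>carrier B. \<forall>h\<in>dual0. r \<otimes> h (x \<otimes>\<^bsub>B\<^esub> x) = T x \<otimes> h x}"
  have smult: "r \<otimes> c \<in> J" if c: "c \<in> J" and r: "r \<in> carrier R" for c r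
  proof -
    from c obtain T where T: "c \<in> carrier R" "T \<in> dual"
      "\<And>x h. \<lbrakk>x \<in> carrier B; h \<in> dual0\<rbrakk> \<Longrightarrow> c \<otimes> h (x \<otimes>\<^bsub>B\<^esub> x) = T x \<otimes> h x"
      unfolding J_def by auto
    then have "r \<otimes> c \<otimes> h (x \<otimes>\<^bsub>B\<^esub> x) = (r \<otimes> T x) \<otimes> h x" if "x \<in> carrier B" "h \<in> dual0" for x h
      using r that by (simp add: R.m_assoc)
    with dual_scale[OF T(2) r] show ?thesis
      unfolding J_def using T(1) r by (intro CollectI conjI bexI[of _ "\<lambda>x. r \<otimes> T x"]) auto
  qed
  have add: "c \<oplus> d \<in> J" if c: "c \<in> J" and d: "d \<in> J" for c d
  proof -
    from c obtain T where T: "c \<in> carrier R" "T \<in> dual"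
      "\<And>x h. \<lbrakk>x \<in> carrier B; h \<in> dual0\<rbrakk> \<Longrightarrow> c \<otimes> h (x \<otimes>\<^bsub>B\<^esub> x) = T x \<otimes> h x"
      unfolding J_def by auto
    from d obtain U where U: "d \<in> carrier R" "U \<in> dual"
      "\<And>x h. \<lbrakk>x \<in> carrier B; h \<in> dual0\<rbrakk> \<Longrightarrow> d \<otimes> h (x \<otimes>\<^bsub>B\<^esub> x) = U x \<otimes> h x"
      unfolding J_def by auto
    have "(c \<oplus> d) \<otimes> h (x \<otimes>\<^bsub>B\<^esub> x) = (T x \<oplus> U x) \<otimes> h x" if "x \<in> carrier B" "h \<in> dual0" for x h
      using T U that by (simp add: R.l_distr)
    with dual_sum[OF T(2) U(2)] show ?thesis
      unfolding J_def using T(1) U(1) by (intro CollectI conjI bexI[of _ "\<lambda>x. T x \<oplus> U x"]) auto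
  qed
  have JR: "c \<in> carrier R" if "c \<in> J" for c
    using that unfolding J_def by auto
  have "\<zero> \<in> J"
    unfolding J_def using zero_dual by (intro CollectI conjI bexI[of _ "\<lambda>x. \<zero>"]) auto
  have "ideal J R"
  proof (rule idealI[OF R.ring_axioms])
    show "subgroup J (add_monoid R)"
    proof (rule R.add.subgroupI)
      show "\<ominus> c \<in> J" if "c \<in> J" for c
        using smult[OF that, of "\<ominus> \<one>"] JR[OF that] by (simp add: R.l_minus)
    qed (use \<open>\<zero> \<in> J\<close> add JR in auto)
    show "x \<otimes> c \<in> J" if "c \<in> J" "x \<in> carrier R" for c x
      using smult[OF that] .
    show "c \<otimes> x \<in> J" if "c \<in> J" "x \<in> carrier R" for c x
      using smult[OF that] R.m_comm[of c x] JR[OF that(1)] that(2) by simp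
  qed
  moreover have "\<exists>n::nat. f x [^] n \<in> J" if "f \<in> dual0" "x \<in> carrier B" for f x
    unfolding J_def using scaled_trace_exists[OF that(2,1)] that
    by (intro exI[of _ 3] CollectI conjI) auto
  ultimately obtain r where r: "r \<in> J" "\<And>f x. \<lbrakk>f \<in> dual0; x \<in> carrier B\<rbrakk> \<Longrightarrow> r \<otimes> f x = f x"
    using ideal_acts_as_one[of J] by blast
  then obtain T where T: "T \<in> dual"
    "\<And>x h. \<lbrakk>x \<in> carrier B; h \<in> dual0\<rbrakk> \<Longrightarrow> r \<otimes> h (x \<otimes>\<^bsub>B\<^esub> x) = T x \<otimes> h x"
    unfolding J_def by auto
  have sq: "h (x \<otimes>\<^bsub>B\<^esub> x) = T x \<otimes> h x" if "x \<in> carrier B" "h \<in> dual0" for x h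
    using T(2)[OF that] r(2)[of h "x \<otimes>\<^bsub>B\<^esub> x"] that by simp
  have T1: "T \<one>\<^bsub>B\<^esub> \<in> carrier R"
    using T(1) by auto
  \<comment> \<open>The squares of x and x + 1 are compared: h(1) = 0, and the cross term
    contributes 2 h(x).\<close>
  have one: "T \<one>\<^bsub>B\<^esub> \<otimes> h x = (\<one> \<oplus> \<one>) \<otimes> h x" if x: "x \<in> carrier B" and h: "h \<in> dual0" for x h
  proof -
    have c: "T x \<in> carrier R" "h x \<in> carrier R"
      using x h T(1) by auto
    have "(T x \<oplus> T \<one>\<^bsub>B\<^esub>) \<otimes> h x = T x \<otimes> h x \<oplus> (h x \<oplus> h x)"
      using sq[of "x \<oplus>\<^bsub>B\<^esub> \<one>\<^bsub>B\<^esub>" h] x h T(1)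
      by (simp add: dual_square_add dual_add dual0_one sq)
    moreover have "T \<one>\<^bsub>B\<^esub> \<otimes> h x = (T x \<oplus> T \<one>\<^bsub>B\<^esub>) \<otimes> h x \<ominus> T x \<otimes> h x"
      using c T1 by algebra
    moreover have "T x \<otimes> h x \<oplus> (h x \<oplus> h x) \<ominus> T x \<otimes> h x = (\<one> \<oplus> \<one>) \<otimes> h x"
      using c by algebra
    ultimately show ?thesis by simp
  qed
  \<comment> \<open>A multiple of the retraction corrects the value at the unit. By
    \<open>one\<close> its coefficient annihilates every \<open>h x\<close>, so the trace identity
    survives.\<close>
  define t where "t x = T x \<oplus> (\<one> \<oplus> \<one> \<ominus> T \<one>\<^bsub>B\<^esub>) \<otimes> retraction x" for x
  show ?thesis
  proof (intro bexI conjI ballI)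
    show "t \<in> dual"
      unfolding t_def using T(1) T1 by (intro dual_sum dual_scale) auto
    show "t \<one>\<^bsub>B\<^esub> = \<one> \<oplus> \<one>"
      unfolding t_def using T1 by (simp add: retraction_one) algebra
    fix x h assume x: "x \<in> carrier B" and h: "h \<in> dual0"
    have c: "T x \<in> carrier R" "h x \<in> carrier R" "retraction x \<in> carrier R"
      using x h T(1) by auto
    have "t x \<otimes> h x = T x \<otimes> h x \<oplus> retraction x \<otimes> ((\<one> \<oplus> \<one>) \<otimes> h x \<ominus> T \<one>\<^bsub>B\<^esub> \<otimes> h x)"
      unfolding t_def using c T1 by algebra
    then show "h (x \<otimes>\<^bsub>B\<^esub> x) = t x \<otimes> h x"
      unfolding one[OF x h] using sq[OF x h] c by (simp add: R.minus_eq R.r_neg)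
  qed
qed

lemma standard_involution_exists: "\<exists>\<sigma>. standard_involution R B \<phi> \<sigma>"
proof -
  obtain t where t: "t \<in> dual" "t \<one>\<^bsub>B\<^esub> = \<one> \<oplus> \<one>"
    and sq: "\<And>x h. \<lbrakk>x \<in> carrier B; h \<in> dual0\<rbrakk> \<Longrightarrow> h (x \<otimes>\<^bsub>B\<^esub> x) = t x \<otimes> h x"
    using trace_exists by blast
  have tR: "t x \<in> carrier R" if "x \<in> carrier B" for x
    using t(1) that by auto
  define \<sigma> where "\<sigma> x = \<phi> (t x) \<ominus>\<^bsub>B\<^esub> x" for x
  have \<sigma>_closed: "\<sigma> x \<in> carrier B" if "x \<in> carrier B" for x
    unfolding \<sigma>_def using tR that by auto
  have \<sigma>_add: "\<sigma> (x \<oplus>\<^bsub>B\<^esub> y) = \<sigma> x \<oplus>\<^bsub>B\<^esub> \<sigma> y" if xy: "x \<in> carrier B" "y \<in> carrier B" for x y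
  proof -
    have "\<phi> (t x) \<in> carrier B" "\<phi> (t y) \<in> carrier B"
      using tR xy by auto
    moreover have "\<sigma> (x \<oplus>\<^bsub>B\<^esub> y) = \<phi> (t x) \<oplus>\<^bsub>B\<^esub> \<phi> (t y) \<ominus>\<^bsub>B\<^esub> (x \<oplus>\<^bsub>B\<^esub> y)"
      unfolding \<sigma>_def using t(1) tR xy by (simp add: dual_add)
    ultimately show ?thesis
      unfolding \<sigma>_def using xy by algebra
  qed
  have \<sigma>_smult: "\<sigma> (\<phi> r \<otimes>\<^bsub>B\<^esub> x) = \<phi> r \<otimes>\<^bsub>B\<^esub> \<sigma> x" if "r \<in> carrier R" "x \<in> carrier B" for r x
    unfolding \<sigma>_def using t(1) tR that by (simp add: dual_smult B.minus_eq B.r_distr B.r_minus)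
  have \<sigma>_one: "\<sigma> \<one>\<^bsub>B\<^esub> = \<one>\<^bsub>B\<^esub>"
    unfolding \<sigma>_def t(2) by simp algebra
  have \<sigma>_\<sigma>: "\<sigma> (\<sigma> x) = x" if x: "x \<in> carrier B" for x
  proof -
    have c: "\<phi> (t x) \<in> carrier B" "t x \<in> carrier R"
      using tR x by auto
    \<comment> \<open>The normalization t(1) = 2 makes \<open>t\<close> invariant under
      \<open>\<sigma>\<close>.\<close>
    have "t (\<sigma> x) = t x \<otimes> (\<one> \<oplus> \<one>) \<ominus> t x"
      unfolding \<sigma>_def using t x c by (simp add: dual_diff dual_scalar)
    then have "t (\<sigma> x) = t x"
      using c by (simp add: R.r_distr) algebra
    then have "\<sigma> (\<sigma> x) = \<phi> (t x) \<ominus>\<^bsub>B\<^esub> (\<phi> (t x) \<ominus>\<^bsub>B\<^esub> x)"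
      unfolding \<sigma>_def by simp
    then show ?thesis
      using c x by algebra
  qed
  have norm: "x \<otimes>\<^bsub>B\<^esub> \<sigma> x \<in> \<phi> ` carrier R" if x: "x \<in> carrier B" for x
  proof -
    have "x \<otimes>\<^bsub>B\<^esub> \<sigma> x = \<phi> (t x) \<otimes>\<^bsub>B\<^esub> x \<ominus>\<^bsub>B\<^esub> x \<otimes>\<^bsub>B\<^esub> x"
      unfolding \<sigma>_def using x tR by (simp add: B.minus_eq B.r_distr B.r_minus central)
    then have "h (x \<otimes>\<^bsub>B\<^esub> \<sigma> x) = \<zero>" if "h \<in> dual0" for h
      using that x tR sq[OF x that] by (simp add: dual_diff dual_smult R.minus_eq R.r_neg)
    then show ?thesis
      using scalar_iff[of "x \<otimes>\<^bsub>B\<^esub> \<sigma> x"] x \<sigma>_closed by auto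
  qed
  have anticomm: "h (anticomm x y) = t x \<otimes> h y \<oplus> t y \<otimes> h x"
    if x: "x \<in> carrier B" and y: "y \<in> carrier B" and h: "h \<in> dual0" for x y h
  proof -
    have c: "h x \<in> carrier R" "h y \<in> carrier R" "t x \<in> carrier R" "t y \<in> carrier R"
      "h (anticomm x y) \<in> carrier R"
      using x y h tR by auto
    have "t x \<otimes> h x \<oplus> h (anticomm x y) \<oplus> t y \<otimes> h y = (t x \<oplus> t y) \<otimes> (h x \<oplus> h y)"
      using sq[of "x \<oplus>\<^bsub>B\<^esub> y" h] dual_square_add[of h x y] x y h t(1) sq by (simp add: dual_add)
    moreover have "h (anticomm x y) =
        (t x \<otimes> h x \<oplus> h (anticomm x y) \<oplus> t y \<otimes> h y) \<ominus> t x \<otimes> h x \<ominus> t y \<otimes> h y"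
      using c by algebra
    moreover have "(t x \<oplus> t y) \<otimes> (h x \<oplus> h y) \<ominus> t x \<otimes> h x \<ominus> t y \<otimes> h y = t x \<otimes> h y \<oplus> t y \<otimes> h x"
      using c by algebra
    ultimately show ?thesis by simp
  qed
  \<comment> \<open>\<open>y\<close> comes first because \<open>D y\<close> will be treated as a
    functional of \<open>x\<close>.\<close>
  define D where "D y x = \<sigma> (x \<otimes>\<^bsub>B\<^esub> y) \<ominus>\<^bsub>B\<^esub> \<sigma> y \<otimes>\<^bsub>B\<^esub> \<sigma> x" for x y
  have D_closed: "D y x \<in> carrier B" if "x \<in> carrier B" "y \<in> carrier B" for x y
    unfolding D_def using that \<sigma>_closed by auto
  \<comment> \<open>Apart from scalars and linear terms, the products enter only through xy + yx.
    The polarized trace identity therefore makes \<open>D y x\<close> a scalar although the trace of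
    xy is unknown.\<close>
  have D_expand: "D y x = \<phi> (t (x \<otimes>\<^bsub>B\<^esub> y) \<ominus> t y \<otimes> t x) \<ominus>\<^bsub>B\<^esub> anticomm x y
      \<oplus>\<^bsub>B\<^esub> (\<phi> (t y) \<otimes>\<^bsub>B\<^esub> x \<oplus>\<^bsub>B\<^esub> \<phi> (t x) \<otimes>\<^bsub>B\<^esub> y)"
    if x: "x \<in> carrier B" and y: "y \<in> carrier B" for x y
  proof -
    have c: "\<phi> (t x) \<in> carrier B" "\<phi> (t y) \<in> carrier B" "\<phi> (t (x \<otimes>\<^bsub>B\<^esub> y)) \<in> carrier B"
      and tt: "t x \<in> carrier R" "t y \<in> carrier R" "t (x \<otimes>\<^bsub>B\<^esub> y) \<in> carrier R"
      using tR x y by auto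
    have yt: "\<phi> (t x) \<otimes>\<^bsub>B\<^esub> y = y \<otimes>\<^bsub>B\<^esub> \<phi> (t x)"
      using central[OF tt(1) y] .
    have e: "\<phi> (t (x \<otimes>\<^bsub>B\<^esub> y) \<ominus> t y \<otimes> t x) = \<phi> (t (x \<otimes>\<^bsub>B\<^esub> y)) \<ominus>\<^bsub>B\<^esub> \<phi> (t y) \<otimes>\<^bsub>B\<^esub> \<phi> (t x)"
      using tt by (simp add: a_minus_def)
    show ?thesis
      unfolding D_def \<sigma>_def e yt using c x y by algebra
  qed
  have D_dual0: "h (D y x) = \<zero>" if x: "x \<in> carrier B" and y: "y \<in> carrier B" and h: "h \<in> dual0" for x y h
  proof -
    have c: "h x \<in> carrier R" "h y \<in> carrier R" "t x \<in> carrier R" "t y \<in> carrier R"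
      "t (x \<otimes>\<^bsub>B\<^esub> y) \<in> carrier R"
      using x y h tR by auto
    have "h (D y x) = \<zero> \<ominus> (t x \<otimes> h y \<oplus> t y \<otimes> h x) \<oplus> (t y \<otimes> h x \<oplus> t x \<otimes> h y)"
      unfolding D_expand[OF x y] anticomm[OF x y h, symmetric] using h x y c
      by (simp add: dual_add dual_diff dual_smult dual0_scalar del: phi.hom_mult)
    then show ?thesis
      using c by algebra
  qed
  define d where "d y x = retraction (D y x)" for x y
  have d_closed: "d y x \<in> carrier R" if "x \<in> carrier B" "y \<in> carrier B" for x y
    unfolding d_def using D_closed that by auto
  have D_eq: "D y x = \<phi> (d y x)" if xy: "x \<in> carrier B" "y \<in> carrier B" for x y
  proof -
    have "reduce (D y x) = \<zero>\<^bsub>B\<^esub>"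
      using xy by (intro reduce_eq_zeroI D_closed D_dual0)
    then show ?thesis
      unfolding reduce_def d_def using D_closed xy by simp
  qed
  have d_dual0: "d y \<in> dual0" if y: "y \<in> carrier B" for y
  proof -
    have "(\<lambda>x. retraction (D y x)) \<in> dual"
    proof (rule dual_comp[OF retraction_dual])
      show "D y (x \<oplus>\<^bsub>B\<^esub> z) = D y x \<oplus>\<^bsub>B\<^esub> D y z" if xz: "x \<in> carrier B" "z \<in> carrier B" for x z
      proof -
        have c: "\<sigma> x \<in> carrier B" "\<sigma> y \<in> carrier B" "\<sigma> z \<in> carrier B"
          "\<sigma> (x \<otimes>\<^bsub>B\<^esub> y) \<in> carrier B" "\<sigma> (z \<otimes>\<^bsub>B\<^esub> y) \<in> carrier B"
          using \<sigma>_closed xz y by auto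
        have "D y (x \<oplus>\<^bsub>B\<^esub> z) =
            \<sigma> (x \<otimes>\<^bsub>B\<^esub> y) \<oplus>\<^bsub>B\<^esub> \<sigma> (z \<otimes>\<^bsub>B\<^esub> y) \<ominus>\<^bsub>B\<^esub> \<sigma> y \<otimes>\<^bsub>B\<^esub> (\<sigma> x \<oplus>\<^bsub>B\<^esub> \<sigma> z)"
          unfolding D_def using xz y by (simp add: B.l_distr \<sigma>_add)
        then show ?thesis
          unfolding D_def using c by algebra
      qed
      show "D y (\<phi> r \<otimes>\<^bsub>B\<^esub> x) = \<phi> r \<otimes>\<^bsub>B\<^esub> D y x" if "r \<in> carrier R" "x \<in> carrier B" for r x
        unfolding D_def using that y \<sigma>_closed
        by (simp add: B.m_assoc \<sigma>_smult scalar_left_commute[of r "\<sigma> y" "\<sigma> x"] B.minus_eq B.r_distr B.r_minus)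
    qed (use D_closed y in auto)
    moreover have "D y \<one>\<^bsub>B\<^esub> = \<zero>\<^bsub>B\<^esub>"
      unfolding D_def using y \<sigma>_closed[OF y] by (simp add: \<sigma>_one B.minus_eq B.r_neg)
    ultimately show ?thesis
      unfolding dual0_def d_def by (simp add: dual_zero)
  qed
  \<comment> \<open>As \<open>D y x\<close> is a scalar, \<open>d y x \<otimes> h x\<close> is the
    value of \<open>h\<close> at its product with \<open>x\<close>. Once this vanishes for all
    \<open>h\<close>, polarization applies because \<open>d y\<close> lies in
    \<open>dual0\<close>.\<close>
  have d_zero: "d y x = \<zero>" if x: "x \<in> carrier B" and y: "y \<in> carrier B" for x y
  proof (rule dual0_eq_zeroI[OF d_dual0[OF y] _ x])
    fix h x assume h: "h \<in> dual0" and x: "x \<in> carrier B"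
    obtain n where n: "n \<in> carrier R" "x \<otimes>\<^bsub>B\<^esub> x = \<phi> (t x) \<otimes>\<^bsub>B\<^esub> x \<oplus>\<^bsub>B\<^esub> \<phi> n"
    proof -
      have "x \<otimes>\<^bsub>B\<^esub> x \<ominus>\<^bsub>B\<^esub> \<phi> (t x) \<otimes>\<^bsub>B\<^esub> x \<in> \<phi> ` carrier R"
      proof -
        have "f (x \<otimes>\<^bsub>B\<^esub> x \<ominus>\<^bsub>B\<^esub> \<phi> (t x) \<otimes>\<^bsub>B\<^esub> x) = \<zero>" if "f \<in> dual0" for f
          using that x tR sq[OF x that] by (simp add: dual_diff dual_smult R.minus_eq R.r_neg)
        then show ?thesis
          using scalar_iff[of "x \<otimes>\<^bsub>B\<^esub> x \<ominus>\<^bsub>B\<^esub> \<phi> (t x) \<otimes>\<^bsub>B\<^esub> x"] x tR by auto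
      qed
      then obtain n where n: "n \<in> carrier R" "x \<otimes>\<^bsub>B\<^esub> x \<ominus>\<^bsub>B\<^esub> \<phi> (t x) \<otimes>\<^bsub>B\<^esub> x = \<phi> n" by auto
      have c: "\<phi> (t x) \<in> carrier B"
        using tR x by auto
      have "x \<otimes>\<^bsub>B\<^esub> x = \<phi> (t x) \<otimes>\<^bsub>B\<^esub> x \<oplus>\<^bsub>B\<^esub> (x \<otimes>\<^bsub>B\<^esub> x \<ominus>\<^bsub>B\<^esub> \<phi> (t x) \<otimes>\<^bsub>B\<^esub> x)"
        using x c by algebra
      then show ?thesis
        using that n by simp
    qed
    define s u v w p q where a: "s = t x" "u = t y" "v = t (x \<otimes>\<^bsub>B\<^esub> y)" "w = h x" "p = h (x \<otimes>\<^bsub>B\<^esub> y)"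
      "q = h (y \<otimes>\<^bsub>B\<^esub> x)"
    \<comment> \<open>The value at xyx is not given directly by a trace identity. Polarization for x
      and xy expresses it through x^2 y, which the quadratic equation of x reduces.\<close>
    define z where "z = h (x \<otimes>\<^bsub>B\<^esub> y \<otimes>\<^bsub>B\<^esub> x)"
    have c: "s \<in> carrier R" "u \<in> carrier R" "v \<in> carrier R" "w \<in> carrier R" "p \<in> carrier R"
      "q \<in> carrier R" "z \<in> carrier R" "h y \<in> carrier R"
      unfolding a z_def using x y h tR by auto
    have xxy: "x \<otimes>\<^bsub>B\<^esub> (x \<otimes>\<^bsub>B\<^esub> y) = \<phi> s \<otimes>\<^bsub>B\<^esub> (x \<otimes>\<^bsub>B\<^esub> y) \<oplus>\<^bsub>B\<^esub> \<phi> n \<otimes>\<^bsub>B\<^esub> y"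
      using n c(1) x y unfolding a by (simp add: B.m_assoc[symmetric] B.l_distr)
    have "h (x \<otimes>\<^bsub>B\<^esub> (x \<otimes>\<^bsub>B\<^esub> y)) = s \<otimes> p \<oplus> n \<otimes> h y"
      unfolding xxy using x y h n(1) c(1) unfolding a by (simp add: dual_add dual_smult)
    then have "s \<otimes> p \<oplus> n \<otimes> h y \<oplus> z = s \<otimes> p \<oplus> v \<otimes> w"
      using anticomm[OF x _ h, of "x \<otimes>\<^bsub>B\<^esub> y"] x y h unfolding a z_def by (simp add: dual_add)
    moreover have "z = s \<otimes> p \<oplus> n \<otimes> h y \<oplus> z \<ominus> (s \<otimes> p \<oplus> n \<otimes> h y)"
      using c n(1) by algebra
    moreover have "s \<otimes> p \<oplus> v \<otimes> w \<ominus> (s \<otimes> p \<oplus> n \<otimes> h y) = v \<otimes> w \<ominus> n \<otimes> h y"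
      using c n(1) by algebra
    ultimately have z: "z = v \<otimes> w \<ominus> n \<otimes> h y"
      by simp
    have yxx: "h (y \<otimes>\<^bsub>B\<^esub> (x \<otimes>\<^bsub>B\<^esub> x)) = s \<otimes> q \<oplus> n \<otimes> h y"
    proof -
      have "y \<otimes>\<^bsub>B\<^esub> (x \<otimes>\<^bsub>B\<^esub> x) = \<phi> s \<otimes>\<^bsub>B\<^esub> (y \<otimes>\<^bsub>B\<^esub> x) \<oplus>\<^bsub>B\<^esub> \<phi> n \<otimes>\<^bsub>B\<^esub> y"
        using n c(1) x y scalar_left_commute[of s y x] central[of n y] unfolding a
        by (simp add: B.r_distr)
      then show ?thesis
        using x y h n(1) c(1) unfolding a by (simp add: dual_add dual_smult)
    qed
    have "d y x \<otimes> w = h (D y x \<otimes>\<^bsub>B\<^esub> x)"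
      using D_eq[OF x y] d_closed[OF x y] x h unfolding a by (simp add: dual_smult)
    also have "D y x \<otimes>\<^bsub>B\<^esub> x = \<phi> (v \<ominus> u \<otimes> s) \<otimes>\<^bsub>B\<^esub> x \<ominus>\<^bsub>B\<^esub> (x \<otimes>\<^bsub>B\<^esub> y \<otimes>\<^bsub>B\<^esub> x \<oplus>\<^bsub>B\<^esub> y \<otimes>\<^bsub>B\<^esub> (x \<otimes>\<^bsub>B\<^esub> x))
        \<oplus>\<^bsub>B\<^esub> (\<phi> u \<otimes>\<^bsub>B\<^esub> (x \<otimes>\<^bsub>B\<^esub> x) \<oplus>\<^bsub>B\<^esub> \<phi> s \<otimes>\<^bsub>B\<^esub> (y \<otimes>\<^bsub>B\<^esub> x))"
    proof -
      have k: "\<phi> (v \<ominus> u \<otimes> s) \<in> carrier B" "\<phi> u \<in> carrier B" "\<phi> s \<in> carrier B"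
        using c by auto
      show ?thesis
        unfolding D_expand[OF x y] a[symmetric] using k x y by algebra
    qed
    also have "h \<dots> = (v \<ominus> u \<otimes> s) \<otimes> w \<ominus> (z \<oplus> (s \<otimes> q \<oplus> n \<otimes> h y)) \<oplus> (u \<otimes> (s \<otimes> w) \<oplus> s \<otimes> q)"
      unfolding z_def yxx[symmetric] using sq[OF x h] x y h c unfolding a
      by (simp add: dual_add dual_diff dual_smult del: phi.hom_mult)
    \<comment> \<open>With \<open>z\<close> inserted, both the unknown trace \<open>v\<close> of xy
      and the constant term \<open>n\<close> cancel.\<close>
    also have "\<dots> = \<zero>"
      unfolding z using c n(1) by algebra
    finally show "d y x \<otimes> h x = \<zero>"
      unfolding a .
  qed
  have \<sigma>_mult: "\<sigma> (x \<otimes>\<^bsub>B\<^esub> y) = \<sigma> y \<otimes>\<^bsub>B\<^esub> \<sigma> x" if xy: "x \<in> carrier B" "y \<in> carrier B" for x y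
  proof -
    have "D y x = \<zero>\<^bsub>B\<^esub>"
      using D_eq[OF xy] d_zero[OF xy] by simp
    then show ?thesis
      unfolding D_def using \<sigma>_closed xy by simp
  qed
  have "standard_involution R B \<phi> \<sigma>"
    unfolding standard_involution_def
    using \<sigma>_closed \<sigma>_add \<sigma>_smult \<sigma>_one \<sigma>_mult \<sigma>_\<sigma> norm by auto
  then show ?thesis by blast
qed

end

section \<open>Degrees and dual bases\<close>

context central_map
begin

lemma satisfies_monic_1:
  assumes x: "x \<in> carrier B"
  shows "satisfies_monic R B \<phi> 1 x \<longleftrightarrow> x \<in> \<phi> ` carrier R"
proof
  assume "satisfies_monic R B \<phi> 1 x"
  then obtain c where c: "c \<in> {..<1::nat} \<rightarrow> carrier R"
    and eq: "x [^]\<^bsub>B\<^esub> (1::nat) \<oplus>\<^bsub>B\<^esub> (\<Oplus>\<^bsub>B\<^esub>i\<in>{..<1::nat}. \<phi> (c i) \<otimes>\<^bsub>B\<^esub> x [^]\<^bsub>B\<^esub> i) = \<zero>\<^bsub>B\<^esub>"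
    unfolding satisfies_monic_def by blast
  have c0: "c 0 \<in> carrier R"
    using c by auto
  then have "x \<oplus>\<^bsub>B\<^esub> \<phi> (c 0) = \<zero>\<^bsub>B\<^esub>"
    using eq x by (simp add: lessThan_Suc)
  then have "x = \<phi> (\<ominus> c 0)"
    using c0 x by (simp add: B.minus_equality[symmetric] B.a_comm)
  then show "x \<in> \<phi> ` carrier R"
    using c0 by blast
next
  assume "x \<in> \<phi> ` carrier R"
  then obtain r where r: "r \<in> carrier R" "x = \<phi> r" by auto
  then show "satisfies_monic R B \<phi> 1 x"
    unfolding satisfies_monic_def
    by (intro bexI[of _ "\<lambda>_. \<ominus> r"]) (auto simp: lessThan_Suc B.r_neg)
qed

lemma satisfies_monic_2:
  assumes x: "x \<in> carrier B"
  shows "satisfies_monic R B \<phi> 2 x \<longleftrightarrow>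
    (\<exists>t\<in>carrier R. \<exists>n\<in>carrier R. x \<otimes>\<^bsub>B\<^esub> x = \<phi> t \<otimes>\<^bsub>B\<^esub> x \<oplus>\<^bsub>B\<^esub> \<phi> n)"
proof -
  have sum: "x [^]\<^bsub>B\<^esub> (2::nat) \<oplus>\<^bsub>B\<^esub> (\<Oplus>\<^bsub>B\<^esub>i\<in>{..<2::nat}. \<phi> (c i) \<otimes>\<^bsub>B\<^esub> x [^]\<^bsub>B\<^esub> i) =
      x \<otimes>\<^bsub>B\<^esub> x \<oplus>\<^bsub>B\<^esub> (\<phi> (c 1) \<otimes>\<^bsub>B\<^esub> x \<oplus>\<^bsub>B\<^esub> \<phi> (c 0))"
    if "c \<in> {..<2::nat} \<rightarrow> carrier R" for c
  proof -
    have c: "c 0 \<in> carrier R" "c 1 \<in> carrier R"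
      using that by auto
    then have "(\<Oplus>\<^bsub>B\<^esub>i\<in>{..<2::nat}. \<phi> (c i) \<otimes>\<^bsub>B\<^esub> x [^]\<^bsub>B\<^esub> i) = \<phi> (c 1) \<otimes>\<^bsub>B\<^esub> x \<oplus>\<^bsub>B\<^esub> \<phi> (c 0)"
      using x by (simp add: numeral_2_eq_2 lessThan_Suc)
    then show ?thesis
      using x by (simp add: numeral_2_eq_2)
  qed
  have move: "x \<otimes>\<^bsub>B\<^esub> x \<oplus>\<^bsub>B\<^esub> (\<phi> t \<otimes>\<^bsub>B\<^esub> x \<oplus>\<^bsub>B\<^esub> \<phi> n) = \<zero>\<^bsub>B\<^esub> \<longleftrightarrow>
      x \<otimes>\<^bsub>B\<^esub> x = \<phi> (\<ominus> t) \<otimes>\<^bsub>B\<^esub> x \<oplus>\<^bsub>B\<^esub> \<phi> (\<ominus> n)"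
    if tn: "t \<in> carrier R" "n \<in> carrier R" for t n
  proof -
    have "\<phi> (\<ominus> t) \<otimes>\<^bsub>B\<^esub> x \<oplus>\<^bsub>B\<^esub> \<phi> (\<ominus> n) = \<ominus>\<^bsub>B\<^esub> (\<phi> t \<otimes>\<^bsub>B\<^esub> x \<oplus>\<^bsub>B\<^esub> \<phi> n)"
      using tn x by (simp add: B.minus_add B.l_minus)
    moreover have "x \<otimes>\<^bsub>B\<^esub> x \<oplus>\<^bsub>B\<^esub> y = \<zero>\<^bsub>B\<^esub> \<longleftrightarrow> x \<otimes>\<^bsub>B\<^esub> x = \<ominus>\<^bsub>B\<^esub> y" if "y \<in> carrier B" for y
      using x that by (metis B.l_neg B.m_closed B.minus_equality)
    ultimately show ?thesis
      using tn x by simp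
  qed
  show ?thesis
  proof
    assume "satisfies_monic R B \<phi> 2 x"
    then obtain c where c: "c \<in> {..<2::nat} \<rightarrow> carrier R"
      and "x \<otimes>\<^bsub>B\<^esub> x \<oplus>\<^bsub>B\<^esub> (\<phi> (c 1) \<otimes>\<^bsub>B\<^esub> x \<oplus>\<^bsub>B\<^esub> \<phi> (c 0)) = \<zero>\<^bsub>B\<^esub>"
      unfolding satisfies_monic_def using sum by auto
    moreover have "c 0 \<in> carrier R" "c 1 \<in> carrier R"
      using c by auto
    ultimately show "\<exists>t\<in>carrier R. \<exists>n\<in>carrier R. x \<otimes>\<^bsub>B\<^esub> x = \<phi> t \<otimes>\<^bsub>B\<^esub> x \<oplus>\<^bsub>B\<^esub> \<phi> n"
      using move by blast
  next
    assume "\<exists>t\<in>carrier R. \<exists>n\<in>carrier R. x \<otimes>\<^bsub>B\<^esub> x = \<phi> t \<otimes>\<^bsub>B\<^esub> x \<oplus>\<^bsub>B\<^esub> \<phi> n"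
    then obtain t n where tn: "t \<in> carrier R" "n \<in> carrier R"
      and eq: "x \<otimes>\<^bsub>B\<^esub> x = \<phi> t \<otimes>\<^bsub>B\<^esub> x \<oplus>\<^bsub>B\<^esub> \<phi> n" by blast
    define c where "c i = (if i = (0::nat) then \<ominus> n else \<ominus> t)" for i
    have c: "c \<in> {..<2::nat} \<rightarrow> carrier R"
      using tn unfolding c_def by auto
    have "x \<otimes>\<^bsub>B\<^esub> x \<oplus>\<^bsub>B\<^esub> (\<phi> (c 1) \<otimes>\<^bsub>B\<^esub> x \<oplus>\<^bsub>B\<^esub> \<phi> (c 0)) = \<zero>\<^bsub>B\<^esub>"
      using move[of "\<ominus> t" "\<ominus> n"] tn eq unfolding c_def by simp
    then show "satisfies_monic R B \<phi> 2 x"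
      unfolding satisfies_monic_def using sum[OF c] c by (intro bexI[of _ c]) auto
  qed
qed

end

section \<open>Degree bounds as quantified equations\<close>

lemma Inf_enat_le_iff: "Inf {enat d | d. P d} \<le> enat n \<longleftrightarrow> (\<exists>d\<le>n. P d)"
proof
  assume le: "Inf {enat d | d. P d} \<le> enat n"
  \<comment> \<open>The infimum of the empty set is infinity, so a finite bound makes the set
    nonempty and the infimum attained.\<close>
  have ne: "{enat d | d. P d} \<noteq> {}"
  proof
    assume "{enat d | d. P d} = {}"
    with le show False
      by (simp only: Inf_enat_def) simp
  qed
  then have "Inf {enat d | d. P d} \<in> {enat d | d. P d}"
    unfolding Inf_enat_def by (auto intro: LeastI)
  with le show "\<exists>d\<le>n. P d" by auto
next
  assume "\<exists>d\<le>n. P d"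
  then obtain d where "d \<le> n" "P d" by auto
  then have "Inf {enat d | d. P d} \<le> enat d"
    by (intro Inf_lower) auto
  with \<open>d \<le> n\<close> show "Inf {enat d | d. P d} \<le> enat n"
    using order_trans enat_ord_simps(1) by blast
qed

text \<open>\<open>n\<close> itself is the witness for the outer infimum, which ranges over positive
  numbers only.\<close>

lemma alg_degree_le_iff:
  assumes "n > 0"
  shows "alg_degree R B \<phi> \<le> enat n \<longleftrightarrow>
    (\<forall>x\<in>carrier B. \<exists>d\<le>n. d > 0 \<and> satisfies_monic R B \<phi> d x)"
  unfolding alg_degree_def Inf_enat_le_iff
proof
  assume "\<exists>d\<le>n. 0 < d \<and> (\<forall>x\<in>carrier B. elem_degree R B \<phi> x \<le> enat d)"
  then obtain d where d: "d \<le> n" "\<And>x. x \<in> carrier B \<Longrightarrow> elem_degree R B \<phi> x \<le> enat d" by blast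
  then show "\<forall>x\<in>carrier B. \<exists>d\<le>n. d > 0 \<and> satisfies_monic R B \<phi> d x"
    unfolding elem_degree_def Inf_enat_le_iff by (meson order_trans)
next
  assume "\<forall>x\<in>carrier B. \<exists>d\<le>n. d > 0 \<and> satisfies_monic R B \<phi> d x"
  then show "\<exists>d\<le>n. 0 < d \<and> (\<forall>x\<in>carrier B. elem_degree R B \<phi> x \<le> enat d)"
    using assms unfolding elem_degree_def Inf_enat_le_iff by blast
qed

context central_map
begin

lemma alg_degree_le_1: "alg_degree R B \<phi> \<le> 1 \<longleftrightarrow> \<phi> ` carrier R = carrier B"
proof -
  have "(\<exists>d\<le>1. d > 0 \<and> satisfies_monic R B \<phi> d x) \<longleftrightarrow> x \<in> \<phi> ` carrier R" if "x \<in> carrier B" for x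
    using satisfies_monic_1[OF that] by (auto simp: le_Suc_eq)
  then show ?thesis
    using alg_degree_le_iff[of 1 R B \<phi>] by (auto simp: one_enat_def)
qed

lemma alg_degree_le_2:
  "alg_degree R B \<phi> \<le> 2 \<longleftrightarrow>
    (\<forall>x\<in>carrier B. \<exists>t\<in>carrier R. \<exists>n\<in>carrier R. x \<otimes>\<^bsub>B\<^esub> x = \<phi> t \<otimes>\<^bsub>B\<^esub> x \<oplus>\<^bsub>B\<^esub> \<phi> n)"
proof -
  have "(\<exists>d\<le>2. d > 0 \<and> satisfies_monic R B \<phi> d x) \<longleftrightarrow> satisfies_monic R B \<phi> 2 x"
    if x: "x \<in> carrier B" for x
  proof
    assume "\<exists>d\<le>2. d > 0 \<and> satisfies_monic R B \<phi> d x"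
    then have "satisfies_monic R B \<phi> 1 x \<or> satisfies_monic R B \<phi> 2 x"
      by (metis One_nat_def Suc_leI le_neq_implies_less less_2_cases_iff not_less_eq_eq numeral_2_eq_2)
    \<comment> \<open>A scalar x = r also satisfies x^2 = r x + 0, so degree one is covered by the
      quadratic equation.\<close>
    moreover have "satisfies_monic R B \<phi> 2 x" if "x \<in> \<phi> ` carrier R"
    proof -
      from that obtain r where r: "r \<in> carrier R" "x = \<phi> r" by auto
      then show ?thesis
        unfolding satisfies_monic_2[OF x] by (intro bexI[of _ r] bexI[of _ \<zero>]) auto
    qed
    ultimately show "satisfies_monic R B \<phi> 2 x"
      using satisfies_monic_1[OF x] by blast
  qed (auto intro: exI[of _ 2])
  then show ?thesis
    using alg_degree_le_iff[of 2 R B \<phi>] satisfies_monic_2 by (auto simp: numeral_eq_enat)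
qed

end

text \<open>Degree two is split into the two bounds that have an algebraic criterion.\<close>

lemma enat_eq_2_iff: "(x::enat) = 2 \<longleftrightarrow> x \<le> 2 \<and> \<not> x \<le> 1"
  by (cases x) (auto simp: numeral_eq_enat one_enat_def)

lemma ring_algebra_imp_central_map: "ring_algebra R B \<phi> \<Longrightarrow> central_map R B \<phi>"
  unfolding ring_algebra_def central_map_def central_map_axioms_def by blast

section \<open>From projective modules to finite dual bases\<close>

lemma finsum_algebra_module: "finsum (algebra_module B \<phi>) = finsum B"
  by (simp add: fun_eq_iff finsum_def finprod_def algebra_module_def)

text \<open>
  The coordinates of a projective module, embedded in a free module, are linear functionals; finitely
  many of them suffice because finitely many generators have finite supports.
\<close>

lemma projective_algebra_exists:
  fixes R :: "('r, 'm) ring_scheme" (structure) and B :: "'b ring"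
  assumes alg: "ring_algebra R B \<phi>"
    and fg: "finitely_generated_module R (algebra_module B \<phi>)"
    and proj: "projective_module R (algebra_module B \<phi>)"
  shows "\<exists>(A :: 'b set) e F. projective_algebra R B \<phi> A e F"
proof -
  interpret central_map R B \<phi>
    using alg by (rule ring_algebra_imp_central_map)
  obtain I :: "'b set" and P Q f where
    P: "submodule P R (free_module R I)" and Q: "submodule Q R (free_module R I)"
    and PQ: "P \<inter> Q = {\<zero>\<^bsub>free_module R I\<^esub>}"
      "P <+>\<^bsub>free_module R I\<^esub> Q = carrier (free_module R I)"
    and f: "bij_betw f (carrier B) P"
    and f_add': "\<And>x y. \<lbrakk>x \<in> carrier B; y \<in> carrier B\<rbrakk> \<Longrightarrow> f (x \<oplus>\<^bsub>B\<^esub> y) = f x \<oplus>\<^bsub>free_module R I\<^esub> f y"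
    and f_smult': "\<And>r x. \<lbrakk>r \<in> carrier R; x \<in> carrier B\<rbrakk> \<Longrightarrow> f (\<phi> r \<otimes>\<^bsub>B\<^esub> x) = r \<odot>\<^bsub>free_module R I\<^esub> f x"
    using proj unfolding projective_module_def by (auto simp: algebra_module_def)
  let ?N = "free_module R I"
  have f_add: "f (x \<oplus>\<^bsub>B\<^esub> y) k = f x k \<oplus> f y k" if "x \<in> carrier B" "y \<in> carrier B" for x y k
    using f_add'[OF that] by (simp add: free_module_def)
  have f_smult: "f (\<phi> r \<otimes>\<^bsub>B\<^esub> x) k = r \<otimes> f x k" if "r \<in> carrier R" "x \<in> carrier B" for r x k
    using f_smult'[OF that] by (simp add: free_module_def)
  have sub_add: "(\<lambda>k. u k \<oplus> v k) \<in> M" if "submodule M R ?N" "u \<in> M" "v \<in> M" for u v M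
    using subgroup.m_closed[OF submodule.axioms(1)[OF that(1)] that(2,3)] by (simp add: free_module_def)
  have sub_smult: "(\<lambda>k. r \<otimes> u k) \<in> M" if "submodule M R ?N" "r \<in> carrier R" "u \<in> M" for r u M
    using submodule.smult_closed[OF that] by (simp add: free_module_def)
  have sub_zero: "(\<lambda>k. \<zero>) \<in> M" if "submodule M R ?N" for M
    using subgroup.one_closed[OF submodule.axioms(1)[OF that]] by (simp add: free_module_def)
  have sub_carrier: "u k \<in> carrier R" if "submodule M R ?N" "u \<in> M" for u k M
    using subgroup.mem_carrier[OF submodule.axioms(1)[OF that(1)] that(2)]
    by (cases "k \<in> I") (auto simp: free_module_def)
  have fP: "f x \<in> P" if "x \<in> carrier B" for x
    using f that by (auto simp: bij_betw_def)
  define F where "F i x = f x i" for i x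
  have F_dual: "F i \<in> dual" for i
    unfolding F_def using f_add f_smult sub_carrier[OF P fP] by (intro dualI) auto
  obtain G where G: "finite G" "G \<subseteq> carrier B"
    "\<And>x. x \<in> carrier B \<Longrightarrow> \<exists>c\<in>G \<rightarrow> carrier R. x = (\<Oplus>\<^bsub>B\<^esub>g\<in>G. \<phi> (c g) \<otimes>\<^bsub>B\<^esub> g)"
    using fg unfolding finitely_generated_module_def finsum_algebra_module
    by (auto simp: algebra_module_def)
  \<comment> \<open>Coordinates that vanish on the finitely many generators vanish on all of
    \<open>B\<close>, so this finite index set is enough.\<close>
  define A where "A = (\<Union>g\<in>G. {i \<in> I. f g i \<noteq> \<zero>})"
  have fN: "f x \<in> carrier ?N" if "x \<in> carrier B" for x
    using subgroup.mem_carrier[OF submodule.axioms(1)[OF P] fP[OF that]] by simp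
  have A: "finite A" "A \<subseteq> I"
    unfolding A_def using G fN by (auto simp: free_module_def)
  have support: "f x k = \<zero>" if x: "x \<in> carrier B" and k: "k \<notin> A" for x k
  proof -
    obtain c where c: "c \<in> G \<rightarrow> carrier R" "x = (\<Oplus>\<^bsub>B\<^esub>g\<in>G. \<phi> (c g) \<otimes>\<^bsub>B\<^esub> g)"
      using G(3)[OF x] by blast
    have "f g k = \<zero>" if "g \<in> G" for g
      using fN[of g] G(2) that k unfolding A_def by (auto simp: free_module_def)
    then have "(\<Oplus>g\<in>G. c g \<otimes> f g k) = (\<Oplus>g\<in>G. \<zero>)"
      using c(1) by (intro R.finsum_cong') (auto simp: Pi_iff)
    moreover have "F k x = (\<Oplus>g\<in>G. c g \<otimes> f g k)"
      using dual_lincomb[OF F_dual c(1), of "\<lambda>g. g"] G(2) unfolding c(2) F_def by auto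
    ultimately have "F k x = \<zero>" by simp
    then show ?thesis by (simp add: F_def)
  qed
  define \<delta> where "\<delta> i = (\<lambda>k. if k = i then \<one> else \<zero>)" for i :: 'b
  \<comment> \<open>The vectors of the dual basis: \<open>e i\<close> will be the element of
    \<open>B\<close> whose image is the component in \<open>P\<close> of the standard basis vector
    \<open>\<delta> i\<close>.\<close>
  have "\<exists>x\<in>carrier B. \<exists>q\<in>Q. \<forall>k. \<delta> i k = f x k \<oplus> q k" if i: "i \<in> I" for i
  proof -
    have "\<delta> i \<in> carrier ?N"
      using i unfolding \<delta>_def by (auto simp: free_module_def)
    then have "\<delta> i \<in> P <+>\<^bsub>?N\<^esub> Q"
      using PQ by simp
    then obtain p q where pq: "p \<in> P" "q \<in> Q" "\<delta> i = p \<oplus>\<^bsub>?N\<^esub> q"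
      unfolding set_add_def set_mult_def by auto
    then obtain x where "x \<in> carrier B" "p = f x"
      using f by (auto simp: bij_betw_def)
    with pq show ?thesis
      by (intro bexI[of _ x] bexI[of _ q]) (auto simp: free_module_def)
  qed
  then obtain e q where e: "\<And>i. i \<in> I \<Longrightarrow> e i \<in> carrier B" and q: "\<And>i. i \<in> I \<Longrightarrow> q i \<in> Q"
    and eq: "\<And>i k. i \<in> I \<Longrightarrow> \<delta> i k = f (e i) k \<oplus> q i k"
    by metis
  have eA: "e \<in> A \<rightarrow> carrier B"
    using e A by auto
  have sum_Q: "(\<lambda>k. \<Oplus>i\<in>A'. c i \<otimes> q i k) \<in> Q" if "finite A'" "A' \<subseteq> I" "c \<in> A' \<rightarrow> carrier R" for c A'
    using that
  proof (induction A' rule: finite_induct)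
    case empty
    then show ?case using sub_zero[OF Q] by simp
  next
    case (insert i A')
    have "(\<Oplus>i\<in>insert i A'. c i \<otimes> q i k) = c i \<otimes> q i k \<oplus> (\<Oplus>i\<in>A'. c i \<otimes> q i k)" for k
      using insert sub_carrier[OF Q q] by (intro R.finsum_insert) (auto simp: Pi_iff)
    moreover have "(\<lambda>k. c i \<otimes> q i k \<oplus> (\<Oplus>i\<in>A'. c i \<otimes> q i k)) \<in> Q"
      using insert q by (intro sub_add[OF Q] sub_smult[OF Q]) auto
    ultimately show ?case by simp
  qed
  have expansion: "x = (\<Oplus>\<^bsub>B\<^esub>i\<in>A. \<phi> (F i x) \<otimes>\<^bsub>B\<^esub> e i)" if x: "x \<in> carrier B" for x
  proof -
    have c: "(\<lambda>i. F i x) \<in> A \<rightarrow> carrier R"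
      using F_dual x by auto
    define z where "z = (\<Oplus>\<^bsub>B\<^esub>i\<in>A. \<phi> (F i x) \<otimes>\<^bsub>B\<^esub> e i)"
    have z: "z \<in> carrier B"
      unfolding z_def using scalars_closed[OF c eA] by (rule B.finsum_closed)
    define v where "v k = (\<Oplus>i\<in>A. F i x \<otimes> q i k)" for k
    have vQ: "v \<in> Q"
      unfolding v_def using sum_Q[OF A c] .
    have c': "F i x \<in> carrier R" "f (e i) k \<in> carrier R" "q i k \<in> carrier R" if "i \<in> A" for i k
      using that A(2) F_dual x sub_carrier[OF P fP] sub_carrier[OF Q q] e by auto
    have fz: "f z k = (\<Oplus>i\<in>A. F i x \<otimes> f (e i) k)" for k
      using dual_lincomb[OF F_dual[of k] c eA] unfolding z_def F_def .
    \<comment> \<open>\<open>f x\<close> is the combination of the \<open>\<delta> i\<close> with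
      coefficients \<open>F i x\<close>; splitting each \<open>\<delta> i\<close> into its
      components in \<open>P\<close> and \<open>Q\<close> gives the two summands.\<close>
    have xz: "f x k = f z k \<oplus> v k" for k
    proof -
      have "f z k \<oplus> v k = (\<Oplus>i\<in>A. F i x \<otimes> f (e i) k \<oplus> F i x \<otimes> q i k)"
        unfolding fz v_def using c' by (intro R.finsum_addf[symmetric]) auto
      also have "\<dots> = (\<Oplus>i\<in>A. if k = i then F i x else \<zero>)"
      proof (rule R.finsum_cong')
        show "F i x \<otimes> f (e i) k \<oplus> F i x \<otimes> q i k = (if k = i then F i x else \<zero>)" if "i \<in> A" for i
        proof -
          have "F i x \<otimes> f (e i) k \<oplus> F i x \<otimes> q i k = F i x \<otimes> \<delta> i k"
            using c'[OF that] eq[of i k] that A(2) by (auto simp: R.r_distr)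
          then show ?thesis
            using c'[OF that] unfolding \<delta>_def by simp
        qed
      qed (use c' in auto)
      also have "\<dots> = f x k"
      proof (cases "k \<in> A")
        case True
        then show ?thesis
          using R.finsum_singleton[OF True A(1), of "\<lambda>i. F i x"] c' by (simp add: F_def Pi_iff)
      next
        case False
        then have "(\<Oplus>i\<in>A. if k = i then F i x else \<zero>) = (\<Oplus>i\<in>A. \<zero>)"
          by (intro R.finsum_cong') auto
        then show ?thesis
          using support[OF x False] by simp
      qed
      finally show ?thesis ..
    qed
    \<comment> \<open>\<open>v\<close> lies in \<open>Q\<close>, and as the difference of
      \<open>f x\<close> and \<open>f z\<close> it lies in \<open>P\<close>, so it vanishes. The
      difference is written with a scalar multiple to match the closure properties of
      submodules.\<close>
    have "v = (\<lambda>k. f x k \<oplus> \<ominus> \<one> \<otimes> f z k)"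
    proof
      fix k
      have c: "f x k \<in> carrier R" "f z k \<in> carrier R" "v k \<in> carrier R"
        using sub_carrier[OF P fP] sub_carrier[OF Q vQ] x z by auto
      have "v k = f z k \<oplus> v k \<oplus> \<ominus> \<one> \<otimes> f z k"
        using c by algebra
      then show "v k = f x k \<oplus> \<ominus> \<one> \<otimes> f z k"
        unfolding xz .
    qed
    then have "v \<in> P"
      using sub_add[OF P fP[OF x] sub_smult[OF P _ fP[OF z], of "\<ominus> \<one>"]] by simp
    then have v0: "v = (\<lambda>k. \<zero>)"
      using vQ PQ(1) by (auto simp: free_module_def)
    have "f x k = f z k" for k
      using xz[of k] v0 sub_carrier[OF P fP[OF z]] by simp
    then have "f x = f z" by blast
    then show ?thesis
      using f x z unfolding z_def[symmetric] by (auto simp: bij_betw_def inj_on_def)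
  qed
  have "projective_algebra R B \<phi> A e F"
    using alg A(1) eA F_dual expansion
    by unfold_locales (auto simp: ring_algebra_def)
  then show ?thesis by blast
qed

section \<open>Base change\<close>

lemma frag_extend_fun_diff: "frag_extend (\<lambda>p. f p - g p) u = frag_extend f u - frag_extend g u"
  using subset_UNIV by (induction u rule: frag_induction) (auto simp: frag_extend_diff)

lemma carrier_pair_ring [simp]:
    "u \<in> carrier (pair_ring B S) \<longleftrightarrow> Poly_Mapping.keys u \<subseteq> carrier B \<times> carrier S"
  and zero_pair_ring [simp]: "\<zero>\<^bsub>pair_ring B S\<^esub> = 0"
  and one_pair_ring [simp]: "\<one>\<^bsub>pair_ring B S\<^esub> = frag_of (\<one>\<^bsub>B\<^esub>, \<one>\<^bsub>S\<^esub>)"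
  and add_pair_ring [simp]: "u \<oplus>\<^bsub>pair_ring B S\<^esub> v = u + v"
  by (simp_all add: pair_ring_def)

lemma mult_pair_ring_of [simp]:
    "frag_of (b, s) \<otimes>\<^bsub>pair_ring B S\<^esub> frag_of (b', s') = frag_of (b \<otimes>\<^bsub>B\<^esub> b', s \<otimes>\<^bsub>S\<^esub> s')"
  and mult_pair_ring_zero_left [simp]: "0 \<otimes>\<^bsub>pair_ring B S\<^esub> v = 0"
  and mult_pair_ring_diff_left: "(u - u') \<otimes>\<^bsub>pair_ring B S\<^esub> v = u \<otimes>\<^bsub>pair_ring B S\<^esub> v - u' \<otimes>\<^bsub>pair_ring B S\<^esub> v"
  and mult_pair_ring_diff_right: "u \<otimes>\<^bsub>pair_ring B S\<^esub> (v - v') = u \<otimes>\<^bsub>pair_ring B S\<^esub> v - u \<otimes>\<^bsub>pair_ring B S\<^esub> v'"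
  by (simp_all add: pair_ring_def frag_extend_diff frag_extend_fun_diff[symmetric] case_prod_unfold)

lemma mult_pair_ring_zero_right [simp]: "u \<otimes>\<^bsub>pair_ring B S\<^esub> 0 = 0"
  using mult_pair_ring_diff_right[of B S u 0 0] by simp

lemma mult_pair_ring_minus_left: "(- u) \<otimes>\<^bsub>pair_ring B S\<^esub> v = - (u \<otimes>\<^bsub>pair_ring B S\<^esub> v)"
  using mult_pair_ring_diff_left[of B S 0 u v] by simp

lemma mult_pair_ring_minus_right: "u \<otimes>\<^bsub>pair_ring B S\<^esub> (- v) = - (u \<otimes>\<^bsub>pair_ring B S\<^esub> v)"
  using mult_pair_ring_diff_right[of B S u 0 v] by simp

lemma mult_pair_ring_add_left:
  "(u + u') \<otimes>\<^bsub>pair_ring B S\<^esub> v = u \<otimes>\<^bsub>pair_ring B S\<^esub> v + u' \<otimes>\<^bsub>pair_ring B S\<^esub> v"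
  using mult_pair_ring_diff_left[of B S u "- u'" v] by (simp add: mult_pair_ring_minus_left)

lemma mult_pair_ring_add_right:
  "u \<otimes>\<^bsub>pair_ring B S\<^esub> (v + v') = u \<otimes>\<^bsub>pair_ring B S\<^esub> v + u \<otimes>\<^bsub>pair_ring B S\<^esub> v'"
  using mult_pair_ring_diff_right[of B S u v "- v'"] by (simp add: mult_pair_ring_minus_right)

lemmas mult_pair_ring_distrib = mult_pair_ring_diff_left mult_pair_ring_diff_right
  mult_pair_ring_add_left mult_pair_ring_add_right mult_pair_ring_minus_left mult_pair_ring_minus_right

lemma add_monoid_pair_ring: "add_monoid (pair_ring B S) = free_Abelian_group (carrier B \<times> carrier S)"
  by (simp add: pair_ring_def free_Abelian_group_def)

text \<open>Differences cover sums and negatives at once, so an additive statement has a single step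
  beyond zero and the generators.\<close>

lemma pair_ring_induct [consumes 1, case_names zero of diff]:
  assumes "u \<in> carrier (pair_ring B S)" and "P 0"
    and "\<And>b s. \<lbrakk>b \<in> carrier B; s \<in> carrier S\<rbrakk> \<Longrightarrow> P (frag_of (b, s))"
    and "\<And>u v. \<lbrakk>u \<in> carrier (pair_ring B S); v \<in> carrier (pair_ring B S); P u; P v\<rbrakk> \<Longrightarrow> P (u - v)"
  shows "P u"
proof -
  have "Poly_Mapping.keys u \<subseteq> carrier B \<times> carrier S"
    using assms(1) by simp
  then show ?thesis
    by (rule free_Abelian_group_induct) (use assms(2-) in auto)
qed

lemma diff_pair_ring_closed:
  "\<lbrakk>u \<in> carrier (pair_ring B S); v \<in> carrier (pair_ring B S)\<rbrakk> \<Longrightarrow> u - v \<in> carrier (pair_ring B S)"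
  using keys_diff[of u v] by auto

text \<open>Before the relations are imposed, \<open>pair_ring B S\<close> is the integral monoid
  ring of the product of the two multiplicative monoids; the additions of \<open>B\<close> and
  \<open>S\<close> enter with the relations.\<close>

lemma mult_pair_ring_closed:
  assumes "Group.monoid B" "Group.monoid S"
    and u: "u \<in> carrier (pair_ring B S)" and v: "v \<in> carrier (pair_ring B S)"
  shows "u \<otimes>\<^bsub>pair_ring B S\<^esub> v \<in> carrier (pair_ring B S)"
  using u
proof (induction rule: pair_ring_induct)
  case (of b s)
  show ?case
    using v
  proof (induction rule: pair_ring_induct)
    case (of b' s')
    then show ?case
      using \<open>b \<in> carrier B\<close> \<open>s \<in> carrier S\<close> assms(1,2) by (simp add: monoid.m_closed)
  next
    case (diff u v)
    then show ?case
      unfolding mult_pair_ring_distrib by (intro diff_pair_ring_closed)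
  qed simp
next
  case (diff u v)
  then show ?case
    unfolding mult_pair_ring_distrib by (intro diff_pair_ring_closed)
qed simp

lemma mult_pair_ring_assoc:
  assumes "Group.monoid B" "Group.monoid S"
    and u: "u \<in> carrier (pair_ring B S)" and v: "v \<in> carrier (pair_ring B S)"
    and w: "w \<in> carrier (pair_ring B S)"
  shows "u \<otimes>\<^bsub>pair_ring B S\<^esub> v \<otimes>\<^bsub>pair_ring B S\<^esub> w = u \<otimes>\<^bsub>pair_ring B S\<^esub> (v \<otimes>\<^bsub>pair_ring B S\<^esub> w)"
  using u
proof (induction rule: pair_ring_induct)
  case (of b s)
  note bs = this
  show ?case
    using v
  proof (induction rule: pair_ring_induct)
    case (of b' s')
    note bs' = this
    show ?case
      using w
    proof (induction rule: pair_ring_induct)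
      case (of b'' s'')
      then show ?case
        using bs bs' assms(1,2) by (simp add: monoid.m_assoc)
    qed (simp_all add: mult_pair_ring_distrib del: mult_pair_ring_of)
  qed (simp_all add: mult_pair_ring_distrib)
qed (simp_all add: mult_pair_ring_distrib)

lemma mult_pair_ring_one:
  assumes "Group.monoid B" "Group.monoid S" and u: "u \<in> carrier (pair_ring B S)"
  shows "\<one>\<^bsub>pair_ring B S\<^esub> \<otimes>\<^bsub>pair_ring B S\<^esub> u = u" and "u \<otimes>\<^bsub>pair_ring B S\<^esub> \<one>\<^bsub>pair_ring B S\<^esub> = u"
  using u
proof (induction rule: pair_ring_induct)
  case (of b s)
  {
    case 1
    then show ?case using assms(1,2) of by (simp add: monoid.l_one)
  next
    case 2
    then show ?case using assms(1,2) of by (simp add: monoid.r_one)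
  }
qed (simp_all add: mult_pair_ring_distrib)

lemma pair_ring_ring:
  assumes "ring B" "ring S"
  shows "ring (pair_ring B S)"
proof (rule ringI)
  have BS: "Group.monoid B" "Group.monoid S"
    using assms ring.is_monoid by auto
  show "abelian_group (pair_ring B S)"
    by (rule comm_group_abelian_groupI) (simp only: add_monoid_pair_ring abelian_free_Abelian_group)
  show "Group.monoid (pair_ring B S)"
  proof (rule monoidI)
    show "\<one>\<^bsub>pair_ring B S\<^esub> \<in> carrier (pair_ring B S)"
      using BS by (simp add: monoid.one_closed)
  qed (use BS mult_pair_ring_closed mult_pair_ring_assoc mult_pair_ring_one in blast)+
qed (simp_all add: mult_pair_ring_distrib)

section \<open>The ideal of bilinearity relations\<close>

lemma tensor_relations_cases [consumes 1, case_names left right scalar]: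
  assumes "k \<in> tensor_relations R B \<phi> S h"
    and left: "\<And>b b' s. \<lbrakk>k = frag_of (b \<oplus>\<^bsub>B\<^esub> b', s) - frag_of (b, s) - frag_of (b', s);
        b \<in> carrier B; b' \<in> carrier B; s \<in> carrier S\<rbrakk> \<Longrightarrow> thesis"
    and right: "\<And>b s s'. \<lbrakk>k = frag_of (b, s \<oplus>\<^bsub>S\<^esub> s') - frag_of (b, s) - frag_of (b, s');
        b \<in> carrier B; s \<in> carrier S; s' \<in> carrier S\<rbrakk> \<Longrightarrow> thesis"
    and scalar: "\<And>r b s. \<lbrakk>k = frag_of (\<phi> r \<otimes>\<^bsub>B\<^esub> b, s) - frag_of (b, h r \<otimes>\<^bsub>S\<^esub> s);
        r \<in> carrier R; b \<in> carrier B; s \<in> carrier S\<rbrakk> \<Longrightarrow> thesis"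
  shows thesis
  using assms(1) unfolding tensor_relations_def
  by (elim UnE CollectE exE conjE) (rule left right scalar; assumption)+

locale base_change_setup = central_map R B \<phi> + S: cring S
  for R :: "('r, 'm) ring_scheme" (structure) and B :: "('b, 'n) ring_scheme" (structure)
    and \<phi> :: "'r \<Rightarrow> 'b" and S :: "('s, 'k) ring_scheme" (structure) +
  fixes h :: "'r \<Rightarrow> 's"
  assumes h_hom: "h \<in> ring_hom R S"

sublocale base_change_setup \<subseteq> h: ring_hom_ring R S h
  by (intro ring_hom_ringI2 R.ring_axioms S.ring_axioms h_hom)

sublocale base_change_setup \<subseteq> pair: ring "pair_ring B S"
  by (intro pair_ring_ring B.ring_axioms S.ring_axioms)

context base_change_setup
begin

abbreviation "PR \<equiv> pair_ring B S"
abbreviation "K \<equiv> tensor_kernel R B \<phi> S h"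
abbreviation "C \<equiv> base_change R B \<phi> S h"
abbreviation "\<psi> \<equiv> base_change_map R B \<phi> S h"

text \<open>Multiplication by a generator turns each relation into one of the same kind. For the
  scalar relations, left multiplication moves \<open>\<phi> r\<close> past \<open>c\<close> by
  centrality and \<open>h r\<close> past \<open>d\<close> by commutativity of
  \<open>S\<close>.\<close>

lemma tensor_relations_mult:
  assumes k: "k \<in> tensor_relations R B \<phi> S h" and c: "c \<in> carrier B" "d \<in> carrier S"
  shows "frag_of (c, d) \<otimes>\<^bsub>PR\<^esub> k \<in> tensor_relations R B \<phi> S h"
    and "k \<otimes>\<^bsub>PR\<^esub> frag_of (c, d) \<in> tensor_relations R B \<phi> S h"
proof -
  from k have "frag_of (c, d) \<otimes>\<^bsub>PR\<^esub> k \<in> tensor_relations R B \<phi> S h \<and>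
    k \<otimes>\<^bsub>PR\<^esub> frag_of (c, d) \<in> tensor_relations R B \<phi> S h"
  proof (cases rule: tensor_relations_cases)
    case (left b b' s)
    have "frag_of (c, d) \<otimes>\<^bsub>PR\<^esub> k = frag_of (c \<otimes>\<^bsub>B\<^esub> b \<oplus>\<^bsub>B\<^esub> c \<otimes>\<^bsub>B\<^esub> b', d \<otimes>\<^bsub>S\<^esub> s)
        - frag_of (c \<otimes>\<^bsub>B\<^esub> b, d \<otimes>\<^bsub>S\<^esub> s) - frag_of (c \<otimes>\<^bsub>B\<^esub> b', d \<otimes>\<^bsub>S\<^esub> s)"
      using left c by (simp add: mult_pair_ring_distrib B.r_distr)
    moreover have "k \<otimes>\<^bsub>PR\<^esub> frag_of (c, d) = frag_of (b \<otimes>\<^bsub>B\<^esub> c \<oplus>\<^bsub>B\<^esub> b' \<otimes>\<^bsub>B\<^esub> c, s \<otimes>\<^bsub>S\<^esub> d)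
        - frag_of (b \<otimes>\<^bsub>B\<^esub> c, s \<otimes>\<^bsub>S\<^esub> d) - frag_of (b' \<otimes>\<^bsub>B\<^esub> c, s \<otimes>\<^bsub>S\<^esub> d)"
      using left c by (simp add: mult_pair_ring_distrib B.l_distr)
    ultimately show ?thesis
      unfolding tensor_relations_def using left c by blast
  next
    case (right b s s')
    have "frag_of (c, d) \<otimes>\<^bsub>PR\<^esub> k = frag_of (c \<otimes>\<^bsub>B\<^esub> b, d \<otimes>\<^bsub>S\<^esub> s \<oplus>\<^bsub>S\<^esub> d \<otimes>\<^bsub>S\<^esub> s')
        - frag_of (c \<otimes>\<^bsub>B\<^esub> b, d \<otimes>\<^bsub>S\<^esub> s) - frag_of (c \<otimes>\<^bsub>B\<^esub> b, d \<otimes>\<^bsub>S\<^esub> s')"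
      using right c by (simp add: mult_pair_ring_distrib S.r_distr)
    moreover have "k \<otimes>\<^bsub>PR\<^esub> frag_of (c, d) = frag_of (b \<otimes>\<^bsub>B\<^esub> c, s \<otimes>\<^bsub>S\<^esub> d \<oplus>\<^bsub>S\<^esub> s' \<otimes>\<^bsub>S\<^esub> d)
        - frag_of (b \<otimes>\<^bsub>B\<^esub> c, s \<otimes>\<^bsub>S\<^esub> d) - frag_of (b \<otimes>\<^bsub>B\<^esub> c, s' \<otimes>\<^bsub>S\<^esub> d)"
      using right c by (simp add: mult_pair_ring_distrib S.l_distr)
    ultimately show ?thesis
      unfolding tensor_relations_def using right c by blast
  next
    case (scalar r b s)
    have "frag_of (c, d) \<otimes>\<^bsub>PR\<^esub> k = frag_of (\<phi> r \<otimes>\<^bsub>B\<^esub> (c \<otimes>\<^bsub>B\<^esub> b), d \<otimes>\<^bsub>S\<^esub> s)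
        - frag_of (c \<otimes>\<^bsub>B\<^esub> b, h r \<otimes>\<^bsub>S\<^esub> (d \<otimes>\<^bsub>S\<^esub> s))"
      using scalar c
      by (simp add: mult_pair_ring_distrib scalar_left_commute[of r c b] S.m_lcomm[of d "h r" s])
    moreover have "k \<otimes>\<^bsub>PR\<^esub> frag_of (c, d) = frag_of (\<phi> r \<otimes>\<^bsub>B\<^esub> (b \<otimes>\<^bsub>B\<^esub> c), s \<otimes>\<^bsub>S\<^esub> d)
        - frag_of (b \<otimes>\<^bsub>B\<^esub> c, h r \<otimes>\<^bsub>S\<^esub> (s \<otimes>\<^bsub>S\<^esub> d))"
      using scalar c by (simp add: mult_pair_ring_distrib B.m_assoc S.m_assoc)
    ultimately show ?thesis
      unfolding tensor_relations_def using scalar c by blast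
  qed
  then show "frag_of (c, d) \<otimes>\<^bsub>PR\<^esub> k \<in> tensor_relations R B \<phi> S h"
    and "k \<otimes>\<^bsub>PR\<^esub> frag_of (c, d) \<in> tensor_relations R B \<phi> S h"
    by auto
qed

lemma tensor_relations_carrier: "tensor_relations R B \<phi> S h \<subseteq> carrier PR"
proof
  fix k assume "k \<in> tensor_relations R B \<phi> S h"
  then show "k \<in> carrier PR"
    unfolding tensor_relations_def
    by (elim UnE CollectE exE conjE; hypsubst; intro diff_pair_ring_closed) auto
qed

lemma tensor_kernel_subgroup: "subgroup K (add_monoid PR)"
  unfolding tensor_kernel_def add_monoid_pair_ring
  using tensor_relations_carrier
  by (intro group.generate_is_subgroup) (auto simp: subset_iff)

lemma tensor_kernel_induct [consumes 1, case_names zero relation minus add]: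
  assumes "k \<in> K" and "P 0"
    and "\<And>k. k \<in> tensor_relations R B \<phi> S h \<Longrightarrow> P k"
    and "\<And>k. k \<in> tensor_relations R B \<phi> S h \<Longrightarrow> P (- k)"
    and "\<And>k l. \<lbrakk>k \<in> K; l \<in> K; P k; P l\<rbrakk> \<Longrightarrow> P (k + l)"
  shows "P k"
  using assms(1) unfolding tensor_kernel_def
proof (induction rule: generate.induct)
  case (inv k)
  then have "inv\<^bsub>free_Abelian_group (carrier B \<times> carrier S)\<^esub> k = - k"
    using tensor_relations_carrier carrier_pair_ring by (intro inv_free_Abelian_group) blast
  then show ?case
    using assms(4)[OF inv] by simp
qed (use assms(2-) in \<open>auto simp: tensor_kernel_def\<close>)

lemma
  shows zero_tensor_kernel: "0 \<in> K"
    and relation_tensor_kernel: "k \<in> tensor_relations R B \<phi> S h \<Longrightarrow> k \<in> K"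
    and add_tensor_kernel: "\<lbrakk>k \<in> K; l \<in> K\<rbrakk> \<Longrightarrow> k + l \<in> K"
    and minus_tensor_kernel: "k \<in> K \<Longrightarrow> - k \<in> K"
    and diff_tensor_kernel: "\<lbrakk>k \<in> K; l \<in> K\<rbrakk> \<Longrightarrow> k - l \<in> K"
proof -
  interpret K: subgroup K "add_monoid PR"
    by (rule tensor_kernel_subgroup)
  show "0 \<in> K" using K.one_closed by simp
  show "k \<in> K" if "k \<in> tensor_relations R B \<phi> S h"
    using that unfolding tensor_kernel_def by (rule generate.incl)
  show add: "k + l \<in> K" if "k \<in> K" "l \<in> K" for k l
    using K.m_closed[OF that] by simp
  show minus: "- k \<in> K" if "k \<in> K" for k
  proof -
    have "Poly_Mapping.keys k \<subseteq> carrier B \<times> carrier S"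
      using K.mem_carrier[OF that] by simp
    then show ?thesis
      using K.m_inv_closed[OF that] unfolding add_monoid_pair_ring by simp
  qed
  show "k - l \<in> K" if "k \<in> K" "l \<in> K"
    using add[OF that(1) minus[OF that(2)]] by simp
qed

lemma tensor_kernel_mult:
  assumes u: "u \<in> carrier PR" and k: "k \<in> K"
  shows "u \<otimes>\<^bsub>PR\<^esub> k \<in> K \<and> k \<otimes>\<^bsub>PR\<^esub> u \<in> K"
  using u
proof (induction rule: pair_ring_induct)
  case (of c d)
  show ?case
    using k
  proof (induction rule: tensor_kernel_induct)
    case (relation k)
    then show ?case
      using tensor_relations_mult[OF relation of] relation_tensor_kernel by auto
  next
    case (minus k)
    then show ?case
      using tensor_relations_mult[OF minus of] relation_tensor_kernel
      by (auto simp: mult_pair_ring_distrib intro: minus_tensor_kernel)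
  qed (auto simp: mult_pair_ring_distrib intro: zero_tensor_kernel add_tensor_kernel)
next
  case (diff u v)
  then show ?case
    by (auto simp: mult_pair_ring_distrib intro: diff_tensor_kernel)
qed (auto intro: zero_tensor_kernel)

lemma tensor_kernel_ideal: "ideal K PR"
  using tensor_kernel_mult by (intro idealI pair.ring_axioms tensor_kernel_subgroup) auto

definition cls :: "('b \<times> 's \<Rightarrow>\<^sub>0 int) \<Rightarrow> ('b \<times> 's \<Rightarrow>\<^sub>0 int) set" where
  "cls u = K +>\<^bsub>PR\<^esub> u"

lemma cls_hom: "cls \<in> ring_hom PR C"
  unfolding cls_def[abs_def] base_change_def by (rule ideal.rcos_ring_hom[OF tensor_kernel_ideal])

lemma minus_pair_ring: "v \<in> carrier PR \<Longrightarrow> u \<ominus>\<^bsub>PR\<^esub> v = u - v"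
  unfolding a_minus_def a_inv_def add_monoid_pair_ring by simp

lemma cls_eq_iff:
  assumes "u \<in> carrier PR" "v \<in> carrier PR"
  shows "cls u = cls v \<longleftrightarrow> u - v \<in> K"
  using pair.quotient_eq_iff_same_a_r_cos[OF tensor_kernel_ideal assms] minus_pair_ring[OF assms(2)]
  unfolding cls_def by auto

lemma carrier_base_change: "carrier C = cls ` carrier PR"
  unfolding base_change_def FactRing_def A_RCOSETS_def' cls_def by auto

end

sublocale base_change_setup \<subseteq> C: ring "base_change R B \<phi> S h"
  unfolding base_change_def by (rule ideal.quotient_is_ring[OF tensor_kernel_ideal])

sublocale base_change_setup \<subseteq> cls: ring_hom_ring "pair_ring B S" "base_change R B \<phi> S h" cls
  by (intro ring_hom_ringI2 pair.ring_axioms C.ring_axioms cls_hom)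

section \<open>Pure tensors and the structure map of the base change\<close>

context base_change_setup
begin

definition tens :: "'b \<Rightarrow> 's \<Rightarrow> ('b \<times> 's \<Rightarrow>\<^sub>0 int) set" where
  "tens b s = cls (frag_of (b, s))"

lemma tens_closed [simp, intro]: "\<lbrakk>b \<in> carrier B; s \<in> carrier S\<rbrakk> \<Longrightarrow> tens b s \<in> carrier C"
  unfolding tens_def by (intro cls.hom_closed) simp

lemma cls_relation:
  assumes "u \<in> carrier PR" "v \<in> carrier PR" "u - v \<in> tensor_relations R B \<phi> S h"
  shows "cls u = cls v"
  using relation_tensor_kernel[OF assms(3)] cls_eq_iff[OF assms(1,2)] by simp

lemma tens_add_left:
  assumes "b \<in> carrier B" "b' \<in> carrier B" "s \<in> carrier S"
  shows "tens (b \<oplus>\<^bsub>B\<^esub> b') s = tens b s \<oplus>\<^bsub>C\<^esub> tens b' s"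
proof -
  have "cls (frag_of (b \<oplus>\<^bsub>B\<^esub> b', s)) = cls (frag_of (b, s) \<oplus>\<^bsub>PR\<^esub> frag_of (b', s))"
    using assms
    by (intro cls_relation pair.a_closed)
      (auto simp: diff_diff_add[symmetric] tensor_relations_def)
  then show ?thesis
    unfolding tens_def using assms by (simp del: add_pair_ring)
qed

lemma tens_add_right:
  assumes "b \<in> carrier B" "s \<in> carrier S" "s' \<in> carrier S"
  shows "tens b (s \<oplus>\<^bsub>S\<^esub> s') = tens b s \<oplus>\<^bsub>C\<^esub> tens b s'"
proof -
  have "cls (frag_of (b, s \<oplus>\<^bsub>S\<^esub> s')) = cls (frag_of (b, s) \<oplus>\<^bsub>PR\<^esub> frag_of (b, s'))"
    using assms
    by (intro cls_relation pair.a_closed)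
      (auto simp: diff_diff_add[symmetric] tensor_relations_def)
  then show ?thesis
    unfolding tens_def using assms by (simp del: add_pair_ring)
qed

lemma tens_scalar:
  assumes "r \<in> carrier R" "b \<in> carrier B" "s \<in> carrier S"
  shows "tens (\<phi> r \<otimes>\<^bsub>B\<^esub> b) s = tens b (h r \<otimes>\<^bsub>S\<^esub> s)"
  unfolding tens_def using assms
  by (intro cls_relation) (auto simp: tensor_relations_def)

lemma tens_mult:
  assumes "b \<in> carrier B" "s \<in> carrier S" "b' \<in> carrier B" "s' \<in> carrier S"
  shows "tens b s \<otimes>\<^bsub>C\<^esub> tens b' s' = tens (b \<otimes>\<^bsub>B\<^esub> b') (s \<otimes>\<^bsub>S\<^esub> s')"
  unfolding tens_def using cls.hom_mult[of "frag_of (b, s)" "frag_of (b', s')"] assms by simp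

lemma base_change_map_eq: "\<psi> s = tens \<one>\<^bsub>B\<^esub> s"
  unfolding base_change_map_def tens_def cls_def ..

lemma base_change_map_mult:
  assumes "s \<in> carrier S" "b \<in> carrier B" "s' \<in> carrier S"
  shows "\<psi> s \<otimes>\<^bsub>C\<^esub> tens b s' = tens b (s \<otimes>\<^bsub>S\<^esub> s')"
  unfolding base_change_map_eq using assms by (simp add: tens_mult)

lemma cls_diff:
  assumes "u \<in> carrier PR" "v \<in> carrier PR"
  shows "cls (u - v) = cls u \<ominus>\<^bsub>C\<^esub> cls v"
  unfolding minus_pair_ring[OF assms(2), symmetric] a_minus_def
  using assms by (simp del: add_pair_ring carrier_pair_ring)

lemma cls_zero: "cls 0 = \<zero>\<^bsub>C\<^esub>"
  using cls.hom_zero by simp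

text \<open>This makes the degree criteria available over \<open>S\<close>. Centrality is checked on
  pure tensors, where it is commutativity of \<open>S\<close>.\<close>

lemma base_change_central: "central_map S C \<psi>"
proof (intro central_map.intro central_map_axioms.intro S.is_cring C.ring_axioms)
  show "\<psi> \<in> ring_hom S C"
  proof (rule ring_hom_memI)
    show "\<psi> \<one>\<^bsub>S\<^esub> = \<one>\<^bsub>C\<^esub>"
      using cls.hom_one unfolding base_change_map_eq tens_def by simp
  qed (auto simp: base_change_map_eq tens_mult tens_add_right)
  fix s X assume s: "s \<in> carrier S" and X: "X \<in> carrier C"
  from X obtain u where u: "u \<in> carrier PR" "X = cls u"
    unfolding carrier_base_change by auto
  have "\<psi> s \<otimes>\<^bsub>C\<^esub> cls u = cls u \<otimes>\<^bsub>C\<^esub> \<psi> s"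
    using u(1)
  proof (induction rule: pair_ring_induct)
    case zero
    then show ?case
      using s unfolding cls_zero base_change_map_eq by simp
  next
    case (of b s')
    then show ?case
      using s unfolding base_change_map_eq tens_def[symmetric] by (simp add: tens_mult S.m_comm)
  next
    case (diff u v)
    have c: "\<psi> s \<in> carrier C" "cls u \<in> carrier C" "cls v \<in> carrier C"
      using s diff cls.hom_closed unfolding base_change_map_eq by auto
    then show ?case
      using diff.IH unfolding cls_diff[OF diff.hyps] by (simp add: a_minus_def C.r_distr C.l_distr C.r_minus C.l_minus)
  qed
  then show "\<psi> s \<otimes>\<^bsub>C\<^esub> X = X \<otimes>\<^bsub>C\<^esub> \<psi> s"
    unfolding u(2) .
qed

end

text \<open>\<open>p\<close>, \<open>q\<close>, \<open>r\<close> stand for traces of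
  \<open>x\<close>, \<open>y\<close>, \<open>z\<close>. This and the next lemma give the additivity,
  in both arguments, of the defect of the polarized trace identity; the third expresses the square
  defect of a difference through it. They are proved for variables first and applied to classes of
  tensors later.\<close>

lemma (in ring) polar_defect_diff_left:
  assumes "x \<in> carrier R" "y \<in> carrier R" "z \<in> carrier R" "p \<in> carrier R" "q \<in> carrier R" "r \<in> carrier R"
  shows "(x \<ominus> y) \<otimes> z \<oplus> z \<otimes> (x \<ominus> y) \<ominus> ((p \<ominus> q) \<otimes> z \<oplus> r \<otimes> (x \<ominus> y)) =
    x \<otimes> z \<oplus> z \<otimes> x \<ominus> (p \<otimes> z \<oplus> r \<otimes> x) \<ominus> (y \<otimes> z \<oplus> z \<otimes> y \<ominus> (q \<otimes> z \<oplus> r \<otimes> y))"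
  using assms by algebra

lemma (in ring) polar_defect_diff_right:
  assumes "x \<in> carrier R" "y \<in> carrier R" "z \<in> carrier R" "p \<in> carrier R" "q \<in> carrier R" "r \<in> carrier R"
  shows "z \<otimes> (x \<ominus> y) \<oplus> (x \<ominus> y) \<otimes> z \<ominus> (r \<otimes> (x \<ominus> y) \<oplus> (p \<ominus> q) \<otimes> z) =
    z \<otimes> x \<oplus> x \<otimes> z \<ominus> (r \<otimes> x \<oplus> p \<otimes> z) \<ominus> (z \<otimes> y \<oplus> y \<otimes> z \<ominus> (r \<otimes> y \<oplus> q \<otimes> z))"
  using assms by algebra

lemma (in ring) square_defect_diff:
  assumes "x \<in> carrier R" "y \<in> carrier R" "p \<in> carrier R" "q \<in> carrier R"
  shows "(x \<ominus> y) \<otimes> (x \<ominus> y) \<ominus> (p \<ominus> q) \<otimes> (x \<ominus> y) =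
    x \<otimes> x \<ominus> p \<otimes> x \<ominus> (x \<otimes> y \<oplus> y \<otimes> x \<ominus> (p \<otimes> y \<oplus> q \<otimes> x)) \<oplus> (y \<otimes> y \<ominus> q \<otimes> y)"
  using assms by algebra

context base_change_setup
begin

interpretation psi: central_map S C \<psi>
  by (rule base_change_central)

text \<open>If b is the scalar \<open>\<phi> r\<close>, then the pure tensor of b and s equals that
  of 1 and h(r) s.\<close>

lemma base_change_scalars:
  assumes "\<phi> ` carrier R = carrier B"
  shows "\<psi> ` carrier S = carrier C"
proof
  show "\<psi> ` carrier S \<subseteq> carrier C" by auto
  show "carrier C \<subseteq> \<psi> ` carrier S"
  proof
    fix X assume "X \<in> carrier C"
    then obtain u where u: "u \<in> carrier PR" "X = cls u"
      unfolding carrier_base_change by auto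
    have "cls u \<in> \<psi> ` carrier S"
      using u(1)
    proof (induction rule: pair_ring_induct)
      case zero
      have "cls 0 = \<psi> \<zero>\<^bsub>S\<^esub>"
        unfolding cls_zero by simp
      then show ?case by blast
    next
      case (of b s)
      then obtain r where r: "r \<in> carrier R" "b = \<phi> r"
        using assms by auto
      then have "cls (frag_of (b, s)) = \<psi> (h r \<otimes>\<^bsub>S\<^esub> s)"
        using tens_scalar[of r "\<one>\<^bsub>B\<^esub>" s] of by (simp add: tens_def[symmetric] base_change_map_eq)
      then show ?case
        by (rule image_eqI) (use r of in auto)
    next
      case (diff u v)
      then obtain s s' where "s \<in> carrier S" "s' \<in> carrier S" "cls u = \<psi> s" "cls v = \<psi> s'" by auto
      then have "cls (u - v) = \<psi> (s \<ominus>\<^bsub>S\<^esub> s')"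
        unfolding cls_diff[OF diff.hyps] by (simp add: a_minus_def)
      then show ?case
        using \<open>s \<in> carrier S\<close> \<open>s' \<in> carrier S\<close> by blast
    qed
    then show "X \<in> \<psi> ` carrier S"
      unfolding u(2) .
  qed
qed

lemma scalars_add_closed: "\<lbrakk>X \<in> \<psi> ` carrier S; Y \<in> \<psi> ` carrier S\<rbrakk> \<Longrightarrow> X \<oplus>\<^bsub>C\<^esub> Y \<in> \<psi> ` carrier S"
  by (auto simp: psi.phi.hom_add[symmetric] simp del: psi.phi.hom_add)

lemma scalars_diff_closed:
  assumes "X \<in> \<psi> ` carrier S" "Y \<in> \<psi> ` carrier S"
  shows "X \<ominus>\<^bsub>C\<^esub> Y \<in> \<psi> ` carrier S"
proof -
  from assms obtain s s' where s: "s \<in> carrier S" "s' \<in> carrier S" "X = \<psi> s" "Y = \<psi> s'" by auto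
  then have "X \<ominus>\<^bsub>C\<^esub> Y = \<psi> (s \<ominus>\<^bsub>S\<^esub> s')"
    by (simp add: a_minus_def)
  then show ?thesis
    using s by blast
qed

lemma cls_closed [intro]: "u \<in> carrier PR \<Longrightarrow> cls u \<in> carrier C"
  unfolding carrier_base_change by blast

text \<open>
  The functional \<open>tr\<close> is only defined on the free abelian group: only the existence of some
  trace for every element of the base change is needed, so it need not descend to the quotient.
\<close>

lemma base_change_quadratic:
  assumes t: "\<And>b. b \<in> carrier B \<Longrightarrow> t b \<in> carrier R"
    and sq: "\<And>b. b \<in> carrier B \<Longrightarrow> b \<otimes>\<^bsub>B\<^esub> b \<ominus>\<^bsub>B\<^esub> \<phi> (t b) \<otimes>\<^bsub>B\<^esub> b \<in> \<phi> ` carrier R"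
    and polar: "\<And>b c. \<lbrakk>b \<in> carrier B; c \<in> carrier B\<rbrakk> \<Longrightarrow>
      b \<otimes>\<^bsub>B\<^esub> c \<oplus>\<^bsub>B\<^esub> c \<otimes>\<^bsub>B\<^esub> b \<ominus>\<^bsub>B\<^esub> (\<phi> (t b) \<otimes>\<^bsub>B\<^esub> c \<oplus>\<^bsub>B\<^esub> \<phi> (t c) \<otimes>\<^bsub>B\<^esub> b) \<in> \<phi> ` carrier R"
  shows "alg_degree S C \<psi> \<le> 2"
proof -
  obtain tr where tr_hom: "tr \<in> hom (free_Abelian_group (carrier B \<times> carrier S)) (add_monoid S)"
    and tr_of': "\<And>p. p \<in> carrier B \<times> carrier S \<Longrightarrow> tr (frag_of p) = (\<lambda>(b, s). h (t b) \<otimes>\<^bsub>S\<^esub> s) p"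
  proof (rule comm_group.free_Abelian_group_universal[OF S.a_comm_group, of "\<lambda>(b, s). h (t b) \<otimes>\<^bsub>S\<^esub> s"])
    show "(\<lambda>(b, s). h (t b) \<otimes>\<^bsub>S\<^esub> s) ` (carrier B \<times> carrier S) \<subseteq> carrier (add_monoid S)"
      using t by auto
  qed (rule that)
  interpret tr: group_hom "add_monoid PR" "add_monoid S" tr
    using tr_hom unfolding add_monoid_pair_ring[symmetric]
    by (intro group_hom.intro group_hom_axioms.intro pair.a_group S.a_group)
  have tr_of: "tr (frag_of (b, s)) = h (t b) \<otimes>\<^bsub>S\<^esub> s" if "b \<in> carrier B" "s \<in> carrier S" for b s
    using tr_of'[of "(b, s)"] that by simp
  have tr_closed [simp]: "tr u \<in> carrier S" if "u \<in> carrier PR" for u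
    using tr.hom_closed that by simp
  have tr_zero: "tr 0 = \<zero>\<^bsub>S\<^esub>"
    using tr.hom_one by simp
  have tr_diff: "tr (u - v) = tr u \<ominus>\<^bsub>S\<^esub> tr v" if uv: "u \<in> carrier PR" "v \<in> carrier PR" for u v
  proof -
    have "tr (u \<oplus>\<^bsub>PR\<^esub> \<ominus>\<^bsub>PR\<^esub> v) = tr u \<oplus>\<^bsub>S\<^esub> \<ominus>\<^bsub>S\<^esub> tr v"
      using tr.hom_mult[of u "\<ominus>\<^bsub>PR\<^esub> v"] tr.hom_inv[of v] uv pair.a_inv_closed[of v]
      unfolding a_inv_def[symmetric] by (simp del: add_pair_ring carrier_pair_ring)
    then show ?thesis
      using minus_pair_ring[OF uv(2), of u] unfolding a_minus_def by simp
  qed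
  define \<Psi> where "\<Psi> u = \<psi> (tr u)" for u
  have \<Psi>_closed: "\<Psi> u \<in> carrier C" if "u \<in> carrier PR" for u
    unfolding \<Psi>_def using that tr_closed psi.phi.hom_closed by blast
  have \<Psi>_diff: "\<Psi> (u - v) = \<Psi> u \<ominus>\<^bsub>C\<^esub> \<Psi> v" if "u \<in> carrier PR" "v \<in> carrier PR" for u v
    unfolding \<Psi>_def tr_diff[OF that] using that tr_closed by (simp add: a_minus_def del: carrier_pair_ring)
  have \<Psi>_zero: "\<Psi> 0 = \<zero>\<^bsub>C\<^esub>"
    unfolding \<Psi>_def tr_zero by simp
  have \<Psi>_of: "\<Psi> (frag_of (b, s)) \<otimes>\<^bsub>C\<^esub> tens c s' = tens (\<phi> (t b) \<otimes>\<^bsub>B\<^esub> c) (s \<otimes>\<^bsub>S\<^esub> s')"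
    if "b \<in> carrier B" "s \<in> carrier S" "c \<in> carrier B" "s' \<in> carrier S" for b s c s'
    unfolding \<Psi>_def tr_of[OF that(1,2)] using that t
    by (simp add: base_change_map_mult tens_scalar S.m_assoc del: psi.phi.hom_mult)
  have tens_scalars: "tens (\<phi> r) s \<in> \<psi> ` carrier S" if "r \<in> carrier R" "s \<in> carrier S" for r s
    using tens_scalar[of r "\<one>\<^bsub>B\<^esub>" s] that by (auto simp: base_change_map_eq)
  have tens_diff: "tens (b \<ominus>\<^bsub>B\<^esub> c) s = tens b s \<ominus>\<^bsub>C\<^esub> tens c s"
    if "b \<in> carrier B" "c \<in> carrier B" "s \<in> carrier S" for b c s
  proof -
    have "tens b s = tens (b \<ominus>\<^bsub>B\<^esub> c) s \<oplus>\<^bsub>C\<^esub> tens c s"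
    proof -
      have "b \<ominus>\<^bsub>B\<^esub> c \<oplus>\<^bsub>B\<^esub> c = b"
        using that by algebra
      then show ?thesis
        using tens_add_left[of "b \<ominus>\<^bsub>B\<^esub> c" c s] that by simp
    qed
    moreover have "tens (b \<ominus>\<^bsub>B\<^esub> c) s \<oplus>\<^bsub>C\<^esub> tens c s \<ominus>\<^bsub>C\<^esub> tens c s = tens (b \<ominus>\<^bsub>B\<^esub> c) s"
    proof -
      have "tens (b \<ominus>\<^bsub>B\<^esub> c) s \<in> carrier C" "tens c s \<in> carrier C"
        using that by auto
      then show ?thesis by algebra
    qed
    ultimately show ?thesis by simp
  qed
  \<comment> \<open>The defect of the polarized trace identity. It is additive in both arguments,
    and on pure tensors it is the defect for b and c tensored with s s', a scalar by
    \<open>polar\<close>.\<close>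
  define E where "E u v = cls u \<otimes>\<^bsub>C\<^esub> cls v \<oplus>\<^bsub>C\<^esub> cls v \<otimes>\<^bsub>C\<^esub> cls u
      \<ominus>\<^bsub>C\<^esub> (\<Psi> u \<otimes>\<^bsub>C\<^esub> cls v \<oplus>\<^bsub>C\<^esub> \<Psi> v \<otimes>\<^bsub>C\<^esub> cls u)" for u v
  have E_zero: "E 0 u = \<zero>\<^bsub>C\<^esub>" "E u 0 = \<zero>\<^bsub>C\<^esub>" if "u \<in> carrier PR" for u
    unfolding E_def cls_zero \<Psi>_zero using cls_closed[OF that] \<Psi>_closed[OF that]
    by (auto simp: a_minus_def C.r_neg)
  have E_diff: "E (u - v) w = E u w \<ominus>\<^bsub>C\<^esub> E v w" "E w (u - v) = E w u \<ominus>\<^bsub>C\<^esub> E w v"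
    if uvw: "u \<in> carrier PR" "v \<in> carrier PR" "w \<in> carrier PR" for u v w
  proof -
    note c = uvw[THEN cls_closed] uvw[THEN \<Psi>_closed]
    show "E (u - v) w = E u w \<ominus>\<^bsub>C\<^esub> E v w" "E w (u - v) = E w u \<ominus>\<^bsub>C\<^esub> E w v"
      unfolding E_def cls_diff[OF uvw(1,2)] \<Psi>_diff[OF uvw(1,2)]
      using C.polar_defect_diff_left[OF c] C.polar_defect_diff_right[OF c] .
  qed
  have zero_scalar: "\<zero>\<^bsub>C\<^esub> \<in> \<psi> ` carrier S"
    using psi.phi.hom_zero by (metis S.zero_closed image_eqI)
  have E_scalar: "E u v \<in> \<psi> ` carrier S" if u: "u \<in> carrier PR" and v: "v \<in> carrier PR" for u v
    using u
  proof (induction rule: pair_ring_induct)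
    case zero
    then show ?case using E_zero[OF v] zero_scalar by simp
  next
    case (diff u u')
    then show ?case using E_diff(1)[OF diff.hyps v] scalars_diff_closed by simp
  next
    case (of b s)
    note bs = this
    then have bsP: "frag_of (b, s) \<in> carrier PR" by simp
    show ?case
      using v
    proof (induction rule: pair_ring_induct)
      case zero
      then show ?case using E_zero[OF bsP] zero_scalar by simp
    next
      case (diff u u')
      then show ?case using E_diff(2)[OF diff.hyps bsP] scalars_diff_closed by simp
    next
      case (of c s')
      have cl: "b \<otimes>\<^bsub>B\<^esub> c \<in> carrier B" "c \<otimes>\<^bsub>B\<^esub> b \<in> carrier B" "\<phi> (t b) \<otimes>\<^bsub>B\<^esub> c \<in> carrier B"
        "\<phi> (t c) \<otimes>\<^bsub>B\<^esub> b \<in> carrier B" "s \<otimes>\<^bsub>S\<^esub> s' \<in> carrier S"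
        using bs of t by auto
      have "E (frag_of (b, s)) (frag_of (c, s')) =
          tens (b \<otimes>\<^bsub>B\<^esub> c \<oplus>\<^bsub>B\<^esub> c \<otimes>\<^bsub>B\<^esub> b \<ominus>\<^bsub>B\<^esub> (\<phi> (t b) \<otimes>\<^bsub>B\<^esub> c \<oplus>\<^bsub>B\<^esub> \<phi> (t c) \<otimes>\<^bsub>B\<^esub> b)) (s \<otimes>\<^bsub>S\<^esub> s')"
        unfolding E_def tens_def[symmetric] using bs of cl
        by (simp add: \<Psi>_of tens_mult tens_add_left tens_diff S.m_comm[of s' s])
      then show ?case
        using polar[OF bs(1) of(1)] tens_scalars cl(5) by auto
    qed
  qed
  have square: "cls u \<otimes>\<^bsub>C\<^esub> cls u \<ominus>\<^bsub>C\<^esub> \<Psi> u \<otimes>\<^bsub>C\<^esub> cls u \<in> \<psi> ` carrier S" if u: "u \<in> carrier PR" for u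
    using u
  proof (induction rule: pair_ring_induct)
    case zero
    then show ?case
      unfolding cls_zero \<Psi>_zero using zero_scalar by (simp add: a_minus_def)
  next
    case (of b s)
    have "cls (frag_of (b, s)) \<otimes>\<^bsub>C\<^esub> cls (frag_of (b, s)) \<ominus>\<^bsub>C\<^esub> \<Psi> (frag_of (b, s)) \<otimes>\<^bsub>C\<^esub> cls (frag_of (b, s)) =
        tens (b \<otimes>\<^bsub>B\<^esub> b \<ominus>\<^bsub>B\<^esub> \<phi> (t b) \<otimes>\<^bsub>B\<^esub> b) (s \<otimes>\<^bsub>S\<^esub> s)"
      unfolding tens_def[symmetric] using of t by (simp add: \<Psi>_of tens_mult tens_diff)
    then show ?case
      using sq[OF of(1)] tens_scalars of by auto
  next
    \<comment> \<open>The square defect is not additive; its deviation at a difference is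
      \<open>E u v\<close>, already known to be a scalar.\<close>
    case (diff u v)
    note c = cls_closed[OF diff.hyps(1)] cls_closed[OF diff.hyps(2)] \<Psi>_closed[OF diff.hyps(1)] \<Psi>_closed[OF diff.hyps(2)]
    have "cls (u - v) \<otimes>\<^bsub>C\<^esub> cls (u - v) \<ominus>\<^bsub>C\<^esub> \<Psi> (u - v) \<otimes>\<^bsub>C\<^esub> cls (u - v) =
        (cls u \<otimes>\<^bsub>C\<^esub> cls u \<ominus>\<^bsub>C\<^esub> \<Psi> u \<otimes>\<^bsub>C\<^esub> cls u) \<ominus>\<^bsub>C\<^esub> E u v
        \<oplus>\<^bsub>C\<^esub> (cls v \<otimes>\<^bsub>C\<^esub> cls v \<ominus>\<^bsub>C\<^esub> \<Psi> v \<otimes>\<^bsub>C\<^esub> cls v)"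
      unfolding E_def cls_diff[OF diff.hyps] \<Psi>_diff[OF diff.hyps] using C.square_defect_diff[OF c] .
    moreover have "\<dots> \<in> \<psi> ` carrier S"
      by (intro scalars_add_closed scalars_diff_closed diff.IH E_scalar diff.hyps)
    ultimately show ?case
      by (simp only:)
  qed
  show ?thesis
    unfolding psi.alg_degree_le_2
  proof
    fix X assume "X \<in> carrier C"
    then obtain u where u: "u \<in> carrier PR" "X = cls u"
      unfolding carrier_base_change by auto
    from square[OF u(1)] obtain n where n: "n \<in> carrier S"
      "cls u \<otimes>\<^bsub>C\<^esub> cls u \<ominus>\<^bsub>C\<^esub> \<Psi> u \<otimes>\<^bsub>C\<^esub> cls u = \<psi> n" by auto
    have "X \<otimes>\<^bsub>C\<^esub> X = \<Psi> u \<otimes>\<^bsub>C\<^esub> X \<oplus>\<^bsub>C\<^esub> (X \<otimes>\<^bsub>C\<^esub> X \<ominus>\<^bsub>C\<^esub> \<Psi> u \<otimes>\<^bsub>C\<^esub> X)"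
      unfolding u(2) using cls_closed[OF u(1)] \<Psi>_closed[OF u(1)] by algebra
    then have "X \<otimes>\<^bsub>C\<^esub> X = \<psi> (tr u) \<otimes>\<^bsub>C\<^esub> X \<oplus>\<^bsub>C\<^esub> \<psi> n"
      using n(2) unfolding u(2) \<Psi>_def by simp
    then show "\<exists>t\<in>carrier S. \<exists>n\<in>carrier S. X \<otimes>\<^bsub>C\<^esub> X = \<psi> t \<otimes>\<^bsub>C\<^esub> X \<oplus>\<^bsub>C\<^esub> \<psi> n"
      using tr_closed[OF u(1)] n(1) by blast
  qed
qed

text \<open>Polarizing the norm x \<sigma>(x) and putting y = 1 shows that x + \<sigma>(x) is a
  scalar. With it as trace, the trace identity and its polarization are, up to sign, the statements
  that the norm and its polarization are scalars.\<close>

lemma base_change_standard_involution: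
  assumes "standard_involution R B \<phi> \<sigma>"
  shows "alg_degree S C \<psi> \<le> 2"
proof -
  have \<sigma>: "\<And>x. x \<in> carrier B \<Longrightarrow> \<sigma> x \<in> carrier B"
    "\<And>x y. \<lbrakk>x \<in> carrier B; y \<in> carrier B\<rbrakk> \<Longrightarrow> \<sigma> (x \<oplus>\<^bsub>B\<^esub> y) = \<sigma> x \<oplus>\<^bsub>B\<^esub> \<sigma> y"
    "\<sigma> \<one>\<^bsub>B\<^esub> = \<one>\<^bsub>B\<^esub>"
    "\<And>x. x \<in> carrier B \<Longrightarrow> x \<otimes>\<^bsub>B\<^esub> \<sigma> x \<in> \<phi> ` carrier R"
    using assms unfolding standard_involution_def by auto
  have diff_scalar: "x \<ominus>\<^bsub>B\<^esub> y \<in> \<phi> ` carrier R" if "x \<in> \<phi> ` carrier R" "y \<in> \<phi> ` carrier R" for x y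
  proof -
    from that obtain r s where rs: "r \<in> carrier R" "s \<in> carrier R" "x = \<phi> r" "y = \<phi> s" by auto
    then have "x \<ominus>\<^bsub>B\<^esub> y = \<phi> (r \<ominus> s)"
      by (simp add: a_minus_def)
    then show ?thesis
      using rs by blast
  qed
  have polar: "x \<otimes>\<^bsub>B\<^esub> \<sigma> y \<oplus>\<^bsub>B\<^esub> y \<otimes>\<^bsub>B\<^esub> \<sigma> x \<in> \<phi> ` carrier R"
    if xy: "x \<in> carrier B" "y \<in> carrier B" for x y
  proof -
    have "x \<otimes>\<^bsub>B\<^esub> \<sigma> y \<oplus>\<^bsub>B\<^esub> y \<otimes>\<^bsub>B\<^esub> \<sigma> x =
        (x \<oplus>\<^bsub>B\<^esub> y) \<otimes>\<^bsub>B\<^esub> \<sigma> (x \<oplus>\<^bsub>B\<^esub> y) \<ominus>\<^bsub>B\<^esub> x \<otimes>\<^bsub>B\<^esub> \<sigma> x \<ominus>\<^bsub>B\<^esub> y \<otimes>\<^bsub>B\<^esub> \<sigma> y"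
      unfolding \<sigma>(2)[OF xy] using xy \<sigma>(1)[OF xy(1)] \<sigma>(1)[OF xy(2)] by algebra
    then show ?thesis
      using diff_scalar[OF diff_scalar[OF \<sigma>(4) \<sigma>(4)] \<sigma>(4)] xy by simp
  qed
  have "\<exists>r\<in>carrier R. \<phi> r = x \<oplus>\<^bsub>B\<^esub> \<sigma> x" if x: "x \<in> carrier B" for x
    using polar[OF x B.one_closed] x \<sigma>(1)[OF x] by (auto simp: \<sigma>(3))
  then obtain t where t: "\<And>x. x \<in> carrier B \<Longrightarrow> t x \<in> carrier R"
    "\<And>x. x \<in> carrier B \<Longrightarrow> \<phi> (t x) = x \<oplus>\<^bsub>B\<^esub> \<sigma> x"
    by metis
  have comm: "\<phi> (t x) \<otimes>\<^bsub>B\<^esub> y = y \<otimes>\<^bsub>B\<^esub> \<phi> (t x)" if "x \<in> carrier B" "y \<in> carrier B" for x y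
    using central t(1) that by blast
  have uminus_scalar: "\<ominus>\<^bsub>B\<^esub> x \<in> \<phi> ` carrier R" if "x \<in> \<phi> ` carrier R" for x
  proof -
    from that obtain r where r: "r \<in> carrier R" "x = \<phi> r" by auto
    then have "\<ominus>\<^bsub>B\<^esub> x = \<phi> (\<ominus> r)" by simp
    then show ?thesis
      using r(1) by blast
  qed
  show ?thesis
  proof (rule base_change_quadratic[of t])
    fix b assume b: "b \<in> carrier B"
    \<comment> \<open>The scalar \<open>\<phi> (t b)\<close> is moved to the right of
      \<open>b\<close>, so that the product of \<open>b\<close> with \<open>\<sigma> b\<close>
      appears in the order in which it is known to be a scalar.\<close>
    have "b \<otimes>\<^bsub>B\<^esub> b \<ominus>\<^bsub>B\<^esub> \<phi> (t b) \<otimes>\<^bsub>B\<^esub> b = \<ominus>\<^bsub>B\<^esub> (b \<otimes>\<^bsub>B\<^esub> \<sigma> b)"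
      unfolding comm[OF b b] unfolding t(2)[OF b] using b \<sigma>(1)[OF b] by algebra
    then show "b \<otimes>\<^bsub>B\<^esub> b \<ominus>\<^bsub>B\<^esub> \<phi> (t b) \<otimes>\<^bsub>B\<^esub> b \<in> \<phi> ` carrier R"
      using uminus_scalar[OF \<sigma>(4)[OF b]] by simp
    fix c assume c: "c \<in> carrier B"
    have "b \<otimes>\<^bsub>B\<^esub> c \<oplus>\<^bsub>B\<^esub> c \<otimes>\<^bsub>B\<^esub> b \<ominus>\<^bsub>B\<^esub> (\<phi> (t b) \<otimes>\<^bsub>B\<^esub> c \<oplus>\<^bsub>B\<^esub> \<phi> (t c) \<otimes>\<^bsub>B\<^esub> b) =
        \<ominus>\<^bsub>B\<^esub> (b \<otimes>\<^bsub>B\<^esub> \<sigma> c \<oplus>\<^bsub>B\<^esub> c \<otimes>\<^bsub>B\<^esub> \<sigma> b)"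
      unfolding comm[OF b c] comm[OF c b] unfolding t(2)[OF b] t(2)[OF c]
      using b c \<sigma>(1)[OF b] \<sigma>(1)[OF c] by algebra
    then show "b \<otimes>\<^bsub>B\<^esub> c \<oplus>\<^bsub>B\<^esub> c \<otimes>\<^bsub>B\<^esub> b \<ominus>\<^bsub>B\<^esub> (\<phi> (t b) \<otimes>\<^bsub>B\<^esub> c \<oplus>\<^bsub>B\<^esub> \<phi> (t c) \<otimes>\<^bsub>B\<^esub> b) \<in> \<phi> ` carrier R"
      using uminus_scalar[OF polar[OF b c]] by simp
  qed (rule t(1))
qed

text \<open>When \<open>h\<close> has a retraction \<open>g\<close>, the algebra is recovered from its base change via \<open>b \<otimes> s \<mapsto> b g(s)\<close>.\<close>

lemma base_change_retract:
  assumes g: "g \<in> ring_hom S R" "\<And>r. r \<in> carrier R \<Longrightarrow> g (h r) = r"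
  obtains \<Phi> where "\<And>b s. \<lbrakk>b \<in> carrier B; s \<in> carrier S\<rbrakk> \<Longrightarrow> \<Phi> (tens b s) = \<phi> (g s) \<otimes>\<^bsub>B\<^esub> b"
    and "\<And>X Y. \<lbrakk>X \<in> carrier C; Y \<in> carrier C\<rbrakk> \<Longrightarrow> \<Phi> (X \<oplus>\<^bsub>C\<^esub> Y) = \<Phi> X \<oplus>\<^bsub>B\<^esub> \<Phi> Y"
proof -
  interpret g: ring_hom_ring S R g
    by (intro ring_hom_ringI2 R.ring_axioms S.ring_axioms g(1))
  obtain G where G_hom: "G \<in> hom (free_Abelian_group (carrier B \<times> carrier S)) (add_monoid B)"
    and G_of': "\<And>p. p \<in> carrier B \<times> carrier S \<Longrightarrow> G (frag_of p) = (\<lambda>(b, s). \<phi> (g s) \<otimes>\<^bsub>B\<^esub> b) p"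
  proof (rule comm_group.free_Abelian_group_universal[OF B.a_comm_group, of "\<lambda>(b, s). \<phi> (g s) \<otimes>\<^bsub>B\<^esub> b"])
    show "(\<lambda>(b, s). \<phi> (g s) \<otimes>\<^bsub>B\<^esub> b) ` (carrier B \<times> carrier S) \<subseteq> carrier (add_monoid B)"
      by auto
  qed (rule that)
  interpret G: group_hom "add_monoid PR" "add_monoid B" G
    using G_hom unfolding add_monoid_pair_ring[symmetric]
    by (intro group_hom.intro group_hom_axioms.intro pair.a_group B.a_group)
  have G_of: "G (frag_of (b, s)) = \<phi> (g s) \<otimes>\<^bsub>B\<^esub> b" if "b \<in> carrier B" "s \<in> carrier S" for b s
    using G_of'[of "(b, s)"] that by simp
  have G_closed: "G u \<in> carrier B" if "u \<in> carrier PR" for u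
    using G.hom_closed that by simp
  have G_add: "G (u + v) = G u \<oplus>\<^bsub>B\<^esub> G v" if "u \<in> carrier PR" "v \<in> carrier PR" for u v
    using G.hom_mult[of u v] that by simp
  have G_zero: "G 0 = \<zero>\<^bsub>B\<^esub>"
    using G.hom_one by simp
  have G_minus: "G (- v) = \<ominus>\<^bsub>B\<^esub> G v" if v: "v \<in> carrier PR" for v
  proof -
    have "inv\<^bsub>add_monoid PR\<^esub> v = - v"
      using v unfolding add_monoid_pair_ring by simp
    then show ?thesis
      using G.hom_inv[of v] v by (simp add: a_inv_def)
  qed
  have minus_closed: "- v \<in> carrier PR" if "v \<in> carrier PR" for v
    using that by simp
  have G_diff: "G (u - v) = G u \<ominus>\<^bsub>B\<^esub> G v" if "u \<in> carrier PR" "v \<in> carrier PR" for u v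
    using G_add[OF that(1) minus_closed[OF that(2)]] G_minus[OF that(2)] by (simp add: a_minus_def)
  have of_closed: "frag_of (b, s) \<in> carrier PR" if "b \<in> carrier B" "s \<in> carrier S" for b s
    using that by simp
  have G_relation: "G k = \<zero>\<^bsub>B\<^esub>" if "k \<in> tensor_relations R B \<phi> S h" for k
  proof -
    from that show ?thesis
    proof (cases rule: tensor_relations_cases)
      case (left b b' s)
      then have c: "\<phi> (g s) \<in> carrier B" by auto
      have "G k = \<phi> (g s) \<otimes>\<^bsub>B\<^esub> (b \<oplus>\<^bsub>B\<^esub> b') \<ominus>\<^bsub>B\<^esub> \<phi> (g s) \<otimes>\<^bsub>B\<^esub> b \<ominus>\<^bsub>B\<^esub> \<phi> (g s) \<otimes>\<^bsub>B\<^esub> b'"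
        unfolding left(1) using left(2-) by (simp add: G_diff diff_pair_ring_closed of_closed G_of del: carrier_pair_ring)
      then show ?thesis
        using c left(2,3) by algebra
    next
      case (right b s s')
      then have c: "\<phi> (g s) \<in> carrier B" "\<phi> (g s') \<in> carrier B" by auto
      have "G k = (\<phi> (g s) \<oplus>\<^bsub>B\<^esub> \<phi> (g s')) \<otimes>\<^bsub>B\<^esub> b \<ominus>\<^bsub>B\<^esub> \<phi> (g s) \<otimes>\<^bsub>B\<^esub> b \<ominus>\<^bsub>B\<^esub> \<phi> (g s') \<otimes>\<^bsub>B\<^esub> b"
        unfolding right(1) using right(2-) by (simp add: G_diff diff_pair_ring_closed of_closed G_of del: carrier_pair_ring)
      then show ?thesis
        using c right(2) by algebra
    next
      \<comment> \<open>This relation is respected because \<open>g (h r) = r\<close>.\<close>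
      case (scalar r b s)
      have "G k = \<phi> (g s) \<otimes>\<^bsub>B\<^esub> (\<phi> r \<otimes>\<^bsub>B\<^esub> b) \<ominus>\<^bsub>B\<^esub> \<phi> (r \<otimes> g s) \<otimes>\<^bsub>B\<^esub> b"
        unfolding scalar(1) using scalar(2-) by (simp add: G_diff of_closed G_of g(2) del: carrier_pair_ring)
      moreover have "\<phi> (r \<otimes> g s) = \<phi> (g s) \<otimes>\<^bsub>B\<^esub> \<phi> r"
        using scalar central[of r "\<phi> (g s)"] by simp
      ultimately show ?thesis
        using scalar by (simp add: B.m_assoc a_minus_def B.r_neg)
    qed
  qed
  have K_carrier: "k \<in> carrier PR" if "k \<in> K" for k
    using subgroup.mem_carrier[OF tensor_kernel_subgroup that] by simp
  have G_kernel: "G k = \<zero>\<^bsub>B\<^esub>" if "k \<in> K" for k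
    using that
  proof (induction rule: tensor_kernel_induct)
    case (minus k)
    then show ?case
      using G_minus[of k] G_relation[OF minus] tensor_relations_carrier by auto
  next
    case (add k l)
    then show ?case
      using G_add[OF K_carrier K_carrier] by simp
  qed (use G_zero G_relation in auto)
  have G_cls: "G u = G v" if "u \<in> carrier PR" "v \<in> carrier PR" "cls u = cls v" for u v
    using G_kernel[of "u - v"] G_diff[OF that(1,2)] cls_eq_iff[OF that(1,2)] that
      G_closed[OF that(1)] G_closed[OF that(2)] by simp
  \<comment> \<open>\<open>G\<close> is constant on each class by \<open>G_cls\<close>, so the
    choice of the representative does not matter.\<close>
  define \<Phi> where "\<Phi> X = G (SOME u. u \<in> carrier PR \<and> cls u = X)" for X
  have \<Phi>_cls: "\<Phi> (cls u) = G u" if u: "u \<in> carrier PR" for u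
    unfolding \<Phi>_def using someI[of "\<lambda>v. v \<in> carrier PR \<and> cls v = cls u" u] u
    by (intro G_cls) auto
  show ?thesis
  proof (rule that[of \<Phi>])
    show "\<Phi> (tens b s) = \<phi> (g s) \<otimes>\<^bsub>B\<^esub> b" if "b \<in> carrier B" "s \<in> carrier S" for b s
      unfolding tens_def using \<Phi>_cls[of "frag_of (b, s)"] G_of[OF that] that by simp
    fix X Y assume "X \<in> carrier C" "Y \<in> carrier C"
    then obtain u v where uv: "u \<in> carrier PR" "X = cls u" "v \<in> carrier PR" "Y = cls v"
      unfolding carrier_base_change by auto
    then have "X \<oplus>\<^bsub>C\<^esub> Y = cls (u \<oplus>\<^bsub>PR\<^esub> v)"
      using cls.hom_add by simp
    then show "\<Phi> (X \<oplus>\<^bsub>C\<^esub> Y) = \<Phi> X \<oplus>\<^bsub>B\<^esub> \<Phi> Y"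
      using \<Phi>_cls[of "u \<oplus>\<^bsub>PR\<^esub> v"] pair.a_closed[OF uv(1,3)] \<Phi>_cls[OF uv(1)] \<Phi>_cls[OF uv(3)]
        G_add[OF uv(1,3)] uv by simp
  qed
qed

text \<open>\<open>\<Phi>\<close> is applied to an equation for the tensor of x with 1. Once
  products are multiplied out, all its terms are pure tensors, so additivity of
  \<open>\<Phi>\<close> and its formula on pure tensors suffice.\<close>

lemma base_change_retract_degree:
  assumes g: "g \<in> ring_hom S R" "\<And>r. r \<in> carrier R \<Longrightarrow> g (h r) = r"
  shows "alg_degree S C \<psi> \<le> 1 \<Longrightarrow> alg_degree R B \<phi> \<le> 1"
    and "alg_degree S C \<psi> \<le> 2 \<Longrightarrow> alg_degree R B \<phi> \<le> 2"
proof -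
  obtain \<Phi> where \<Phi>: "\<And>b s. \<lbrakk>b \<in> carrier B; s \<in> carrier S\<rbrakk> \<Longrightarrow> \<Phi> (tens b s) = \<phi> (g s) \<otimes>\<^bsub>B\<^esub> b"
    and \<Phi>_add: "\<And>X Y. \<lbrakk>X \<in> carrier C; Y \<in> carrier C\<rbrakk> \<Longrightarrow> \<Phi> (X \<oplus>\<^bsub>C\<^esub> Y) = \<Phi> X \<oplus>\<^bsub>B\<^esub> \<Phi> Y"
    using base_change_retract[OF g] by blast
  interpret g: ring_hom_ring S R g
    by (intro ring_hom_ringI2 R.ring_axioms S.ring_axioms g(1))
  show "alg_degree R B \<phi> \<le> 1" if "alg_degree S C \<psi> \<le> 1"
    unfolding alg_degree_le_1
  proof
    show "carrier B \<subseteq> \<phi> ` carrier R"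
    proof
      fix x assume x: "x \<in> carrier B"
      then have "tens x \<one>\<^bsub>S\<^esub> \<in> \<psi> ` carrier S"
        using that unfolding psi.alg_degree_le_1 by auto
      then obtain s where s: "s \<in> carrier S" "tens x \<one>\<^bsub>S\<^esub> = tens \<one>\<^bsub>B\<^esub> s"
        unfolding base_change_map_eq by auto
      then have "x = \<phi> (g s)"
        using \<Phi>[OF x S.one_closed] \<Phi>[OF B.one_closed s(1)] x by simp
      then show "x \<in> \<phi> ` carrier R"
        using s(1) by auto
    qed
  qed auto
  show "alg_degree R B \<phi> \<le> 2" if deg: "alg_degree S C \<psi> \<le> 2"
    unfolding alg_degree_le_2
  proof
    fix x assume x: "x \<in> carrier B"
    then obtain s n where sn: "s \<in> carrier S" "n \<in> carrier S"
      and eq: "tens x \<one>\<^bsub>S\<^esub> \<otimes>\<^bsub>C\<^esub> tens x \<one>\<^bsub>S\<^esub> = \<psi> s \<otimes>\<^bsub>C\<^esub> tens x \<one>\<^bsub>S\<^esub> \<oplus>\<^bsub>C\<^esub> \<psi> n"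
      using deg tens_closed[OF x S.one_closed] unfolding psi.alg_degree_le_2 by blast
    have "tens (x \<otimes>\<^bsub>B\<^esub> x) \<one>\<^bsub>S\<^esub> = tens x s \<oplus>\<^bsub>C\<^esub> tens \<one>\<^bsub>B\<^esub> n"
      using eq x sn by (simp add: tens_mult base_change_map_mult) (simp add: base_change_map_eq)
    from arg_cong[OF this, of \<Phi>] have "x \<otimes>\<^bsub>B\<^esub> x = \<phi> (g s) \<otimes>\<^bsub>B\<^esub> x \<oplus>\<^bsub>B\<^esub> \<phi> (g n)"
      using x sn by (simp add: \<Phi> \<Phi>_add)
    then show "\<exists>t\<in>carrier R. \<exists>n\<in>carrier R. x \<otimes>\<^bsub>B\<^esub> x = \<phi> t \<otimes>\<^bsub>B\<^esub> x \<oplus>\<^bsub>B\<^esub> \<phi> n"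
      using sn by (intro bexI[of _ "g s"] bexI[of _ "g n"]) auto
  qed
qed

end

section \<open>Comparison of the degrees\<close>

lemma (in ring) image_ring_inv_hom:
  assumes "inj_on f (carrier R)"
  shows "inv_into (carrier R) f \<in> ring_hom (image_ring f R) R"
  using ring_iso_set_sym[OF ring_axioms inj_imp_image_ring_iso[OF assms]]
  by (simp add: ring_iso_def)

text \<open>Ideals are pulled back along \<open>f\<close>, and the images of generators of the
  preimage generate the given ideal.\<close>

lemma (in ring) noetherian_image_ring:
  assumes noeth: "noetherian_ring R" and f: "inj_on f (carrier R)"
  shows "noetherian_ring (image_ring f R)"
proof -
  let ?S = "image_ring f R"
  interpret S: ring ?S
    using f by (rule inj_imp_image_ring_is_ring)
  interpret f: ring_hom_ring R ?S f
    using inj_imp_image_ring_iso[OF f] S.ring_axioms ring_axioms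
    by (intro ring_hom_ringI2) (auto simp: ring_iso_def)
  show ?thesis
  proof (rule S.noetherian_ringI)
    fix I assume I: "ideal I ?S"
    define J where "J = {r \<in> carrier R. f r \<in> I}"
    have J: "ideal J R"
      unfolding J_def by (rule f.ideal_vimage[OF I])
    then obtain A where A: "A \<subseteq> carrier R" "finite A" "J = Idl A"
      using noetherian_ring.finetely_gen[OF noeth] by blast
    have AS: "f ` A \<subseteq> carrier ?S"
      using A(1) by auto
    have "I = genideal ?S (f ` A)"
    proof
      have "A \<subseteq> J"
        using A(1,3) genideal_self by simp
      then have "f ` A \<subseteq> I"
        unfolding J_def by auto
      then show "genideal ?S (f ` A) \<subseteq> I"
        using S.genideal_minimal[OF I] by simp
      have "ideal {r \<in> carrier R. f r \<in> genideal ?S (f ` A)} R"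
        by (rule f.ideal_vimage[OF S.genideal_ideal[OF AS]])
      moreover have "A \<subseteq> {r \<in> carrier R. f r \<in> genideal ?S (f ` A)}"
        using A(1) S.genideal_self[OF AS] by auto
      ultimately have "J \<subseteq> {r \<in> carrier R. f r \<in> genideal ?S (f ` A)}"
        unfolding A(3) by (rule genideal_minimal)
      moreover have "I \<subseteq> f ` J"
      proof
        fix x assume x: "x \<in> I"
        then have "x \<in> carrier ?S"
          using ideal.Icarr[OF I] by simp
        then show "x \<in> f ` J"
          using x unfolding J_def image_ring_carrier by auto
      qed
      ultimately show "I \<subseteq> genideal ?S (f ` A)" by auto
    qed
    then show "\<exists>A\<subseteq>carrier ?S. finite A \<and> I = genideal ?S A"
      using AS A(2) by blast
  qed
qed

lemma alg_degree_le_geometric_degree: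
  fixes R :: "('r, 'm) ring_scheme" and S :: "('r + nat + 's) ring"
  assumes "cring S" "noetherian_ring S" "connected_ring S" "h \<in> ring_hom R S"
  shows "alg_degree S (base_change R B \<phi> S h) (base_change_map R B \<phi> S h) \<le>
    geometric_degree TYPE('s) R B \<phi>"
proof -
  have "(S, h) \<in> {(S, h). cring S \<and> noetherian_ring S \<and> connected_ring S \<and> h \<in> ring_hom R S}"
    using assms by simp
  from SUP_upper[OF this, of "\<lambda>(S, h). alg_degree S (base_change R B \<phi> S h) (base_change_map R B \<phi> S h)"]
  show ?thesis
    unfolding geometric_degree_def by simp
qed

lemma geometric_degree_le:
  fixes R :: "('r, 'm) ring_scheme"
  assumes "\<And>(S :: ('r + nat + 's) ring) h. \<lbrakk>cring S; h \<in> ring_hom R S\<rbrakk> \<Longrightarrow>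
      alg_degree S (base_change R B \<phi> S h) (base_change_map R B \<phi> S h) \<le> n"
  shows "geometric_degree TYPE('s) R B \<phi> \<le> n"
  unfolding geometric_degree_def using assms by (intro SUP_least) auto

theorem theoremA:
  fixes R :: "'r ring" and B :: "'b ring" and \<phi> :: "'r \<Rightarrow> 'b"
  assumes "cring R" and "connected_ring R" and "noetherian_ring R"
    and "ring_algebra R B \<phi>"
    and "finitely_generated_module R (algebra_module B \<phi>)"
    and "projective_module R (algebra_module B \<phi>)"
    and "constant_rank R (algebra_module B \<phi>)"
    and "\<exists>a\<in>carrier R. nonzerodivisor R (a \<otimes>\<^bsub>R\<^esub> (a \<ominus>\<^bsub>R\<^esub> \<one>\<^bsub>R\<^esub>))"
  shows "(alg_degree R B \<phi> = 2 \<longleftrightarrow> geometric_degree TYPE('s) R B \<phi> = 2) \<and>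
         (geometric_degree TYPE('s) R B \<phi> = 2 \<longleftrightarrow>
            \<phi> ` carrier R \<noteq> carrier B \<and> (\<exists>\<sigma>. standard_involution R B \<phi> \<sigma>))"
proof -
  interpret central_map R B \<phi>
    using assms(4) by (rule ring_algebra_imp_central_map)
  let ?g = "geometric_degree TYPE('s) R B \<phi>"
  \<comment> \<open>The supremum ranges over rings in the sum type, whose first summand holds a copy
    of \<open>R\<close>. The inverse of \<open>f\<close> on this copy is the retraction used for
    recovering \<open>B\<close>.\<close>
  define f :: "'r \<Rightarrow> 'r + nat + 's" where "f = Inl"
  have f: "inj_on f (carrier R)"
    unfolding f_def by simp
  let ?S = "image_ring f R"
  have f_iso: "f \<in> ring_iso R ?S"
    using f by (rule inj_imp_image_ring_iso)
  then have f_hom: "f \<in> ring_hom R ?S"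
    by (simp add: ring_iso_def)
  interpret S: cring ?S
    using R.ring_iso_imp_img_cring[OF f_iso] by (simp add: image_ring_def image_group_def monoid.defs)
  interpret base_change_setup R B \<phi> ?S f
    by unfold_locales (rule f_hom)
  have S_conn: "connected_ring ?S"
    unfolding connected_ring_def
  proof (intro ballI impI)
    fix x assume "x \<in> carrier ?S" and idem: "x \<otimes>\<^bsub>?S\<^esub> x = x"
    then obtain r where r: "r \<in> carrier R" "x = f r"
      unfolding image_ring_carrier by auto
    then have "f (r \<otimes>\<^bsub>R\<^esub> r) = f r"
      using idem by simp
    then have "r \<otimes>\<^bsub>R\<^esub> r = r"
      unfolding f_def by simp
    then show "x = \<zero>\<^bsub>?S\<^esub> \<or> x = \<one>\<^bsub>?S\<^esub>"
      using assms(2) r unfolding connected_ring_def by auto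
  qed
  have copy_le: "alg_degree ?S (base_change R B \<phi> ?S f) (base_change_map R B \<phi> ?S f) \<le> ?g"
    using S.is_cring R.noetherian_image_ring[OF assms(3) f] S_conn f_hom
    by (rule alg_degree_le_geometric_degree)
  note inv_hom = R.image_ring_inv_hom[OF f]
  have inv_f: "inv_into (carrier R) f (f r) = r" if "r \<in> carrier R" for r
    using f that by simp
  have le1: "alg_degree R B \<phi> \<le> 1" if "?g \<le> 1"
    using base_change_retract_degree(1)[OF inv_hom inv_f] copy_le that by auto
  have le2: "alg_degree R B \<phi> \<le> 2" if "?g \<le> 2"
    using base_change_retract_degree(2)[OF inv_hom inv_f] copy_le that by auto
  have base_changes: "base_change_setup R B \<phi> S h" if "cring S" "h \<in> ring_hom R S"
    for S :: "('r + nat + 's) ring" and h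
    using that central_map_axioms
    by (intro base_change_setup.intro base_change_setup_axioms.intro)
  \<comment> \<open>This excludes the bound 1 for the degree when it fails for the geometric degree:
    if \<open>B\<close> is all of R, every base change consists of scalars.\<close>
  have ge1: "?g \<le> 1" if "alg_degree R B \<phi> \<le> 1"
  proof (rule geometric_degree_le)
    fix S :: "('r + nat + 's) ring" and h
    assume "cring S" "h \<in> ring_hom R S"
    then interpret T: base_change_setup R B \<phi> S h
      by (rule base_changes)
    show "alg_degree S (base_change R B \<phi> S h) (base_change_map R B \<phi> S h) \<le> 1"
      using T.base_change_scalars that
      unfolding alg_degree_le_1 central_map.alg_degree_le_1[OF T.base_change_central] .
  qed
  have ge2: "?g \<le> 2" if "standard_involution R B \<phi> \<sigma>" for \<sigma>
  proof (rule geometric_degree_le)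
    fix S :: "('r + nat + 's) ring" and h
    assume "cring S" "h \<in> ring_hom R S"
    then interpret T: base_change_setup R B \<phi> S h
      by (rule base_changes)
    show "alg_degree S (base_change R B \<phi> S h) (base_change_map R B \<phi> S h) \<le> 2"
      using that by (rule T.base_change_standard_involution)
  qed
  have involution: "\<exists>\<sigma>. standard_involution R B \<phi> \<sigma>" if deg: "alg_degree R B \<phi> \<le> 2"
  proof -
    obtain A :: "'b set" and e F where "projective_algebra R B \<phi> A e F"
      using projective_algebra_exists[OF assms(4-6)] by blast
    moreover obtain a where "a \<in> carrier R" "nonzerodivisor R (a \<otimes>\<^bsub>R\<^esub> (a \<ominus>\<^bsub>R\<^esub> \<one>\<^bsub>R\<^esub>))"
      using assms(8) by blast
    ultimately have "quadratic_algebra R B \<phi> A e F a"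
      using deg unfolding alg_degree_le_2
      by (intro quadratic_algebra.intro quadratic_algebra_axioms.intro) auto
    then show ?thesis
      by (rule quadratic_algebra.standard_involution_exists)
  qed
  \<comment> \<open>Either degree is at most 1 exactly when \<open>B\<close> equals R. For the bound
    2 the implications form a cycle: degree, involution, geometric degree, degree.\<close>
  show ?thesis
    unfolding enat_eq_2_iff alg_degree_le_1[symmetric]
    using le1 le2 ge1 ge2 involution by blast
qed

end
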